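(* For every constant $\delta>0$ there is $n_0$ such that for all $n\ge n_0$: (i) there is an instance of non-uniform SparsestCut on at most $n$ vertices whose integrality gap with respect to the SparsestCut SDP relaxation is at least $(\log\log n)^{1/6-\delta}$, and (ii) there is an instance of non-uniform BalancedEdge-Separator on at most $n$ vertices whose integrality gap with respect to the BalancedEdge-Separator SDP relaxation is at least $(\log\log n)^{1/6-\delta}$. Both relaxations include the triangle inequality constraints.
   Context: Instances are complete graphs on a vertex set $V$ with edge weights ${\rm wt}(e)\ge0$ and demands ${\rm dem}(e)\ge0$; $E(S,\overline S)$ denotes edges with exactly one endpoint in $S$. SparsestCut: minimize the sparsity $\sum_{e\in E(S,\overline S)}{\rm wt}(e)/\sum_{e\in E(S,\overline S)}{\rm dem}(e)$ over non-trivial cuts; its SDP relaxation minimizes $\frac14\sum_{e\{x,y\}}{\rm wt}(e)\|v_x-v_y\|^2$ subject to $\|v_x-v_y\|^2+\|v_y-v_z\|^2\ge\|v_x-v_z\|^2$ for all $x,y,z$ and $\frac14\sum_{e\{x,y\}}{\rm dem}(e)\|v_x-v_y\|^2=1$; the integrality gap is the ratio of the minimum sparsity to the SDP optimum. BalancedEdge-Separator: additionally a balance parameter $B$ with $D/6\le B\le D/2$, $D=\sum_e{\rm dem}(e)$; a non-trivial cut is $B'$-balanced if its crossing demand is at least $B'$. Its SDP relaxation minimizes $\frac14\sum_{e\{x,y\}}{\rm wt}(e)\|v_x-v_y\|^2$ subject to $\|v_x\|^2=1$, the triangle inequalities above, and $\frac14\sum_{e\{x,y\}}{\rm dem}(e)\|v_x-v_y\|^2\ge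 B$; the integrality gap is $\alpha/\gamma$ where $\gamma$ is the SDP optimum and $\alpha$ the minimum crossing weight of a non-trivial $B/3$-balanced cut. *)

theory Defs
  imports Complex_Main "HOL-Library.Ramsey"
begin

text \<open>The edges of the complete graph on \<open>V\<close> are the two-element sets in \<^term>\<open>nsets V 2\<close>.\<close>

definition crossing :: "'a set \<Rightarrow> 'a set \<Rightarrow> 'a set set" where
  "crossing V S = {e \<in> nsets V 2. card (e \<inter> S) = 1}"

definition nontrivial_cuts :: "'a set \<Rightarrow> 'a set set" where
  "nontrivial_cuts V = {S. S \<subseteq> V \<and> S \<noteq> {} \<and> S \<noteq> V}"

definition total_demand :: "'a set \<Rightarrow> ('a set \<Rightarrow> real) \<Rightarrow> real" where
  "total_demand V dem = (\<Sum>e\<in>nsets V 2. dem e)"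

text \<open>Some demand has to be positive, since otherwise every sparsity has denominator \<open>0\<close> and
  the SparsestCut relaxation is infeasible.\<close>

definition sc_instance :: "'a set \<Rightarrow> ('a set \<Rightarrow> real) \<Rightarrow> ('a set \<Rightarrow> real) \<Rightarrow> bool" where
  "sc_instance V wt dem \<longleftrightarrow>
     finite V \<and> (\<forall>e\<in>nsets V 2. 0 \<le> wt e \<and> 0 \<le> dem e) \<and> 0 < total_demand V dem"

definition bes_instance ::
  "'a set \<Rightarrow> ('a set \<Rightarrow> real) \<Rightarrow> ('a set \<Rightarrow> real) \<Rightarrow> real \<Rightarrow> bool" where
  "bes_instance V wt dem B \<longleftrightarrow>
     sc_instance V wt dem \<and> total_demand V dem / 6 \<le> B \<and> B \<le> total_demand V dem / 2"

definition sparsity ::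
  "'a set \<Rightarrow> ('a set \<Rightarrow> real) \<Rightarrow> ('a set \<Rightarrow> real) \<Rightarrow> 'a set \<Rightarrow> real" where
  "sparsity V wt dem S = (\<Sum>e\<in>crossing V S. wt e) / (\<Sum>e\<in>crossing V S. dem e)"

text \<open>Cuts without crossing demand have infinite or undefined sparsity; they are left out of the
  minimum because division by \<open>0\<close> yields \<open>0\<close> here.\<close>

definition min_sparsity :: "'a set \<Rightarrow> ('a set \<Rightarrow> real) \<Rightarrow> ('a set \<Rightarrow> real) \<Rightarrow> real" where
  "min_sparsity V wt dem =
     (MIN S\<in>{S \<in> nontrivial_cuts V. 0 < (\<Sum>e\<in>crossing V S. dem e)}. sparsity V wt dem S)"

definition balanced_cuts :: "'a set \<Rightarrow> ('a set \<Rightarrow> real) \<Rightarrow> real \<Rightarrow> 'a set set" where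
  "balanced_cuts V dem B' = {S \<in> nontrivial_cuts V. B' \<le> (\<Sum>e\<in>crossing V S. dem e)}"

definition min_balanced_cut ::
  "'a set \<Rightarrow> ('a set \<Rightarrow> real) \<Rightarrow> ('a set \<Rightarrow> real) \<Rightarrow> real \<Rightarrow> real" where
  "min_balanced_cut V wt dem B' = (MIN S\<in>balanced_cuts V dem B'. \<Sum>e\<in>crossing V S. wt e)"

text \<open>A vector of \<open>\<real>\<^sup>d\<close> is a function on \<open>nat\<close> of which only the coordinates below \<open>d\<close> count.
  The dimension is not fixed: the relaxations range over all \<open>d\<close>.\<close>

definition sqnorm :: "nat \<Rightarrow> (nat \<Rightarrow> real) \<Rightarrow> real" where
  "sqnorm d u = (\<Sum>i<d. (u i)\<^sup>2)"

definition sqdist :: "nat \<Rightarrow> (nat \<Rightarrow> real) \<Rightarrow> (nat \<Rightarrow> real) \<Rightarrow> real" where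
  "sqdist d u w = sqnorm d (\<lambda>i. u i - w i)"

definition triangle_ineqs :: "'a set \<Rightarrow> nat \<Rightarrow> ('a \<Rightarrow> nat \<Rightarrow> real) \<Rightarrow> bool" where
  "triangle_ineqs V d v \<longleftrightarrow>
     (\<forall>x\<in>V. \<forall>y\<in>V. \<forall>z\<in>V. sqdist d (v x) (v z) \<le> sqdist d (v x) (v y) + sqdist d (v y) (v z))"

text \<open>An edge \<open>e\<close> equals \<open>{Min e, Max e}\<close>; the vertex order only serves to name its endpoints.\<close>

definition sdp_sum ::
  "'a::linorder set \<Rightarrow> ('a set \<Rightarrow> real) \<Rightarrow> nat \<Rightarrow> ('a \<Rightarrow> nat \<Rightarrow> real) \<Rightarrow> real" where
  "sdp_sum V c d v = 1/4 * (\<Sum>e\<in>nsets V 2. c e * sqdist d (v (Min e)) (v (Max e)))"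

definition sc_feasible ::
  "'a::linorder set \<Rightarrow> ('a set \<Rightarrow> real) \<Rightarrow> nat \<Rightarrow> ('a \<Rightarrow> nat \<Rightarrow> real) \<Rightarrow> bool" where
  "sc_feasible V dem d v \<longleftrightarrow> triangle_ineqs V d v \<and> sdp_sum V dem d v = 1"

definition bes_feasible ::
  "'a::linorder set \<Rightarrow> ('a set \<Rightarrow> real) \<Rightarrow> real \<Rightarrow> nat \<Rightarrow> ('a \<Rightarrow> nat \<Rightarrow> real) \<Rightarrow> bool" where
  "bes_feasible V dem B d v \<longleftrightarrow>
     (\<forall>x\<in>V. sqnorm d (v x) = 1) \<and> triangle_ineqs V d v \<and> B \<le> sdp_sum V dem d v"

definition sc_sdp_opt ::
  "'a::linorder set \<Rightarrow> ('a set \<Rightarrow> real) \<Rightarrow> ('a set \<Rightarrow> real) \<Rightarrow> real" where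
  "sc_sdp_opt V wt dem = Inf {sdp_sum V wt d v | d v. sc_feasible V dem d v}"

definition bes_sdp_opt ::
  "'a::linorder set \<Rightarrow> ('a set \<Rightarrow> real) \<Rightarrow> ('a set \<Rightarrow> real) \<Rightarrow> real \<Rightarrow> real" where
  "bes_sdp_opt V wt dem B = Inf {sdp_sum V wt d v | d v. bes_feasible V dem B d v}"

text \<open>If the SDP optimum is \<open>0\<close>, these quotients are \<open>0\<close>, so a positive lower bound on a gap
  entails a positive optimum.\<close>

definition sc_integrality_gap ::
  "'a::linorder set \<Rightarrow> ('a set \<Rightarrow> real) \<Rightarrow> ('a set \<Rightarrow> real) \<Rightarrow> real" where
  "sc_integrality_gap V wt dem = min_sparsity V wt dem / sc_sdp_opt V wt dem"

definition bes_integrality_gap ::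
  "'a::linorder set \<Rightarrow> ('a set \<Rightarrow> real) \<Rightarrow> ('a set \<Rightarrow> real) \<Rightarrow> real \<Rightarrow> real" where
  "bes_integrality_gap V wt dem B = min_balanced_cut V wt dem (B/3) / bes_sdp_opt V wt dem B"

end

theory Submission
  imports Defs "HOL-Analysis.Convex" "HOL-Real_Asymp.Real_Asymp"
begin

text \<open>Let \<open>N = 2\<^sup>k\<close> with \<open>k\<close> the size of a set \<open>A\<close>. The vertices are pairs \<open>(f, x)\<close> of sign functions
  on the subsets of \<open>A\<close>, and \<open>(f, x)\<close> is sent to the average of \<open>x\<^sub>S (f \<chi>\<^sub>S)\<^sup>\<otimes>\<^sup>2\<^sup>0\<close> over all characters \<open>\<chi>\<^sub>S\<close>, normalised
  to a unit vector. This vector is invariant under \<open>(f, x) \<mapsto> (f \<chi>\<^sub>T, x(\<cdot> + T))\<close>, it changes its sign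
  together with \<open>x\<close>, and a change of one of the \<open>2N\<close> signs moves it by a squared distance
  \<open>O(1/N)\<close>. With unit weight on the edges of the cube of all pairs, large weight inside the
  orbits and demand between \<open>(f, x)\<close> and \<open>(f, -x)\<close>, the relaxation therefore has value \<open>O(1)\<close>. A cheap
  cut is invariant, so all \<open>x\<close>-coordinates have the same influence, and the argument of Kahn,
  Kalai and Linial bounds the weight of the cut from below by \<open>log N\<close> times its demand. As the cube has
  \<open>2\<^sup>2\<^sup>N\<close> vertices, the gap is of order \<open>log log n\<close>, which is more than required.

  For the triangle inequality, a tensor power of a sign vector is again a sign vector, so that the
  terms coming from matching characters form a Hamming metric. The other terms are dominated by
  its slack, because the Fourier coefficients of functions close to a constant are small.\<close>

section \<open>Fourier analysis on the subsets of a finite set\<close>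

text \<open>The 20-fold tensor power is even, so it forgets the sign of \<open>f\<close> and cannot
  by itself supply antipodal points for the demand; the signs \<open>x\<close> enter linearly and
  do. The group permutes the \<open>x\<close>-coordinates transitively but only changes signs at the
  \<open>f\<close>-coordinates. So an invariant cut has equal influences in the
  \<open>x\<close>-directions, the demand flips exactly those, and the influence argument bounds
  only them. The vectors of an orbit coincide: its heavy edges cost the relaxation nothing, and no
  quotient of the cube has to be formed. The obstacle is the triangle inequality for squared
  distances with arbitrary \<open>x\<close>. Where a Hamming metric may have equality, a power of
  the similarities leaves a slack of the order of a product of two distances. This pays for the
  mismatched characters if the three functions are close after moves along orbits. If two of the
  three pairs are far apart, powers of 7/8 make their inner products small and a Lipschitz estimate
  suffices. As division by 0 yields 0, the value of the relaxation also has to be bounded away from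
  0; paths in the cube do this.\<close>

definition chi :: "'a set \<Rightarrow> 'a set \<Rightarrow> real" where
  "chi S T = (- 1) ^ card (S \<inter> T)"

text \<open>Expectation over the group of subsets of \<open>A\<close> under symmetric difference,
  which is its own dual, so that subsets index points and characters alike. The theory is applied at
  two levels: to \<open>A\<close>, for the functions \<open>f\<close> and \<open>x\<close>, and to
  \<open>cube A\<close>, for cuts of the vertex set.\<close>

definition avg :: "'a set \<Rightarrow> ('a set \<Rightarrow> real) \<Rightarrow> real" where
  "avg A f = (\<Sum>T\<in>Pow A. f T) / 2 ^ card A"

definition fourier :: "'a set \<Rightarrow> ('a set \<Rightarrow> real) \<Rightarrow> 'a set \<Rightarrow> real" where
  "fourier A f S = avg A (\<lambda>T. f T * chi S T)"

lemma chi_commute: "chi S T = chi T S"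
  by (simp add: chi_def Int_commute)

lemma chi_empty [simp]: "chi {} T = 1" "chi T {} = 1"
  by (simp_all add: chi_def)

lemma abs_chi [simp]: "\<bar>chi S T\<bar> = 1"
  by (simp add: chi_def power_abs)

lemma chi_sym_diff:
  assumes "finite S" "finite S'"
  shows "chi (sym_diff S S') T = chi S T * chi S' T"
proof -
  let ?a = "S \<inter> T" and ?b = "S' \<inter> T"
  have fin: "finite ?a" "finite ?b" using assms by auto
  have "sym_diff S S' \<inter> T = sym_diff ?a ?b" by auto
  then have "card (sym_diff S S' \<inter> T) = card (?a - ?b) + card (?b - ?a)"
    using fin by (simp add: card_Un_disjoint Int_commute)
      (metis card_Un_disjoint Diff_disjoint finite_Diff Int_Diff Int_commute inf.idem Int_assoc Int_empty_right)
  moreover have "card ?a = card (?a - ?b) + card (?a \<inter> ?b)"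
    using fin by (metis card_Diff_subset_Int card_mono diff_add finite_Int inf_le1)
  moreover have "card ?b = card (?b - ?a) + card (?a \<inter> ?b)"
    using fin by (metis card_Diff_subset_Int card_mono diff_add finite_Int inf_le1 Int_commute)
  ultimately have "card ?a + card ?b = card (sym_diff S S' \<inter> T) + 2 * card (?a \<inter> ?b)" by simp
  then have "(- 1 :: real) ^ (card ?a + card ?b) = (- 1) ^ card (sym_diff S S' \<inter> T)"
    by (simp add: power_add)
  then show ?thesis by (simp add: chi_def power_add)
qed

lemma chi_sym_diff_right:
  "finite T \<Longrightarrow> finite T' \<Longrightarrow> chi S (sym_diff T T') = chi S T * chi S T'"
  using chi_sym_diff[of T T' S] by (simp add: chi_commute)

lemma chi_singleton: "chi S {i} = (if i \<in> S then - 1 else 1)"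
  by (simp add: chi_def)

lemma sym_diff_cancel [simp]: "sym_diff (sym_diff S U) U = S"
  by auto

lemma bij_betw_sym_diff: "U \<subseteq> A \<Longrightarrow> bij_betw (\<lambda>T. sym_diff T U) (Pow A) (Pow A)"
  by (rule bij_betwI[where g = "\<lambda>T. sym_diff T U"]) auto

lemma sum_sym_diff:
  fixes f :: "'a set \<Rightarrow> 'b::comm_monoid_add"
  assumes "U \<subseteq> A"
  shows "(\<Sum>T\<in>Pow A. f (sym_diff T U)) = (\<Sum>T\<in>Pow A. f T)"
  using sum.reindex_bij_betw[OF bij_betw_sym_diff[OF assms]] .

lemma sum_sym_diff':
  fixes f :: "'a set \<Rightarrow> 'b::comm_monoid_add"
  assumes "U \<subseteq> A"
  shows "(\<Sum>T\<in>Pow A. f (sym_diff U T)) = (\<Sum>T\<in>Pow A. f T)"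
  using sum_sym_diff[OF assms, of f] by (simp add: Un_commute)

lemma avg_sym_diff: "U \<subseteq> A \<Longrightarrow> avg A (\<lambda>T. f (sym_diff T U)) = avg A f"
  by (simp add: avg_def sum_sym_diff)

lemma avg_cong: "(\<And>T. T \<subseteq> A \<Longrightarrow> f T = g T) \<Longrightarrow> avg A f = avg A g"
  by (simp add: avg_def)

lemma avg_mono: "(\<And>T. T \<subseteq> A \<Longrightarrow> f T \<le> g T) \<Longrightarrow> avg A f \<le> avg A g"
  unfolding avg_def by (intro divide_right_mono sum_mono) auto

lemma avg_nonneg: "(\<And>T. T \<subseteq> A \<Longrightarrow> 0 \<le> f T) \<Longrightarrow> 0 \<le> avg A f"
  unfolding avg_def by (intro divide_nonneg_nonneg sum_nonneg) auto

lemma avg_add: "avg A (\<lambda>T. f T + g T) = avg A f + avg A g"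
  by (simp add: avg_def sum.distrib add_divide_distrib)

lemma avg_diff: "avg A (\<lambda>T. f T - g T) = avg A f - avg A g"
  by (simp add: avg_def sum_subtractf diff_divide_distrib)

lemma avg_minus: "avg A (\<lambda>T. - f T) = - avg A f"
  by (simp add: avg_def sum_negf)

lemma avg_cmult: "avg A (\<lambda>T. c * f T) = c * avg A f"
  by (simp add: avg_def sum_distrib_left)

lemma avg_sum: "avg A (\<lambda>T. \<Sum>i\<in>I. f i T) = (\<Sum>i\<in>I. avg A (f i))"
  unfolding avg_def by (subst sum.swap) (simp add: sum_divide_distrib)

lemma avg_const: "finite A \<Longrightarrow> avg A (\<lambda>T. c) = c"
  by (simp add: avg_def card_Pow)

lemma abs_avg_le: "\<bar>avg A f\<bar> \<le> avg A (\<lambda>T. \<bar>f T\<bar>)"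
  unfolding avg_def by (simp add: divide_right_mono)

lemma avg_Cauchy_Schwarz: "(avg A (\<lambda>T. f T * g T))\<^sup>2 \<le> avg A (\<lambda>T. (f T)\<^sup>2) * avg A (\<lambda>T. (g T)\<^sup>2)"
proof -
  have "(\<Sum>T\<in>Pow A. f T * g T)\<^sup>2 \<le> (\<Sum>T\<in>Pow A. (f T)\<^sup>2) * (\<Sum>T\<in>Pow A. (g T)\<^sup>2)"
    by (rule Cauchy_Schwarz_ineq_sum)
  then have "(\<Sum>T\<in>Pow A. f T * g T)\<^sup>2 / (2 ^ card A)\<^sup>2
      \<le> (\<Sum>T\<in>Pow A. (f T)\<^sup>2) * (\<Sum>T\<in>Pow A. (g T)\<^sup>2) / (2 ^ card A)\<^sup>2"
    by (rule divide_right_mono) simp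
  then show ?thesis by (simp add: avg_def power_divide power2_eq_square)
qed

lemma avg_chi:
  assumes "finite A" "S \<subseteq> A"
  shows "avg A (chi S) = of_bool (S = {})"
proof (cases "S = {}")
  case True
  then show ?thesis using avg_const[OF assms(1), of 1] by (simp add: avg_def)
next
  case False
  then obtain i where i: "i \<in> S" by auto
  have "avg A (chi S) = avg A (\<lambda>T. chi S (sym_diff T {i}))"
    using i assms by (intro avg_sym_diff[symmetric]) auto
  also have "\<dots> = avg A (\<lambda>T. - chi S T)"
  proof (rule avg_cong)
    fix T assume "T \<subseteq> A"
    then have "finite T" using assms finite_subset by blast
    then show "chi S (sym_diff T {i}) = - chi S T"
      using i by (subst chi_sym_diff_right) (auto simp: chi_singleton)
  qed
  finally show ?thesis using False by (simp add: avg_minus)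
qed

lemma fourier_inversion:
  assumes "finite A" "T \<subseteq> A"
  shows "f T = (\<Sum>S\<in>Pow A. fourier A f S * chi S T)"
proof -
  have "(\<Sum>S\<in>Pow A. fourier A f S * chi S T)
      = (\<Sum>S\<in>Pow A. avg A (\<lambda>T'. f T' * (chi S T' * chi S T)))"
    by (simp add: fourier_def avg_def sum_distrib_right sum_divide_distrib mult.assoc)
  also have "\<dots> = avg A (\<lambda>T'. \<Sum>S\<in>Pow A. f T' * (chi S T' * chi S T))"
    by (simp add: avg_sum)
  also have "\<dots> = avg A (\<lambda>T'. f T' * (2 ^ card A * of_bool (T' = T)))"
  proof (rule avg_cong)
    fix T' assume T': "T' \<subseteq> A"
    have fin: "finite T" "finite T'" using assms T' finite_subset by blast+
    have "(\<Sum>S\<in>Pow A. f T' * (chi S T' * chi S T)) = f T' * (\<Sum>S\<in>Pow A. chi (sym_diff T' T) S)"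
      unfolding sum_distrib_left
      by (intro sum.cong refl) (simp only: chi_sym_diff[OF fin(2,1)] chi_commute[of _ T] chi_commute[of _ T'])
    also have "(\<Sum>S\<in>Pow A. chi (sym_diff T' T) S) = 2 ^ card A * avg A (chi (sym_diff T' T))"
      by (simp add: avg_def)
    also have "avg A (chi (sym_diff T' T)) = of_bool (sym_diff T' T = {})"
      using assms T' by (intro avg_chi) auto
    also have "(sym_diff T' T = {}) = (T' = T)" by auto
    finally show "(\<Sum>S\<in>Pow A. f T' * (chi S T' * chi S T)) = f T' * (2 ^ card A * of_bool (T' = T))" .
  qed
  also have "\<dots> = (\<Sum>T'\<in>Pow A. if T' = T then f T' else 0)"
    unfolding avg_def sum_divide_distrib by (intro sum.cong) auto
  also have "\<dots> = f T" using assms by (subst sum.delta) auto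
  finally show ?thesis by simp
qed

lemma plancherel:
  assumes "finite A"
  shows "avg A (\<lambda>T. f T * g T) = (\<Sum>S\<in>Pow A. fourier A f S * fourier A g S)"
proof -
  have "avg A (\<lambda>T. f T * g T) = avg A (\<lambda>T. \<Sum>S\<in>Pow A. fourier A f S * (g T * chi S T))"
  proof (rule avg_cong)
    fix T assume "T \<subseteq> A"
    show "f T * g T = (\<Sum>S\<in>Pow A. fourier A f S * (g T * chi S T))"
      unfolding fourier_inversion[OF assms \<open>T \<subseteq> A\<close>, of f] sum_distrib_right
      by (intro sum.cong) (auto simp: mult_ac)
  qed
  also have "\<dots> = (\<Sum>S\<in>Pow A. fourier A f S * fourier A g S)"
    by (simp add: avg_sum avg_cmult fourier_def)
  finally show ?thesis .
qed

lemma parseval: "finite A \<Longrightarrow> avg A (\<lambda>T. (f T)\<^sup>2) = (\<Sum>S\<in>Pow A. (fourier A f S)\<^sup>2)"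
  by (simp add: power2_eq_square plancherel)

lemma fourier_polynomial:
  assumes "finite A" "\<S> \<subseteq> Pow A" "R \<subseteq> A"
  shows "fourier A (\<lambda>T. \<Sum>S\<in>\<S>. c S * chi S T) R = (if R \<in> \<S> then c R else 0)"
proof -
  have fin: "finite \<S>" using assms finite_subset by blast
  have "fourier A (\<lambda>T. \<Sum>S\<in>\<S>. c S * chi S T) R = (\<Sum>S\<in>\<S>. c S * avg A (\<lambda>T. chi S T * chi R T))"
    by (simp add: fourier_def sum_distrib_right avg_sum mult.assoc avg_cmult)
  also have "\<dots> = (\<Sum>S\<in>\<S>. c S * of_bool (S = R))"
  proof (rule sum.cong)
    fix S assume S: "S \<in> \<S>"
    then have "S \<subseteq> A" using assms by auto
    then have fS: "finite S" "finite R" using assms finite_subset by blast+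
    have "avg A (\<lambda>T. chi S T * chi R T) = avg A (chi (sym_diff S R))"
      using fS by (intro avg_cong) (simp only: chi_sym_diff)
    also have "\<dots> = of_bool (sym_diff S R = {})"
      using assms \<open>S \<subseteq> A\<close> by (intro avg_chi) auto
    also have "(sym_diff S R = {}) = (S = R)" by auto
    finally show "c S * avg A (\<lambda>T. chi S T * chi R T) = c S * of_bool (S = R)" by simp
  qed simp
  also have "\<dots> = (\<Sum>S\<in>\<S>. if S = R then c S else 0)" by (intro sum.cong) auto
  also have "\<dots> = (if R \<in> \<S> then c R else 0)" using fin by (simp add: sum.delta)
  finally show ?thesis .
qed

section \<open>Hypercontractivity and influences\<close>

lemma avg_insert:
  assumes "finite A" "i \<notin> A"
  shows "avg (insert i A) f = avg A (\<lambda>T. (f T + f (insert i T)) / 2)"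
proof -
  have "(\<Sum>T\<in>Pow (insert i A). f T) = (\<Sum>T\<in>Pow A. f T) + (\<Sum>T\<in>insert i ` Pow A. f T)"
    unfolding Pow_insert using assms by (intro sum.union_disjoint) auto
  also have "(\<Sum>T\<in>insert i ` Pow A. f T) = (\<Sum>T\<in>Pow A. f (insert i T))"
    using assms by (subst sum.reindex) (auto intro!: inj_onI)
  finally show ?thesis using assms
    by (simp add: avg_def sum.distrib add_divide_distrib flip: sum_divide_distrib)
qed

text \<open>Hypercontractivity in degree \<open>d\<close>, by induction on the coordinates. On the
  two halves of the cube the polynomial is \<open>g + h\<close> and \<open>g - h\<close>, where
  \<open>h\<close> has degree at most \<open>d - 1\<close>, and the odd powers of \<open>h\<close>
  cancel. By Cauchy-Schwarz the mixed term is at most 6 * 3 * 9 ^ (d - 1) = 2 * 9 ^ d times the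
  product of the second moments, which is just what completes the square.\<close>

lemma bonami:
  fixes c :: "'a set \<Rightarrow> real"
  assumes "finite A"
  defines "p \<equiv> \<lambda>c d T. \<Sum>S | S \<subseteq> A \<and> card S \<le> d. c S * chi S T"
  shows "avg A (\<lambda>T. (p c d T) ^ 4) \<le> 9 ^ d * (avg A (\<lambda>T. (p c d T)\<^sup>2))\<^sup>2"
  using assms(1) unfolding p_def
proof (induction A arbitrary: c d rule: finite_induct)
  case empty
  have "{S. S \<subseteq> {} \<and> card S \<le> d} = {{} :: 'a set}" by auto
  then have "avg {} (\<lambda>T. (\<Sum>S | S \<subseteq> {} \<and> card S \<le> d. c S * chi S T) ^ 4) = 1 * (c {}) ^ 4"
    "avg {} (\<lambda>T. (\<Sum>S | S \<subseteq> {} \<and> card S \<le> d. c S * chi S T)\<^sup>2) = (c {})\<^sup>2"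
    by (simp_all add: avg_def)
  moreover have "1 * (c {}) ^ 4 \<le> 9 ^ d * (c {}) ^ 4" by (intro mult_right_mono) auto
  ultimately show ?case by (simp flip: power_mult)
next
  case (insert i A)
  let ?P = "\<lambda>A c d T. \<Sum>S | S \<subseteq> A \<and> card S \<le> d. c S * chi S T"
  define g where "g = ?P A c d"
  \<comment> \<open>The condition \<open>Suc (card S) \<le> d\<close> makes \<open>h\<close> vanish
    for \<open>d = 0\<close>; a bound by the truncated \<open>d - 1\<close> would keep the constant
    term.\<close>
  define h where "h = (\<lambda>T. \<Sum>S | S \<subseteq> A \<and> Suc (card S) \<le> d. c (insert i S) * chi S T)"
  have fA: "finite S" if "S \<subseteq> A" for S using that insert finite_subset by blast
  have split: "?P (insert i A) c d T
      = (\<Sum>S | S \<subseteq> A \<and> card S \<le> d. c S * chi S T)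
      + (\<Sum>S | S \<subseteq> A \<and> Suc (card S) \<le> d. c (insert i S) * chi (insert i S) T)" for T
  proof -
    have eq: "{S. S \<subseteq> insert i A \<and> card S \<le> d}
        = {S. S \<subseteq> A \<and> card S \<le> d} \<union> insert i ` {S. S \<subseteq> A \<and> Suc (card S) \<le> d}"
    proof (intro set_eqI iffI)
      fix S assume S: "S \<in> {S. S \<subseteq> insert i A \<and> card S \<le> d}"
      show "S \<in> {S. S \<subseteq> A \<and> card S \<le> d} \<union> insert i ` {S. S \<subseteq> A \<and> Suc (card S) \<le> d}"
      proof (cases "i \<in> S")
        case True
        have "finite S" using S insert.hyps finite_subset[of S "insert i A"] by auto
        then have "card S = Suc (card (S - {i}))" using True card_Suc_Diff1 by metis
        moreover have "S - {i} \<subseteq> A" using S by auto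
        ultimately have "S - {i} \<in> {S. S \<subseteq> A \<and> Suc (card S) \<le> d}" using S by simp
        moreover have "S = insert i (S - {i})" using True by auto
        ultimately show ?thesis by (intro UnI2 image_eqI)
      next
        case False then show ?thesis using S by auto
      qed
    next
      fix S assume "S \<in> {S. S \<subseteq> A \<and> card S \<le> d} \<union> insert i ` {S. S \<subseteq> A \<and> Suc (card S) \<le> d}"
      then show "S \<in> {S. S \<subseteq> insert i A \<and> card S \<le> d}"
      proof
        assume "S \<in> insert i ` {S. S \<subseteq> A \<and> Suc (card S) \<le> d}"
        then obtain S' where S': "S = insert i S'" "S' \<subseteq> A" "Suc (card S') \<le> d" by auto
        then have "i \<notin> S'" using insert by auto
        then show ?thesis using S' fA by auto
      qed auto
    qed
    have "inj_on (insert i) {S. S \<subseteq> A \<and> Suc (card S) \<le> d}"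
      using insert.hyps by (intro inj_onI) auto
    then show ?thesis
      unfolding eq using insert.hyps
      by (subst sum.union_disjoint) (auto simp: sum.reindex)
  qed
  have chi1: "chi (insert i S) T = chi S T" "chi (insert i S) (insert i T) = - chi S T"
    "chi S (insert i T) = chi S T" if "S \<subseteq> A" "T \<subseteq> A" for S T
  proof -
    have n: "i \<notin> S" "i \<notin> T" using that insert.hyps by auto
    then show "chi (insert i S) T = chi S T" "chi S (insert i T) = chi S T"
      by (simp_all add: chi_def)
    have "insert i S \<inter> insert i T = insert i (S \<inter> T)" by auto
    then show "chi (insert i S) (insert i T) = - chi S T"
      using n fA[OF that(1)] by (simp add: chi_def)
  qed
  have p0: "?P (insert i A) c d T = g T + h T" if "T \<subseteq> A" for T
    unfolding split g_def h_def using chi1 that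
    by (intro arg_cong2[of _ _ _ _ "(+)"] sum.cong) auto
  have p1: "?P (insert i A) c d (insert i T) = g T - h T" if "T \<subseteq> A" for T
  proof -
    have "(\<Sum>S | S \<subseteq> A \<and> Suc (card S) \<le> d. c (insert i S) * chi (insert i S) (insert i T)) = - h T"
      unfolding h_def sum_negf[symmetric] using chi1 that by (intro sum.cong) auto
    moreover have "(\<Sum>S | S \<subseteq> A \<and> card S \<le> d. c S * chi S (insert i T)) = g T"
      unfolding g_def using chi1 that by (intro sum.cong) auto
    ultimately show ?thesis unfolding split by simp
  qed
  have e4: "avg (insert i A) (\<lambda>T. (?P (insert i A) c d T) ^ 4)
      = avg A (\<lambda>T. g T ^ 4) + 6 * avg A (\<lambda>T. (g T)\<^sup>2 * (h T)\<^sup>2) + avg A (\<lambda>T. h T ^ 4)"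
  proof -
    have "avg (insert i A) (\<lambda>T. (?P (insert i A) c d T) ^ 4)
        = avg A (\<lambda>T. g T ^ 4 + 6 * ((g T)\<^sup>2 * (h T)\<^sup>2) + h T ^ 4)"
      unfolding avg_insert[OF insert.hyps]
      by (rule avg_cong) (simp add: p0 p1 power4_eq_xxxx power2_eq_square algebra_simps)
    then show ?thesis by (simp only: avg_add avg_cmult)
  qed
  have e2: "avg (insert i A) (\<lambda>T. (?P (insert i A) c d T)\<^sup>2)
      = avg A (\<lambda>T. (g T)\<^sup>2) + avg A (\<lambda>T. (h T)\<^sup>2)"
  proof -
    have "avg (insert i A) (\<lambda>T. (?P (insert i A) c d T)\<^sup>2) = avg A (\<lambda>T. (g T)\<^sup>2 + (h T)\<^sup>2)"
      unfolding avg_insert[OF insert.hyps]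
      by (rule avg_cong) (simp add: p0 p1 power2_eq_square algebra_simps)
    then show ?thesis by (simp only: avg_add)
  qed
  let ?G = "avg A (\<lambda>T. (g T)\<^sup>2)" and ?H = "avg A (\<lambda>T. (h T)\<^sup>2)"
  have G0: "0 \<le> ?G" and H0: "0 \<le> ?H" by (simp_all add: avg_nonneg)
  have g4: "avg A (\<lambda>T. g T ^ 4) \<le> 9 ^ d * ?G\<^sup>2"
    using insert.IH[of c d] unfolding g_def .
  show ?case
  proof (cases d)
    case 0
    then have "h = (\<lambda>_. 0)" by (auto simp: h_def)
    then have "avg A (\<lambda>T. (g T)\<^sup>2 * (h T)\<^sup>2) = 0" "avg A (\<lambda>T. h T ^ 4) = 0" "?H = 0"
      by (simp_all add: avg_def)
    then show ?thesis unfolding e4 e2 using g4 by simp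
  next
    case (Suc d')
    have h4: "avg A (\<lambda>T. h T ^ 4) \<le> 9 ^ d' * ?H\<^sup>2"
      using insert.IH[of "\<lambda>S. c (insert i S)" d'] unfolding h_def Suc by simp
    have "(avg A (\<lambda>T. (g T)\<^sup>2 * (h T)\<^sup>2))\<^sup>2 \<le> avg A (\<lambda>T. g T ^ 4) * avg A (\<lambda>T. h T ^ 4)"
      using avg_Cauchy_Schwarz[of A "\<lambda>T. (g T)\<^sup>2" "\<lambda>T. (h T)\<^sup>2"] by (simp flip: power_mult)
    also have "\<dots> \<le> (9 ^ d * ?G\<^sup>2) * (9 ^ d' * ?H\<^sup>2)"
      using g4 h4 by (intro mult_mono avg_nonneg) (auto simp: zero_le_mult_iff)
    also have "\<dots> = (3 * 9 ^ d' * ?G * ?H)\<^sup>2"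
      unfolding Suc by (simp add: power2_eq_square)
    finally have "avg A (\<lambda>T. (g T)\<^sup>2 * (h T)\<^sup>2) \<le> 3 * 9 ^ d' * ?G * ?H"
      using G0 H0 by (rule_tac power2_le_imp_le) auto
    then have "avg A (\<lambda>T. g T ^ 4) + 6 * avg A (\<lambda>T. (g T)\<^sup>2 * (h T)\<^sup>2) + avg A (\<lambda>T. h T ^ 4)
       \<le> 9 ^ d * ?G\<^sup>2 + 6 * (3 * 9 ^ d' * ?G * ?H) + 9 ^ d' * ?H\<^sup>2"
      using g4 h4 by linarith
    also have "\<dots> \<le> 9 ^ d * ?G\<^sup>2 + 6 * (3 * 9 ^ d' * ?G * ?H) + 9 ^ d * ?H\<^sup>2"
      unfolding Suc by simp
    also have "\<dots> = 9 ^ d * (?G + ?H)\<^sup>2"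
      unfolding Suc by (simp add: power2_eq_square algebra_simps)
    finally show ?thesis unfolding e4 e2 .
  qed
qed

text \<open>Half the difference of two signs squares to 0 or 1, so for a sign function this is the
  probability that flipping \<open>i\<close> changes the value: up to normalisation, the weight that
  a cut collects in direction \<open>i\<close>.\<close>

definition influence :: "'a set \<Rightarrow> ('a set \<Rightarrow> real) \<Rightarrow> 'a \<Rightarrow> real" where
  "influence A F i = avg A (\<lambda>T. ((F T - F (sym_diff T {i})) / 2)\<^sup>2)"

lemma fourier_sym_diff:
  assumes "finite A" "U \<subseteq> A"
  shows "fourier A (\<lambda>T. F (sym_diff T U)) S = chi S U * fourier A F S"
proof -
  have "fourier A (\<lambda>T. F (sym_diff T U)) S = avg A (\<lambda>T. F (sym_diff T U) * chi S (sym_diff (sym_diff T U) U))"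
    unfolding fourier_def by simp
  also have "\<dots> = avg A (\<lambda>T. F T * chi S (sym_diff T U))"
    by (rule avg_sym_diff[OF assms(2), of "\<lambda>T. F T * chi S (sym_diff T U)"])
  also have "\<dots> = avg A (\<lambda>T. chi S U * (F T * chi S T))"
    using assms finite_subset by (intro avg_cong) (subst chi_sym_diff_right, blast, blast, simp)
  finally show ?thesis by (simp add: avg_cmult fourier_def)
qed

lemma fourier_flip_difference:
  assumes "finite A" "U \<subseteq> A"
  shows "fourier A (\<lambda>T. (F T - F (sym_diff T U)) / 2) S = (1 - chi S U) / 2 * fourier A F S"
proof -
  have "fourier A (\<lambda>T. (F T - F (sym_diff T U)) / 2) S
      = (1/2) * (fourier A F S - fourier A (\<lambda>T. F (sym_diff T U)) S)"
    unfolding fourier_def avg_cmult[symmetric] avg_diff[symmetric]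
    by (rule avg_cong) (simp add: field_simps)
  then show ?thesis using fourier_sym_diff[OF assms, of F S] by (simp add: algebra_simps)
qed

lemma influence_fourier:
  assumes "finite A" "i \<in> A"
  shows "influence A F i = (\<Sum>S | S \<subseteq> A \<and> i \<in> S. (fourier A F S)\<^sup>2)"
proof -
  have "influence A F i = (\<Sum>S\<in>Pow A. ((1 - chi S {i}) / 2 * fourier A F S)\<^sup>2)"
    unfolding influence_def using assms by (simp add: parseval fourier_flip_difference)
  also have "\<dots> = (\<Sum>S\<in>Pow A. if i \<in> S then (fourier A F S)\<^sup>2 else 0)"
    by (intro sum.cong) (auto simp: chi_singleton)
  also have "\<dots> = (\<Sum>S\<in>Pow A \<inter> {S. i \<in> S}. (fourier A F S)\<^sup>2)"
    using assms by (subst sum.inter_restrict) auto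
  also have "Pow A \<inter> {S. i \<in> S} = {S. S \<subseteq> A \<and> i \<in> S}" by auto
  finally show ?thesis .
qed

lemma sum_influence:
  assumes "finite A"
  shows "(\<Sum>i\<in>A. influence A F i) = (\<Sum>S\<in>Pow A. real (card S) * (fourier A F S)\<^sup>2)"
proof -
  have "(\<Sum>i\<in>A. influence A F i) = (\<Sum>i\<in>A. \<Sum>S\<in>Pow A. if i \<in> S then (fourier A F S)\<^sup>2 else 0)"
  proof (rule sum.cong)
    fix i assume "i \<in> A"
    have "{S. S \<subseteq> A \<and> i \<in> S} = Pow A \<inter> {S. i \<in> S}" by auto
    then show "influence A F i = (\<Sum>S\<in>Pow A. if i \<in> S then (fourier A F S)\<^sup>2 else 0)"
      unfolding influence_fourier[OF assms \<open>i \<in> A\<close>] using assms by (simp add: sum.inter_restrict)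
  qed simp
  also have "\<dots> = (\<Sum>S\<in>Pow A. \<Sum>i\<in>A. if i \<in> S then (fourier A F S)\<^sup>2 else 0)"
    by (rule sum.swap)
  also have "\<dots> = (\<Sum>S\<in>Pow A. real (card S) * (fourier A F S)\<^sup>2)"
  proof (rule sum.cong)
    fix S assume "S \<in> Pow A"
    then have "A \<inter> S = S" by auto
    then show "(\<Sum>i\<in>A. if i \<in> S then (fourier A F S)\<^sup>2 else 0) = real (card S) * (fourier A F S)\<^sup>2"
      using assms by (simp flip: sum.inter_restrict)
  qed simp
  finally show ?thesis .
qed

text \<open>With \<open>D\<close> the discrete derivative of \<open>F\<close> along \<open>i\<close> and \<open>g\<close> its part of degree at most
  \<open>d\<close>, the values of \<open>D\<close> in \<open>{-1, 0, 1}\<close> give \<open>D = D\<^sup>3\<close>, so that two applications of Cauchy-Schwarz replace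
  the Hoelder inequality for the exponents 4 and 4/3.\<close>

lemma low_degree_influence:
  assumes "finite A" "i \<in> A" and F: "\<And>T. T \<subseteq> A \<Longrightarrow> F T \<in> {- 1, 1}"
  shows "(\<Sum>S | S \<subseteq> A \<and> i \<in> S \<and> card S \<le> d. (fourier A F S)\<^sup>2)
    \<le> 3 ^ d * (influence A F i * sqrt (influence A F i))"
proof -
  let ?\<S> = "{S. S \<subseteq> A \<and> i \<in> S \<and> card S \<le> d}"
  define W where "W = (\<Sum>S\<in>?\<S>. (fourier A F S)\<^sup>2)"
  define D where "D = (\<lambda>T. (F T - F (sym_diff T {i})) / 2)"
  define g where "g = (\<lambda>T. \<Sum>S\<in>?\<S>. fourier A F S * chi S T)"
  define \<tau> where "\<tau> = influence A F i"
  have W0: "0 \<le> W" unfolding W_def by (intro sum_nonneg) auto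
  have \<tau>0: "0 \<le> \<tau>" unfolding \<tau>_def influence_def by (intro avg_nonneg) auto
  have ftg: "fourier A g S = (if S \<in> ?\<S> then fourier A F S else 0)" if "S \<in> Pow A" for S
    unfolding g_def using that assms(1) by (subst fourier_polynomial) auto
  have ftD: "fourier A D S = (if i \<in> S then fourier A F S else 0)" for S
    unfolding D_def using assms by (subst fourier_flip_difference) (auto simp: chi_singleton)
  have Weq: "(\<Sum>S\<in>Pow A. if S \<in> ?\<S> then (fourier A F S)\<^sup>2 else 0) = W"
  proof -
    have "?\<S> = Pow A \<inter> {S. S \<in> ?\<S>}" by auto
    then show ?thesis
      unfolding W_def using sum.inter_restrict[of "Pow A" "\<lambda>S. (fourier A F S)\<^sup>2" "{S. S \<in> ?\<S>}"] assms(1)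
      by simp
  qed
  have gD: "avg A (\<lambda>T. g T * D T) = W"
    unfolding plancherel[OF assms(1)] Weq[symmetric]
    by (intro sum.cong) (auto simp: ftg ftD power2_eq_square)
  have gg: "avg A (\<lambda>T. (g T)\<^sup>2) = W"
    unfolding parseval[OF assms(1)] Weq[symmetric]
    by (intro sum.cong) (auto simp: ftg)
  have geq: "g = (\<lambda>T. \<Sum>S | S \<subseteq> A \<and> card S \<le> d. (if i \<in> S then fourier A F S else 0) * chi S T)"
  proof
    fix T
    have "(\<Sum>S | S \<subseteq> A \<and> card S \<le> d. (if i \<in> S then fourier A F S else 0) * chi S T)
        = (\<Sum>S | S \<subseteq> A \<and> card S \<le> d. if i \<in> S then fourier A F S * chi S T else 0)"
      by (intro sum.cong) auto
    also have "\<dots> = (\<Sum>S\<in>{S. S \<subseteq> A \<and> card S \<le> d} \<inter> {S. i \<in> S}. fourier A F S * chi S T)"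
      using assms(1) by (subst sum.inter_restrict) auto
    also have "{S. S \<subseteq> A \<and> card S \<le> d} \<inter> {S. i \<in> S} = ?\<S>" by auto
    finally show "g T = (\<Sum>S | S \<subseteq> A \<and> card S \<le> d. (if i \<in> S then fourier A F S else 0) * chi S T)"
      by (simp add: g_def)
  qed
  have g4: "avg A (\<lambda>T. g T ^ 4) \<le> 9 ^ d * W\<^sup>2"
    using bonami[OF assms(1), of "\<lambda>S. if i \<in> S then fourier A F S else 0" d] gg unfolding geq by simp
  have Dval: "D T \<in> {- 1, 0, 1}" if "T \<subseteq> A" for T
  proof -
    have "sym_diff T {i} \<subseteq> A" using that assms(2) by auto
    from F[OF this] F[OF that] show ?thesis unfolding D_def by auto
  qed
  have D2: "avg A (\<lambda>T. (D T)\<^sup>2) = \<tau>" unfolding D_def \<tau>_def influence_def ..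
  have D4: "avg A (\<lambda>T. ((D T)\<^sup>2)\<^sup>2) = \<tau>"
    unfolding D2[symmetric] by (intro avg_cong) (use Dval in force)
  have "W\<^sup>2 = (avg A (\<lambda>T. (g T * D T) * (D T)\<^sup>2))\<^sup>2"
  proof -
    have "avg A (\<lambda>T. g T * D T) = avg A (\<lambda>T. (g T * D T) * (D T)\<^sup>2)"
      using Dval by (intro avg_cong) force
    then show ?thesis using gD by simp
  qed
  also have "\<dots> \<le> avg A (\<lambda>T. (g T * D T)\<^sup>2) * avg A (\<lambda>T. ((D T)\<^sup>2)\<^sup>2)"
    by (rule avg_Cauchy_Schwarz)
  finally have s1: "W\<^sup>2 \<le> avg A (\<lambda>T. (g T * D T)\<^sup>2) * \<tau>" by (simp only: D4)
  have s2: "(avg A (\<lambda>T. (g T * D T)\<^sup>2))\<^sup>2 \<le> 9 ^ d * W\<^sup>2 * \<tau>"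
  proof -
    have "(avg A (\<lambda>T. (g T * D T)\<^sup>2))\<^sup>2 = (avg A (\<lambda>T. (g T)\<^sup>2 * (D T)\<^sup>2))\<^sup>2"
      by (simp add: power_mult_distrib)
    also have "\<dots> \<le> avg A (\<lambda>T. ((g T)\<^sup>2)\<^sup>2) * avg A (\<lambda>T. ((D T)\<^sup>2)\<^sup>2)"
      by (rule avg_Cauchy_Schwarz)
    also have "\<dots> \<le> 9 ^ d * W\<^sup>2 * \<tau>"
      unfolding D4 using g4 \<tau>0 by (intro mult_right_mono) (simp_all flip: power_mult)
    finally show ?thesis .
  qed
  have "(W\<^sup>2)\<^sup>2 \<le> (avg A (\<lambda>T. (g T * D T)\<^sup>2) * \<tau>)\<^sup>2"
    using s1 by (rule power_mono) simp
  also have "\<dots> \<le> (9 ^ d * W\<^sup>2 * \<tau>) * \<tau>\<^sup>2"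
    by (simp only: power_mult_distrib[of _ \<tau>] mult_right_mono[OF s2] zero_le_power2)
  finally have key: "W\<^sup>2 * W\<^sup>2 \<le> 9 ^ d * \<tau> ^ 3 * W\<^sup>2"
    by (simp add: power2_eq_square power3_eq_cube mult_ac)
  have "W\<^sup>2 \<le> 9 ^ d * \<tau> ^ 3"
  proof (cases "W = 0")
    case True then show ?thesis using \<tau>0 by simp
  next
    case False then show ?thesis by (intro mult_right_le_imp_le[OF key]) simp
  qed
  also have "9 ^ d * \<tau> ^ 3 = (3 ^ d * (\<tau> * sqrt \<tau>))\<^sup>2"
  proof -
    have "(9::real) ^ d = 3 ^ d * 3 ^ d" by (simp flip: power_mult_distrib)
    then show ?thesis using \<tau>0 by (simp add: power2_eq_square power3_eq_cube mult_ac)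
  qed
  finally show ?thesis
    unfolding W_def[symmetric] \<tau>_def[symmetric] using \<tau>0 by (rule_tac power2_le_imp_le) auto
qed

text \<open>Flipping \<open>X\<close> multiplies the coefficient at \<open>S\<close> by
  \<open>chi S X\<close>, so only sets \<open>S\<close> that meet \<open>X\<close> contribute. Those
  of size above \<open>d\<close> are paid for by the total influence divided by
  \<open>d + 1\<close>; a smaller \<open>S\<close> is charged to some \<open>i\<close> in
  \<open>S \<inter> X\<close> and its low-degree influence. Hence only the influences in
  \<open>X\<close> have to be bounded by \<tau>.\<close>

lemma kkl:
  assumes "finite A" "X \<subseteq> A" and F: "\<And>T. T \<subseteq> A \<Longrightarrow> F T \<in> {- 1, 1}"
    and \<tau>: "\<And>i. i \<in> X \<Longrightarrow> influence A F i \<le> \<tau>"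
  shows "avg A (\<lambda>T. ((F T - F (sym_diff T X)) / 2)\<^sup>2)
    \<le> (\<Sum>i\<in>A. influence A F i) / real (d + 1) + real (card X) * (3 ^ d * (\<tau> * sqrt \<tau>))"
proof -
  have finX: "finite X" using assms finite_subset by blast
  have "avg A (\<lambda>T. ((F T - F (sym_diff T X)) / 2)\<^sup>2)
      = (\<Sum>S\<in>Pow A. ((1 - chi S X) / 2 * fourier A F S)\<^sup>2)"
    by (simp add: parseval assms fourier_flip_difference)
  also have "\<dots> \<le> (\<Sum>S\<in>Pow A. real (card S) * (fourier A F S)\<^sup>2 / real (d + 1)
      + (\<Sum>i\<in>X. if i \<in> S \<and> card S \<le> d then (fourier A F S)\<^sup>2 else 0))"
  proof (rule sum_mono)
    fix S assume S: "S \<in> Pow A"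
    let ?a = "real (card S) * (fourier A F S)\<^sup>2 / real (d + 1)"
    let ?b = "\<Sum>i\<in>X. if i \<in> S \<and> card S \<le> d then (fourier A F S)\<^sup>2 else 0"
    have a0: "0 \<le> ?a" by simp
    have b0: "0 \<le> ?b" by (intro sum_nonneg) auto
    have c: "chi S X \<in> {- 1, 1}" using abs_chi[of S X] by (auto simp: abs_if split: if_splits)
    show "((1 - chi S X) / 2 * fourier A F S)\<^sup>2 \<le> ?a + ?b"
    proof (cases "S \<inter> X = {}")
      case True
      then have "chi S X = 1" by (simp add: chi_def)
      then show ?thesis using a0 b0 by simp
    next
      case False
      then obtain i where i: "i \<in> S" "i \<in> X" by auto
      have "((1 - chi S X) / 2 * fourier A F S)\<^sup>2 \<le> (fourier A F S)\<^sup>2" using c by auto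
      also have "\<dots> \<le> ?a + ?b"
      proof (cases "card S \<le> d")
        case True
        have "(if i \<in> S \<and> card S \<le> d then (fourier A F S)\<^sup>2 else 0) \<le> ?b"
          using finX i by (intro member_le_sum) auto
        then have "(fourier A F S)\<^sup>2 \<le> ?b" using True i by (simp only: if_True simp_thms)
        then show ?thesis using a0 by linarith
      next
        case False
        have "(fourier A F S)\<^sup>2 * 1 \<le> (fourier A F S)\<^sup>2 * (real (card S) / real (d + 1))"
          using False by (intro mult_left_mono) auto
        then show ?thesis using b0 by (simp add: mult.commute)
      qed
      finally show ?thesis .
    qed
  qed
  also have "\<dots> = (\<Sum>i\<in>A. influence A F i) / real (d + 1)
      + (\<Sum>i\<in>X. \<Sum>S\<in>Pow A. if i \<in> S \<and> card S \<le> d then (fourier A F S)\<^sup>2 else 0)"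
    unfolding sum.distrib sum_influence[OF assms(1)] sum_divide_distrib[symmetric] by (subst sum.swap) simp
  also have "\<dots> \<le> (\<Sum>i\<in>A. influence A F i) / real (d + 1) + (\<Sum>i\<in>X. 3 ^ d * (\<tau> * sqrt \<tau>))"
  proof (intro add_left_mono sum_mono)
    fix i assume i: "i \<in> X"
    have eq: "{S. S \<subseteq> A \<and> i \<in> S \<and> card S \<le> d} = Pow A \<inter> {S. i \<in> S \<and> card S \<le> d}" by auto
    have "(\<Sum>S\<in>Pow A. if i \<in> S \<and> card S \<le> d then (fourier A F S)\<^sup>2 else 0)
        = (\<Sum>S | S \<subseteq> A \<and> i \<in> S \<and> card S \<le> d. (fourier A F S)\<^sup>2)"
      unfolding eq using assms(1) by (subst sum.inter_restrict) auto
    also have "\<dots> \<le> 3 ^ d * (influence A F i * sqrt (influence A F i))"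
      by (rule low_degree_influence[OF assms(1) _ F]) (use i assms(2) in auto)
    also have "\<dots> \<le> 3 ^ d * (\<tau> * sqrt \<tau>)"
    proof -
      have "0 \<le> influence A F i" unfolding influence_def by (intro avg_nonneg) auto
      then show ?thesis using \<tau>[OF i] by (intro mult_left_mono mult_mono) auto
    qed
    finally show "(\<Sum>S\<in>Pow A. if i \<in> S \<and> card S \<le> d then (fourier A F S)\<^sup>2 else 0) \<le> 3 ^ d * (\<tau> * sqrt \<tau>)" .
  qed
  finally show ?thesis by simp
qed

section \<open>The triangle inequality\<close>

definition sgn_fun :: "'a set \<Rightarrow> ('a set \<Rightarrow> real) \<Rightarrow> bool" where
  "sgn_fun A f \<longleftrightarrow> (\<forall>z. z \<subseteq> A \<longrightarrow> f z = 1 \<or> f z = - 1)"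

text \<open>The normalised inner product of \<open>f * chi S\<close> and \<open>g * chi S'\<close>
  for every pair \<open>S\<close>, \<open>S'\<close> with symmetric difference
  \<open>U\<close>.\<close>

definition corr :: "'a set \<Rightarrow> ('a set \<Rightarrow> real) \<Rightarrow> ('a set \<Rightarrow> real) \<Rightarrow> 'a set \<Rightarrow> real" where
  "corr A f g U = fourier A (\<lambda>z. f z * g z) U"

text \<open>Collects the coefficients \<open>x S * y S'\<close> of all pairs with symmetric
  difference \<open>U\<close>, which share the same value of \<open>corr\<close>.\<close>

definition sigcorr :: "'a set \<Rightarrow> ('a set \<Rightarrow> real) \<Rightarrow> ('a set \<Rightarrow> real) \<Rightarrow> 'a set \<Rightarrow> real" where
  "sigcorr A x y U = avg A (\<lambda>S. x S * y (sym_diff S U))"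

text \<open>The inner product of the vectors of \<open>(f, x)\<close> and \<open>(g, y)\<close>. The exponent is the order of the tensor
  power; it has to be even and large enough for the numerical estimates.\<close>

definition ker ::
  "'a set \<Rightarrow> ('a set \<Rightarrow> real) \<Rightarrow> ('a set \<Rightarrow> real) \<Rightarrow> ('a set \<Rightarrow> real) \<Rightarrow> ('a set \<Rightarrow> real) \<Rightarrow> real" where
  "ker A f x g y = (\<Sum>U\<in>Pow A. corr A f g U ^ 20 * sigcorr A x y U)"

lemma sgn_fun_mult: "sgn_fun A f \<Longrightarrow> sgn_fun A g \<Longrightarrow> sgn_fun A (\<lambda>z. f z * g z)"
  unfolding sgn_fun_def by (metis mult_1 mult_minus1 minus_minus)

lemma sgn_fun_minus: "sgn_fun A f \<Longrightarrow> sgn_fun A (\<lambda>z. - f z)"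
  unfolding sgn_fun_def by (metis minus_minus)

lemma sgn_fun_chi: "sgn_fun A (chi T)"
  unfolding sgn_fun_def
proof (intro allI impI)
  show "chi T z = 1 \<or> chi T z = - 1" for z using abs_chi[of T z] by (simp only: abs_if split: if_splits) auto
qed

lemma sgn_fun_shift: "sgn_fun A x \<Longrightarrow> T \<subseteq> A \<Longrightarrow> sgn_fun A (\<lambda>S. x (sym_diff S T))"
  unfolding sgn_fun_def
proof (intro allI impI)
  fix z assume x: "\<forall>z\<subseteq>A. x z = 1 \<or> x z = - 1" and "T \<subseteq> A" "z \<subseteq> A"
  then have "sym_diff z T \<subseteq> A" by auto
  with x show "x (sym_diff z T) = 1 \<or> x (sym_diff z T) = - 1" by blast
qed

lemma sgn_funD: "sgn_fun A f \<Longrightarrow> z \<subseteq> A \<Longrightarrow> f z = 1 \<or> f z = - 1"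
  unfolding sgn_fun_def by auto

lemma abs_sgn_fun: "sgn_fun A f \<Longrightarrow> z \<subseteq> A \<Longrightarrow> \<bar>f z\<bar> = 1"
  unfolding sgn_fun_def by (metis abs_1 abs_minus_cancel)

lemma abs_sgn_fun_diff:
  assumes "sgn_fun A f" "sgn_fun A g" "z \<subseteq> A"
  shows "\<bar>f z - g z\<bar> = 1 - f z * g z" "\<bar>f z * g z - 1\<bar> = 1 - f z * g z"
  using sgn_funD[OF assms(1,3)] sgn_funD[OF assms(2,3)] by (elim disjE; simp)+

lemma corr_commute: "corr A f g = corr A g f"
  unfolding corr_def by (simp add: mult.commute)

lemma sigcorr_commute:
  assumes "U \<subseteq> A" shows "sigcorr A x y U = sigcorr A y x U"
proof -
  have "sigcorr A x y U = avg A (\<lambda>S. x (sym_diff S U) * y (sym_diff (sym_diff S U) U))"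
    unfolding sigcorr_def using avg_sym_diff[OF assms, of "\<lambda>S. x S * y (sym_diff S U)"] by simp
  then show ?thesis by (simp add: sigcorr_def mult.commute)
qed

lemma ker_commute: "ker A f x g y = ker A g y f x"
  unfolding ker_def using corr_commute[of A f g] sigcorr_commute[of _ A x y] by (intro sum.cong) auto

lemma sum_corr_sq:
  assumes "finite A" "sgn_fun A f" "sgn_fun A g"
  shows "(\<Sum>U\<in>Pow A. (corr A f g U)\<^sup>2) = 1"
proof -
  have "(\<Sum>U\<in>Pow A. (corr A f g U)\<^sup>2) = avg A (\<lambda>z. (f z * g z)\<^sup>2)"
    unfolding corr_def by (simp add: parseval assms)
  also have "\<dots> = avg A (\<lambda>z. 1)"
    using abs_sgn_fun[OF sgn_fun_mult[OF assms(2,3)]] by (intro avg_cong) (simp add: abs_square_eq_1)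
  finally show ?thesis using avg_const[OF assms(1)] by simp
qed

lemma abs_avg_le_1:
  assumes "finite A" "sgn_fun A f" shows "\<bar>avg A f\<bar> \<le> 1"
proof -
  have "\<bar>avg A f\<bar> \<le> avg A (\<lambda>T. \<bar>f T\<bar>)" by (rule abs_avg_le)
  also have "\<dots> = avg A (\<lambda>T. 1)" by (rule avg_cong) (simp add: abs_sgn_fun[OF assms(2)])
  finally show ?thesis by (simp add: avg_const assms)
qed

lemma abs_corr_le_1: "finite A \<Longrightarrow> sgn_fun A f \<Longrightarrow> sgn_fun A g \<Longrightarrow> \<bar>corr A f g U\<bar> \<le> 1"
  unfolding corr_def fourier_def by (intro abs_avg_le_1 sgn_fun_mult sgn_fun_chi)

lemma abs_sigcorr_le_1:
  "finite A \<Longrightarrow> sgn_fun A x \<Longrightarrow> sgn_fun A y \<Longrightarrow> U \<subseteq> A \<Longrightarrow> \<bar>sigcorr A x y U\<bar> \<le> 1"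
  unfolding sigcorr_def by (intro abs_avg_le_1 sgn_fun_mult sgn_fun_shift)

section \<open>Estimates for high powers\<close>

text \<open>Parseval controls two of the factors and \<theta> each of the others. Used with
  \<open>n = 18\<close>, this is how the order 20 of the tensor power makes sums of correlations
  small.\<close>

lemma sum_power_le:
  fixes a :: "'b \<Rightarrow> real"
  assumes "\<And>i. i \<in> I \<Longrightarrow> \<bar>a i\<bar> \<le> \<theta>" "(\<Sum>i\<in>I. (a i)\<^sup>2) \<le> s" "0 \<le> \<theta>"
  shows "(\<Sum>i\<in>I. \<bar>a i\<bar> ^ (n + 2)) \<le> \<theta> ^ n * s"
proof -
  have "(\<Sum>i\<in>I. \<bar>a i\<bar> ^ (n + 2)) \<le> (\<Sum>i\<in>I. \<theta> ^ n * (a i)\<^sup>2)"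
    unfolding power_add power2_abs using assms by (intro sum_mono mult_right_mono power_mono) auto
  also have "\<dots> \<le> \<theta> ^ n * s"
    unfolding sum_distrib_left[symmetric] using assms by (intro mult_left_mono) auto
  finally show ?thesis .
qed

text \<open>After \<open>e - h\<close> is split off, each term of the cofactor has
  \<open>n + 2\<close> factors; two of them are kept as squares, for Parseval to sum.\<close>

lemma power_diff_le:
  fixes e h :: real
  assumes "\<bar>e\<bar> \<le> m" "\<bar>h\<bar> \<le> m"
  shows "\<bar>e ^ (n + 3) - h ^ (n + 3)\<bar> \<le> real (n + 3) * \<bar>e - h\<bar> * (m ^ n * (e\<^sup>2 + h\<^sup>2))"
proof -
  define M where "M = max \<bar>e\<bar> \<bar>h\<bar>"
  have M: "0 \<le> M" "M \<le> m" "\<bar>e\<bar> \<le> M" "\<bar>h\<bar> \<le> M" "M\<^sup>2 \<le> e\<^sup>2 + h\<^sup>2"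
    using assms unfolding M_def by (auto simp: max_def)
  have "\<bar>h ^ (n + 3 - Suc i) * e ^ i\<bar> \<le> m ^ n * (e\<^sup>2 + h\<^sup>2)" if "i < n + 3" for i
  proof -
    have "\<bar>h ^ (n + 3 - Suc i) * e ^ i\<bar> \<le> M ^ (n + 3 - Suc i) * M ^ i"
      unfolding abs_mult power_abs using M by (intro mult_mono power_mono) auto
    also have "\<dots> = M ^ n * M\<^sup>2"
      unfolding power_add[symmetric] using that by (intro arg_cong[of _ _ "(^) M"]) auto
    also have "\<dots> \<le> m ^ n * (e\<^sup>2 + h\<^sup>2)"
      using M by (intro mult_mono power_mono) auto
    finally show ?thesis .
  qed
  then have "\<bar>\<Sum>i<n + 3. h ^ (n + 3 - Suc i) * e ^ i\<bar> \<le> (\<Sum>i<n + 3. m ^ n * (e\<^sup>2 + h\<^sup>2))"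
    by (intro order.trans[OF sum_abs] sum_mono) auto
  then have "\<bar>e - h\<bar> * \<bar>\<Sum>i<n + 3. h ^ (n + 3 - Suc i) * e ^ i\<bar>
      \<le> \<bar>e - h\<bar> * (real (n + 3) * (m ^ n * (e\<^sup>2 + h\<^sup>2)))"
    by (intro mult_left_mono) auto
  then show ?thesis
    unfolding power_diff_sumr2 abs_mult by (simp only: mult_ac)
qed

text \<open>The quotient of \<open>1 - a ^ n\<close> by \<open>1 - a\<close> is a geometric sum of
  \<open>n\<close> terms, each at least \<open>a ^ n\<close>.\<close>

lemma Bernoulli_diff_ge:
  fixes a :: real
  assumes "0 \<le> a" "a \<le> 1"
  shows "real n * (1 - a) * a ^ n \<le> 1 - a ^ n"
proof (induction n)
  case (Suc n)
  have le: "a ^ Suc n \<le> a ^ n" using assms by (simp add: mult_left_le_one_le)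
  have "real n * (1 - a) * a ^ Suc n \<le> real n * (1 - a) * a ^ n"
    using assms le by (intro mult_left_mono) auto
  moreover have "(1 - a) * a ^ Suc n \<le> (1 - a) * a ^ n"
    using assms le by (intro mult_left_mono) auto
  ultimately show ?case using Suc by (simp add: algebra_simps)
qed simp

text \<open>For \<open>n = 1\<close> and \<open>c = a + b - 1\<close>, the case of equality in the
  triangle inequality for the distances \<open>1 - a\<close>, \<open>1 - b\<close>,
  \<open>1 - c\<close>, the right-hand side is 0. From \<open>n = 2\<close> on it is positive of
  second order, and this slack absorbs all off-diagonal terms.\<close>

lemma power_triangle_slack:
  fixes a b c :: real
  assumes "a \<le> 1" "b \<le> 1" "0 \<le> a" "0 \<le> b" "0 \<le> a + b - 1" "a + b - 1 \<le> c" "2 \<le> n"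
  shows "(1 - a) * (1 - b) \<le> 1 + c ^ n - a ^ n - b ^ n"
proof -
  have "(1 - a) * (1 - b) \<le> 1 + (a + b - 1) ^ n - a ^ n - b ^ n"
    using \<open>2 \<le> n\<close>
  proof (induction n rule: dec_induct)
    case base
    have "0 \<le> (1 - a) * (1 - b)" using assms by (intro mult_nonneg_nonneg) auto
    then show ?case by (simp add: power2_eq_square algebra_simps)
  next
    case (step n)
    \<comment> \<open>As \<open>a - ?s = 1 - b\<close> and \<open>b - ?s = 1 - a\<close>, the
      expression for \<open>Suc n\<close> is \<open>?s\<close> times the one for \<open>n\<close>,
      plus \<open>(1 - b) * (1 - a ^ n) + (1 - a) * (1 - b ^ n)\<close>.\<close>
    let ?s = "a + b - 1"
    have "a ^ n \<le> a ^ 1" "b ^ n \<le> b ^ 1"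
      using assms step by (intro power_decreasing; simp)+
    then have "(1 - b) * (1 - a) \<le> (1 - b) * (1 - a ^ n)" "(1 - a) * (1 - b) \<le> (1 - a) * (1 - b ^ n)"
      using assms by (intro mult_left_mono; simp)+
    moreover have "(1 - ?s) * ((1 - a) * (1 - b)) \<le> 1 * ((1 - a) * (1 - b))"
      using assms by (intro mult_right_mono mult_nonneg_nonneg) auto
    moreover have "0 \<le> (1 - a) * (1 - b)" using assms by (intro mult_nonneg_nonneg) auto
    moreover have "?s * ((1 - a) * (1 - b)) \<le> ?s * (1 + ?s ^ n - a ^ n - b ^ n)"
      using step assms by (intro mult_left_mono) auto
    ultimately show ?case by (simp add: algebra_simps)
  qed
  also have "\<dots> \<le> 1 + c ^ n - a ^ n - b ^ n"
    using assms by (simp add: power_mono)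
  finally show ?thesis .
qed

section \<open>Correlations of close sign functions\<close>

lemma corr_empty: "corr A f g {} = avg A (\<lambda>z. f z * g z)"
  unfolding corr_def fourier_def by simp

text \<open>So \<open>1 - corr A f g {}\<close> is twice the normalised Hamming distance; the
  estimates below use it as the distance of \<open>f\<close> and \<open>g\<close>.\<close>

lemma one_minus_corr_empty:
  assumes "finite A" "sgn_fun A f" "sgn_fun A g"
  shows "1 - corr A f g {} = avg A (\<lambda>z. \<bar>f z - g z\<bar>)"
proof -
  have "1 - corr A f g {} = avg A (\<lambda>z. 1 - f z * g z)"
    unfolding corr_empty avg_diff using avg_const[OF assms(1)] by simp
  also have "\<dots> = avg A (\<lambda>z. \<bar>f z - g z\<bar>)"
    by (intro avg_cong) (simp add: abs_sgn_fun_diff[OF assms(2,3)])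
  finally show ?thesis .
qed

lemma corr_empty_triangle:
  assumes "finite A" "sgn_fun A f" "sgn_fun A g" "sgn_fun A h"
  shows "1 - corr A f h {} \<le> (1 - corr A f g {}) + (1 - corr A g h {})"
  unfolding one_minus_corr_empty[OF assms(1,2,4)] one_minus_corr_empty[OF assms(1,2,3)]
    one_minus_corr_empty[OF assms(1,3,4)] avg_add[symmetric]
  by (intro avg_mono) auto

text \<open>The average of \<open>chi U\<close> is 0, so the constant 1, to which
  \<open>f * g\<close> is close, can be subtracted before taking absolute values.\<close>

lemma abs_corr_le:
  assumes "finite A" "sgn_fun A f" "sgn_fun A g" "U \<subseteq> A" "U \<noteq> {}"
  shows "\<bar>corr A f g U\<bar> \<le> 1 - corr A f g {}"
proof -
  have "corr A f g U = avg A (\<lambda>z. (f z * g z) * chi U z) - avg A (chi U)"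
    unfolding corr_def fourier_def using avg_chi[OF assms(1,4)] assms(5) by simp
  also have "\<dots> = avg A (\<lambda>z. (f z * g z - 1) * chi U z)"
    unfolding avg_diff[symmetric] by (simp add: algebra_simps)
  also have "\<bar>\<dots>\<bar> \<le> avg A (\<lambda>z. \<bar>(f z * g z - 1) * chi U z\<bar>)" by (rule abs_avg_le)
  also have "\<dots> = avg A (\<lambda>z. \<bar>f z - g z\<bar>)"
    unfolding abs_mult[of _ "chi U _"] abs_chi
    by (intro avg_cong) (simp add: abs_sgn_fun_diff[OF assms(2,3)])
  finally show ?thesis using one_minus_corr_empty[OF assms(1-3)] by simp
qed

lemma abs_corr_diff_le:
  assumes "finite A" "sgn_fun A f" "sgn_fun A g" "sgn_fun A h"
  shows "\<bar>corr A f h U - corr A g h U\<bar> \<le> 1 - corr A f g {}"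
proof -
  have "corr A f h U - corr A g h U = avg A (\<lambda>z. (f z - g z) * h z * chi U z)"
    unfolding corr_def fourier_def avg_diff[symmetric] by (simp add: algebra_simps)
  also have "\<bar>\<dots>\<bar> \<le> avg A (\<lambda>z. \<bar>(f z - g z) * h z * chi U z\<bar>)" by (rule abs_avg_le)
  also have "\<dots> = avg A (\<lambda>z. \<bar>f z - g z\<bar>)"
    unfolding abs_mult abs_chi by (intro avg_cong) (simp add: abs_sgn_fun[OF assms(4)])
  finally show ?thesis using one_minus_corr_empty[OF assms(1-3)] by simp
qed

lemma sum_Pow_remove_empty:
  fixes F :: "'a set \<Rightarrow> real"
  assumes "finite A"
  shows "(\<Sum>U\<in>Pow A. F U) = F {} + (\<Sum>U\<in>Pow A - {{}}. F U)"
  by (rule sum.remove) (use assms in auto)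

lemma sum_corr_sq_nonempty:
  assumes "finite A" "sgn_fun A f" "sgn_fun A g"
  shows "(\<Sum>U\<in>Pow A - {{}}. (corr A f g U)\<^sup>2) \<le> 2 * (1 - corr A f g {})"
proof -
  have "(\<Sum>U\<in>Pow A - {{}}. (corr A f g U)\<^sup>2) = 1 - (corr A f g {})\<^sup>2"
    using sum_corr_sq[OF assms] sum_Pow_remove_empty[OF assms(1), of "\<lambda>U. (corr A f g U)\<^sup>2"] by simp
  also have "\<dots> \<le> 2 * (1 - corr A f g {})"
    using zero_le_power2[of "1 - corr A f g {}"] by (simp add: power2_eq_square algebra_simps)
  finally show ?thesis .
qed

lemma abs_ker_le:
  assumes "finite A" "sgn_fun A f" "sgn_fun A g" "sgn_fun A x" "sgn_fun A y"
    and "\<And>U. U \<subseteq> A \<Longrightarrow> \<bar>corr A f g U\<bar> \<le> \<theta>" "0 \<le> \<theta>"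
  shows "\<bar>ker A f x g y\<bar> \<le> \<theta> ^ 18"
proof -
  have "\<bar>ker A f x g y\<bar> \<le> (\<Sum>U\<in>Pow A. \<bar>corr A f g U\<bar> ^ (18 + 2))"
    unfolding ker_def
  proof (intro order.trans[OF sum_abs] sum_mono)
    fix U assume "U \<in> Pow A"
    then have "\<bar>sigcorr A x y U\<bar> \<le> 1" using assms by (intro abs_sigcorr_le_1) auto
    then have "\<bar>corr A f g U\<bar> ^ 20 * \<bar>sigcorr A x y U\<bar> \<le> \<bar>corr A f g U\<bar> ^ 20 * 1"
      by (intro mult_left_mono) auto
    then show "\<bar>corr A f g U ^ 20 * sigcorr A x y U\<bar> \<le> \<bar>corr A f g U\<bar> ^ (18 + 2)"
      by (simp add: abs_mult power_abs)
  qed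
  also have "\<dots> \<le> \<theta> ^ 18 * 1"
    using assms sum_corr_sq[OF assms(1-3)] by (intro sum_power_le) auto
  finally show ?thesis by simp
qed

lemma sum_corr_power_nonempty:
  assumes "finite A" "sgn_fun A f" "sgn_fun A g"
  shows "(\<Sum>U\<in>Pow A - {{}}. corr A f g U ^ 20) \<le> (1 - corr A f g {}) ^ 18 * (2 * (1 - corr A f g {}))"
proof -
  have "(\<Sum>U\<in>Pow A - {{}}. \<bar>corr A f g U\<bar> ^ (18 + 2)) \<le> (1 - corr A f g {}) ^ 18 * (2 * (1 - corr A f g {}))"
    using assms abs_corr_le_1[OF assms, of "{}"]
    by (intro sum_power_le sum_corr_sq_nonempty abs_corr_le) auto
  then show ?thesis by (simp add: power_even_abs)
qed

text \<open>The bound has to be a product of both distances. In the difference of the powers for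
  \<open>f\<close>, \<open>h\<close> and for \<open>g\<close>, \<open>h\<close>, the Lipschitz
  estimate gives the factor \<open>D1\<close>, and Parseval gives \<open>2 * D3 + 2 * D2\<close>, at
  most \<open>6 * D2\<close>. The remaining power sum is of order \<open>D1 ^ 19\<close>, and
  \<open>D1 \<le> D2\<close>. Together they give the factor 20 * 6 + 2 = 122, which (1/4) ^ 17
  reduces far below 1/100.\<close>

lemma off_diagonal_le:
  assumes "finite A" "sgn_fun A f" "sgn_fun A g" "sgn_fun A h"
    and D: "1 - corr A f g {} \<le> 1/4" "1 - corr A g h {} \<le> 1/4" "1 - corr A f h {} \<le> 1/4"
    and le: "1 - corr A f g {} \<le> 1 - corr A g h {}"
  shows "(\<Sum>U\<in>Pow A - {{}}. \<bar>corr A f h U ^ 20 - corr A f g U ^ 20 - corr A g h U ^ 20\<bar>)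
    \<le> (1 - corr A f g {}) * (1 - corr A g h {}) / 100"
proof -
  define D1 D2 D3 where "D1 = 1 - corr A f g {}" "D2 = 1 - corr A g h {}" "D3 = 1 - corr A f h {}"
  note Ds = this
  have D0: "0 \<le> D1" "0 \<le> D2" "0 \<le> D3"
    using abs_corr_le_1[OF assms(1)] assms(2-4) unfolding Ds by (simp_all add: abs_le_iff)
  have D3le: "D3 \<le> 2 * D2" using corr_empty_triangle[OF assms(1-4)] le unfolding Ds by simp
  have dle: "D1 \<le> 1/4" "D2 \<le> 1/4" "D3 \<le> 1/4" "D1 \<le> D2" using D le by (simp_all add: Ds)
  let ?I = "Pow A - {{}}"
  have p: "\<bar>corr A f h U ^ 20 - corr A f g U ^ 20 - corr A g h U ^ 20\<bar>
      \<le> 20 * D1 * (1/4) ^ 17 * ((corr A f h U)\<^sup>2 + (corr A g h U)\<^sup>2) + corr A f g U ^ 20" if "U \<in> ?I" for U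
  proof -
    have b: "\<bar>corr A f h U\<bar> \<le> 1/4" "\<bar>corr A g h U\<bar> \<le> 1/4"
      using that abs_corr_le[OF assms(1,2,4), of U] abs_corr_le[OF assms(1,3,4), of U] D by auto
    have "\<bar>corr A f h U ^ (17 + 3) - corr A g h U ^ (17 + 3)\<bar>
      \<le> real (17 + 3) * \<bar>corr A f h U - corr A g h U\<bar> * ((1/4) ^ 17 * ((corr A f h U)\<^sup>2 + (corr A g h U)\<^sup>2))"
      by (rule power_diff_le[OF b])
    also have "\<dots> \<le> real (17 + 3) * D1 * ((1/4) ^ 17 * ((corr A f h U)\<^sup>2 + (corr A g h U)\<^sup>2))"
      using abs_corr_diff_le[OF assms(1-4), of U] unfolding Ds
      by (intro mult_right_mono mult_left_mono) auto
    finally have "\<bar>corr A f h U ^ 20 - corr A g h U ^ 20\<bar>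
        \<le> 20 * D1 * (1/4) ^ 17 * ((corr A f h U)\<^sup>2 + (corr A g h U)\<^sup>2)"
      by (simp add: mult_ac)
    moreover have "0 \<le> corr A f g U ^ 20" by (simp add: zero_le_even_power)
    ultimately show ?thesis by linarith
  qed
  have "(\<Sum>U\<in>?I. \<bar>corr A f h U ^ 20 - corr A f g U ^ 20 - corr A g h U ^ 20\<bar>)
      \<le> (\<Sum>U\<in>?I. 20 * D1 * (1/4) ^ 17 * ((corr A f h U)\<^sup>2 + (corr A g h U)\<^sup>2) + corr A f g U ^ 20)"
    using p by (rule sum_mono)
  also have "\<dots> = 20 * D1 * (1/4) ^ 17 * ((\<Sum>U\<in>?I. (corr A f h U)\<^sup>2) + (\<Sum>U\<in>?I. (corr A g h U)\<^sup>2))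
      + (\<Sum>U\<in>?I. corr A f g U ^ 20)"
    by (simp only: sum.distrib sum_distrib_left[symmetric])
  also have "\<dots> \<le> 20 * D1 * (1/4) ^ 17 * (2 * D3 + 2 * D2) + D1 ^ 18 * (2 * D1)"
    unfolding Ds using assms D0
    by (intro add_mono mult_left_mono sum_corr_sq_nonempty sum_corr_power_nonempty) (auto simp: Ds)
  also have "\<dots> \<le> 20 * D1 * (1/4) ^ 17 * (6 * D2) + (1/4) ^ 17 * (2 * D1 * D2)"
  proof (intro add_mono mult_left_mono)
    have "D1 ^ 18 * (2 * D1) = D1 ^ 17 * (2 * D1 * D1)" using power_add[of D1 17 1] by simp
    also have "\<dots> \<le> (1/4) ^ 17 * (2 * D1 * D2)"
      using D0 dle by (intro mult_mono power_mono mult_left_mono) auto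
    finally show "D1 ^ 18 * (2 * D1) \<le> (1/4) ^ 17 * (2 * D1 * D2)" .
  qed (use D3le D0 in auto)
  also have "\<dots> = D1 * D2 * (122 * (1/4) ^ 17)" by (simp add: algebra_simps)
  also have "\<dots> \<le> D1 * D2 * (1/100)"
    using D0 by (intro mult_left_mono mult_nonneg_nonneg) (auto simp: power_divide)
  finally show ?thesis unfolding Ds by simp
qed

lemma off_diagonal:
  assumes "finite A" "sgn_fun A f" "sgn_fun A g" "sgn_fun A h"
    and D: "1 - corr A f g {} \<le> 1/4" "1 - corr A g h {} \<le> 1/4" "1 - corr A f h {} \<le> 1/4"
  shows "(\<Sum>U\<in>Pow A - {{}}. \<bar>corr A f h U ^ 20 - corr A f g U ^ 20 - corr A g h U ^ 20\<bar>)
    \<le> (1 - corr A f g {}) * (1 - corr A g h {}) / 100"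
proof (cases "1 - corr A f g {} \<le> 1 - corr A g h {}")
  case True
  then show ?thesis by (rule off_diagonal_le[OF assms])
next
  case False
  then have "(\<Sum>U\<in>Pow A - {{}}. \<bar>corr A h f U ^ 20 - corr A h g U ^ 20 - corr A g f U ^ 20\<bar>)
    \<le> (1 - corr A h g {}) * (1 - corr A g f {}) / 100"
    using assms by (intro off_diagonal_le) (auto simp: corr_commute[of A h] corr_commute[of A g f])
  then show ?thesis
    by (simp add: corr_commute[of A h] corr_commute[of A g f] mult.commute algebra_simps)
qed

text \<open>Without cancellation between the three powers each sum is bounded by the square of one
  distance. The triangle inequality turns squares into products, for instance
  \<open>D1 * D1 \<le> D1 * (D2 + D3)\<close>.\<close>

lemma sum_three_powers_le:
  assumes "finite A" "sgn_fun A f" "sgn_fun A g" "sgn_fun A h"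
    and D: "1 - corr A f g {} \<le> 1/4" "1 - corr A g h {} \<le> 1/4" "1 - corr A f h {} \<le> 1/4"
  defines "D1 \<equiv> 1 - corr A f g {}" and "D2 \<equiv> 1 - corr A g h {}" and "D3 \<equiv> 1 - corr A f h {}"
  shows "(\<Sum>U\<in>Pow A - {{}}. corr A f h U ^ 20 + corr A f g U ^ 20 + corr A g h U ^ 20)
    \<le> (D1 * D2 + D2 * D3 + D1 * D3) / 100"
proof -
  have D0: "0 \<le> D1" "0 \<le> D2" "0 \<le> D3"
    using abs_corr_le_1[OF assms(1)] assms(2-4) unfolding D1_def D2_def D3_def by (simp_all add: abs_le_iff)
  have tri: "D3 \<le> D1 + D2" "D1 \<le> D2 + D3" "D2 \<le> D1 + D3"
    using corr_empty_triangle[OF assms(1,2,3,4)] corr_empty_triangle[OF assms(1,2,4,3)]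
      corr_empty_triangle[OF assms(1,3,2,4)]
    unfolding D1_def D2_def D3_def by (simp_all add: corr_commute[of A g f] corr_commute[of A h g])
  have p: "E ^ 18 * (2 * E) \<le> (1/4) ^ 17 * (2 * E\<^sup>2)" if "0 \<le> E" "E \<le> 1/4" for E :: real
  proof -
    have "E ^ 17 * (2 * E\<^sup>2) \<le> (1/4) ^ 17 * (2 * E\<^sup>2)"
      using that by (intro mult_right_mono power_mono) auto
    then show ?thesis using power_add[of E 17 1] by (simp add: power2_eq_square mult_ac)
  qed
  have "(\<Sum>U\<in>Pow A - {{}}. corr A f h U ^ 20 + corr A f g U ^ 20 + corr A g h U ^ 20)
      \<le> D3 ^ 18 * (2 * D3) + D1 ^ 18 * (2 * D1) + D2 ^ 18 * (2 * D2)"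
    unfolding sum.distrib D1_def D2_def D3_def
    by (intro add_mono sum_corr_power_nonempty assms(1-4))
  also have "\<dots> \<le> (1/4) ^ 17 * (2 * D3\<^sup>2) + (1/4) ^ 17 * (2 * D1\<^sup>2) + (1/4) ^ 17 * (2 * D2\<^sup>2)"
    using D0 D unfolding D1_def[symmetric] D2_def[symmetric] D3_def[symmetric]
    by (intro add_mono p) auto
  also have "\<dots> = (1/4) ^ 17 * 2 * (D1\<^sup>2 + D2\<^sup>2 + D3\<^sup>2)" by (simp add: algebra_simps)
  also have "\<dots> \<le> (1/4) ^ 17 * 2 * (2 * (D1 * D2 + D2 * D3 + D1 * D3))"
  proof (intro mult_left_mono)
    have "D1 * D1 \<le> D1 * (D2 + D3)" "D2 * D2 \<le> D2 * (D1 + D3)" "D3 * D3 \<le> D3 * (D1 + D2)"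
      using D0 tri by (intro mult_left_mono; simp)+
    then show "D1\<^sup>2 + D2\<^sup>2 + D3\<^sup>2 \<le> 2 * (D1 * D2 + D2 * D3 + D1 * D3)"
      by (simp add: power2_eq_square algebra_simps)
  qed auto
  also have "\<dots> = (D1 * D2 + D2 * D3 + D1 * D3) * (4 * (1/4) ^ 17)" by (simp add: algebra_simps)
  also have "\<dots> \<le> (D1 * D2 + D2 * D3 + D1 * D3) * (1/100)"
    using D0 by (intro mult_left_mono add_nonneg_nonneg mult_nonneg_nonneg) (auto simp: power_divide)
  finally show ?thesis by simp
qed

section \<open>Three pairwise close functions\<close>

text \<open>A common form for the three inner products of a triangle. The sign
  \<open>y S * y (sym_diff S U)\<close> is taken out of each of them, so that they combine under one
  average; it has modulus 1 and disappears at \<open>U = {}\<close>.\<close>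

lemma ker_split:
  assumes "finite A" "sgn_fun A y"
    and sigcorr: "\<And>U. U \<subseteq> A \<Longrightarrow> sigcorr A x w U = avg A (\<lambda>S. y S * y (sym_diff S U) * R U S)"
  shows "ker A f x h w = avg A (\<lambda>S. corr A f h {} ^ 20 * R {} S)
    + (\<Sum>U\<in>Pow A - {{}}. avg A (\<lambda>S. y S * y (sym_diff S U) * (corr A f h U ^ 20 * R U S)))"
proof -
  have "ker A f x h w = (\<Sum>U\<in>Pow A. avg A (\<lambda>S. y S * y (sym_diff S U) * (corr A f h U ^ 20 * R U S)))"
    unfolding ker_def
  proof (rule sum.cong)
    fix U assume "U \<in> Pow A"
    then show "corr A f h U ^ 20 * sigcorr A x w U
        = avg A (\<lambda>S. y S * y (sym_diff S U) * (corr A f h U ^ 20 * R U S))"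
      by (simp add: sigcorr avg_cmult[symmetric] mult_ac)
  qed simp
  also have "\<dots> = avg A (\<lambda>S. y S * y (sym_diff S {}) * (corr A f h {} ^ 20 * R {} S))
    + (\<Sum>U\<in>Pow A - {{}}. avg A (\<lambda>S. y S * y (sym_diff S U) * (corr A f h U ^ 20 * R U S)))"
    by (rule sum_Pow_remove_empty[OF assms(1)])
  also have "avg A (\<lambda>S. y S * y (sym_diff S {}) * (corr A f h {} ^ 20 * R {} S))
      = avg A (\<lambda>S. corr A f h {} ^ 20 * R {} S)"
  proof (rule avg_cong)
    fix S assume "S \<subseteq> A"
    then have "y S * y S = 1" using sgn_funD[OF assms(2), of S] by auto
    then show "y S * y (sym_diff S {}) * (corr A f h {} ^ 20 * R {} S) = corr A f h {} ^ 20 * R {} S"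
      by simp
  qed
  finally show ?thesis .
qed

text \<open>The signs \<open>x\<^sub>S y\<^sub>S\<close> and \<open>w\<^sub>S y\<^sub>S\<close> sort the terms into four types. In the types \<open>(+,+)\<close>, \<open>(-,+)\<close> and
  \<open>(+,-)\<close> the diagonal slack is at least a product of two of the three distances between
  \<open>f\<close>, \<open>g\<close>, \<open>h\<close>, and the off-diagonal error is a small multiple of the same product. The error of type \<open>(-,-)\<close>
  is small compared to the sum of all three products; the last assumption, that type \<open>(+,+)\<close> is frequent,
  allows us to absorb it.\<close>

lemma near_triangle_aligned:
  assumes "finite A" and sf: "sgn_fun A f" "sgn_fun A g" "sgn_fun A h"
    and sx: "sgn_fun A x" "sgn_fun A y" "sgn_fun A w"
    and D: "1 - corr A f g {} \<le> 1/4" "1 - corr A g h {} \<le> 1/4" "1 - corr A f h {} \<le> 1/4"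
    and al: "1/4 \<le> avg A (\<lambda>S. (1 + x S * y S) / 2 * ((1 + w S * y S) / 2))"
  shows "ker A f x g y + ker A g y h w \<le> 1 + ker A f x h w"
    and "- 1 \<le> ker A f x g y + ker A g y h w + ker A f x h w"
proof -
  define D1 D2 D3 where Ds: "D1 = 1 - corr A f g {}" "D2 = 1 - corr A g h {}" "D3 = 1 - corr A f h {}"
  have D0: "0 \<le> D1" "0 \<le> D2" "0 \<le> D3"
    using abs_corr_le_1[OF assms(1)] sf unfolding Ds by (simp_all add: abs_le_iff)
  have tri: "D3 \<le> D1 + D2" "D1 \<le> D2 + D3" "D2 \<le> D1 + D3"
    using corr_empty_triangle[OF assms(1) sf(1,2,3)] corr_empty_triangle[OF assms(1) sf(1,3,2)]
      corr_empty_triangle[OF assms(1) sf(2,1,3)]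
    unfolding Ds by (simp_all add: corr_commute[of A g f] corr_commute[of A h g])
  define L1 L2 L3 where L: "L1 = D1 * D2" "L2 = D2 * D3" "L3 = D1 * D3"
  have L0: "0 \<le> L1" "0 \<le> L2" "0 \<le> L3" unfolding L using D0 by simp_all
  have D4: "D1 \<le> 1/4" "D2 \<le> 1/4" "D3 \<le> 1/4" using D unfolding Ds by auto
  have L16: "L1 \<le> 1/16" "L2 \<le> 1/16" "L3 \<le> 1/16"
    using mult_mono[OF D4(1,2)] mult_mono[OF D4(2,3)] mult_mono[OF D4(1,3)] D0 unfolding L by auto
  define d e k where dek: "d = (\<lambda>U. corr A f g U ^ 20)" "e = (\<lambda>U. corr A f h U ^ 20)" "k = (\<lambda>U. corr A g h U ^ 20)"
  have dek0: "0 \<le> d U" "0 \<le> e U" "0 \<le> k U" for U unfolding dek by (simp_all add: zero_le_even_power)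
  \<comment> \<open>These are the diagonal slacks of types \<open>(+,+)\<close>,
    \<open>(-,+)\<close> and \<open>(+,-)\<close>, from the three orderings of the triangle
    \<open>f\<close>, \<open>g\<close>, \<open>h\<close>.\<close>
  have sl1: "L1 \<le> 1 + e {} - d {} - k {}"
    using power_triangle_slack[of "corr A f g {}" "corr A g h {}" "corr A f h {}" 20] D0 D4 tri unfolding dek L Ds by simp
  have sl2: "L2 \<le> 1 + d {} - k {} - e {}"
    using power_triangle_slack[of "corr A g h {}" "corr A f h {}" "corr A f g {}" 20] D0 D4 tri unfolding dek L Ds by simp
  have sl3: "L3 \<le> 1 + k {} - d {} - e {}"
    using power_triangle_slack[of "corr A f g {}" "corr A f h {}" "corr A g h {}" 20] D0 D4 tri unfolding dek L Ds by simp
  let ?I = "Pow A - {{}}"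
  have E1: "(\<Sum>U\<in>?I. \<bar>e U - d U - k U\<bar>) \<le> L1 / 100"
    using off_diagonal[OF assms(1) sf D] unfolding dek L Ds .
  have E2: "(\<Sum>U\<in>?I. \<bar>d U - e U - k U\<bar>) \<le> L2 / 100"
    using off_diagonal[OF assms(1) sf(1,3,2)] D unfolding dek L Ds
    by (simp add: corr_commute[of A h g] mult.commute)
  have E3: "(\<Sum>U\<in>?I. \<bar>k U - d U - e U\<bar>) \<le> L3 / 100"
    using off_diagonal[OF assms(1) sf(2,1,3)] D unfolding dek L Ds
    by (simp add: corr_commute[of A g f] mult.commute)
  have E4: "(\<Sum>U\<in>?I. e U + d U + k U) \<le> (L1 + L2 + L3) / 100"
    using sum_three_powers_le[OF assms(1) sf D] unfolding dek L Ds .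
  define \<sigma> \<tau> where st: "\<sigma> = (\<lambda>S. x S * y S)" "\<tau> = (\<lambda>S. w S * y S)"
  have pm: "y S = 1 \<or> y S = - 1" "\<sigma> S = 1 \<or> \<sigma> S = - 1" "\<tau> S = 1 \<or> \<tau> S = - 1" if "S \<subseteq> A" for S
    using sgn_funD[OF sx(1) that] sgn_funD[OF sx(2) that] sgn_funD[OF sx(3) that] unfolding st by auto
  have sdA: "sym_diff S U \<subseteq> A" if "S \<subseteq> A" "U \<subseteq> A" for S U using that by auto
  have c1: "sigcorr A x y U = avg A (\<lambda>S. y S * y (sym_diff S U) * \<sigma> S)" if "U \<subseteq> A" for U
    unfolding sigcorr_def
  proof (rule avg_cong)
    fix S assume S: "S \<subseteq> A"
    show "x S * y (sym_diff S U) = y S * y (sym_diff S U) * \<sigma> S"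
      using pm(1)[OF S] unfolding st by auto
  qed
  have c2: "sigcorr A y w U = avg A (\<lambda>S. y S * y (sym_diff S U) * \<tau> (sym_diff S U))" if "U \<subseteq> A" for U
    unfolding sigcorr_def
  proof (rule avg_cong)
    fix S assume S: "S \<subseteq> A"
    show "y S * w (sym_diff S U) = y S * y (sym_diff S U) * \<tau> (sym_diff S U)"
      using pm(1)[OF sdA[OF S that]] unfolding st by (elim disjE) simp_all
  qed
  have c3: "sigcorr A x w U = avg A (\<lambda>S. y S * y (sym_diff S U) * (\<sigma> S * \<tau> (sym_diff S U)))" if "U \<subseteq> A" for U
    unfolding sigcorr_def
  proof (rule avg_cong)
    fix S assume S: "S \<subseteq> A"
    show "x S * w (sym_diff S U) = y S * y (sym_diff S U) * (\<sigma> S * \<tau> (sym_diff S U))"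
      using pm(1)[OF S] pm(1)[OF sdA[OF S that]] unfolding st by (elim disjE) simp_all
  qed
  have p: "ker A f x g y = avg A (\<lambda>S. d {} * \<sigma> S)
      + (\<Sum>U\<in>?I. avg A (\<lambda>S. y S * y (sym_diff S U) * (d U * \<sigma> S)))"
    using ker_split[OF assms(1) sx(2) c1] unfolding dek by simp
  have q: "ker A g y h w = avg A (\<lambda>S. k {} * \<tau> S)
      + (\<Sum>U\<in>?I. avg A (\<lambda>S. y S * y (sym_diff S U) * (k U * \<tau> (sym_diff S U))))"
    using ker_split[OF assms(1) sx(2) c2] unfolding dek by simp
  have r: "ker A f x h w = avg A (\<lambda>S. e {} * (\<sigma> S * \<tau> S))
      + (\<Sum>U\<in>?I. avg A (\<lambda>S. y S * y (sym_diff S U) * (e U * (\<sigma> S * \<tau> (sym_diff S U)))))"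
    using ker_split[OF assms(1) sx(2) c3] unfolding dek by simp
  \<comment> \<open>Indicators of the negative values of \<open>\<sigma>\<close> and
    \<open>\<tau>\<close>, with frequencies \<open>\<rho>1\<close> and
    \<open>\<rho>2\<close>.\<close>
  define i j where ij: "i = (\<lambda>S. (1 - \<sigma> S) / 2)" "j = (\<lambda>S. (1 - \<tau> S) / 2)"
  have ijv: "i S = 0 \<and> \<sigma> S = 1 \<or> i S = 1 \<and> \<sigma> S = - 1" "j S = 0 \<and> \<tau> S = 1 \<or> j S = 1 \<and> \<tau> S = - 1" if "S \<subseteq> A" for S
    using pm(2,3)[OF that] unfolding ij by auto
  define \<rho>1 \<rho>2 where \<rho>: "\<rho>1 = avg A i" "\<rho>2 = avg A j"
  have ij01: "0 \<le> i S" "i S \<le> 1" "0 \<le> j S" "j S \<le> 1" if "S \<subseteq> A" for S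
    using ijv[OF that] by auto
  have \<rho>0: "0 \<le> \<rho>1" "0 \<le> \<rho>2" unfolding \<rho> using ij01 by (auto intro: avg_nonneg)
  have al': "1/4 \<le> avg A (\<lambda>S. (1 - i S) * (1 - j S))"
    using al unfolding ij st by (simp add: field_simps)
  have "avg A i \<le> avg A (\<lambda>_. 1)" using ij01 by (intro avg_mono) auto
  then have \<rho>1: "\<rho>1 \<le> 1" unfolding \<rho> by (simp add: avg_const assms(1))
  define \<mu> where "\<mu> = min \<rho>1 \<rho>2"
  have \<mu>: "\<mu> \<le> \<rho>1" "\<mu> \<le> \<rho>2" "\<mu> \<le> 1" "0 \<le> \<mu>" using \<rho>0 \<rho>1 unfolding \<mu>_def by auto

  have eq1: "1 + ker A f x h w - ker A f x g y - ker A g y h w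
      = avg A (\<lambda>S. 1 + e {} * (\<sigma> S * \<tau> S) - d {} * \<sigma> S - k {} * \<tau> S)
      + (\<Sum>U\<in>?I. avg A (\<lambda>S. y S * y (sym_diff S U)
          * (e U * (\<sigma> S * \<tau> (sym_diff S U)) - d U * \<sigma> S - k U * \<tau> (sym_diff S U))))"
    unfolding p q r right_diff_distrib avg_diff avg_add sum_subtractf avg_const[OF assms(1)] by simp
  \<comment> \<open>The lower bound uses only the marginals \<open>\<rho>1\<close> and
    \<open>\<rho>2\<close>, as the error bound does. In type \<open>(-,-)\<close> the integrand is
    at least 1, while \<open>L2\<close> and \<open>L3\<close> are at most 1/16.\<close>
  have main1: "L1 / 4 + \<rho>1 * L2 / 2 + \<rho>2 * L3 / 2
      \<le> avg A (\<lambda>S. 1 + e {} * (\<sigma> S * \<tau> S) - d {} * \<sigma> S - k {} * \<tau> S)"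
  proof -
    have "L1 / 4 + \<rho>1 * L2 / 2 + \<rho>2 * L3 / 2
        \<le> L1 * avg A (\<lambda>S. (1 - i S) * (1 - j S)) + (L2 / 2) * \<rho>1 + (L3 / 2) * \<rho>2"
      using mult_left_mono[OF al' L0(1)] by (simp add: mult.commute)
    also have "\<dots> = avg A (\<lambda>S. L1 * ((1 - i S) * (1 - j S)) + (L2 / 2) * i S + (L3 / 2) * j S)"
      unfolding avg_add avg_cmult \<rho> ..
    also have "\<dots> \<le> avg A (\<lambda>S. 1 + e {} * (\<sigma> S * \<tau> S) - d {} * \<sigma> S - k {} * \<tau> S)"
    proof (rule avg_mono)
      fix S assume S: "S \<subseteq> A"
      show "L1 * ((1 - i S) * (1 - j S)) + (L2 / 2) * i S + (L3 / 2) * j S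
          \<le> 1 + e {} * (\<sigma> S * \<tau> S) - d {} * \<sigma> S - k {} * \<tau> S"
        using ijv[OF S] sl1 sl2 sl3 L0 L16 dek0[of "{}"] by auto
    qed
    finally show ?thesis .
  qed
  \<comment> \<open>Off the diagonal the type is read at two points, \<open>\<sigma>\<close> at
    \<open>S\<close> and \<open>\<tau>\<close> at \<open>sym_diff S U\<close>. The joint
    distribution depends on \<open>U\<close>, but translation preserves the marginals, and type
    \<open>(-,-)\<close> is at most as frequent as the smaller of them,
    \<open>\<mu>\<close>.\<close>
  have err1: "\<bar>avg A (\<lambda>S. y S * y (sym_diff S U)
          * (e U * (\<sigma> S * \<tau> (sym_diff S U)) - d U * \<sigma> S - k U * \<tau> (sym_diff S U)))\<bar>
      \<le> \<bar>e U - d U - k U\<bar> + \<rho>1 * \<bar>d U - e U - k U\<bar> + \<rho>2 * \<bar>k U - d U - e U\<bar> + \<mu> * (e U + d U + k U)"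
    if "U \<in> ?I" for U
  proof -
    have U: "U \<subseteq> A" using that by auto
    have evj: "avg A (\<lambda>S. j (sym_diff S U)) = \<rho>2" unfolding \<rho> by (rule avg_sym_diff[OF U])
    have "avg A (\<lambda>S. i S * j (sym_diff S U)) \<le> avg A i"
      using ij01 sdA[OF _ U] by (intro avg_mono) (auto simp: mult_left_le)
    moreover have "avg A (\<lambda>S. i S * j (sym_diff S U)) \<le> avg A (\<lambda>S. j (sym_diff S U))"
      using ij01 sdA[OF _ U] by (intro avg_mono) (auto simp: mult_left_le_one_le)
    ultimately have evij: "avg A (\<lambda>S. i S * j (sym_diff S U)) \<le> \<mu>"
      unfolding evj unfolding \<mu>_def \<rho> by simp
    have "\<bar>avg A (\<lambda>S. y S * y (sym_diff S U)
          * (e U * (\<sigma> S * \<tau> (sym_diff S U)) - d U * \<sigma> S - k U * \<tau> (sym_diff S U)))\<bar>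
      \<le> avg A (\<lambda>S. \<bar>y S * y (sym_diff S U)
          * (e U * (\<sigma> S * \<tau> (sym_diff S U)) - d U * \<sigma> S - k U * \<tau> (sym_diff S U))\<bar>)"
      by (rule abs_avg_le)
    also have "\<dots> \<le> avg A (\<lambda>S. \<bar>e U - d U - k U\<bar> + \<bar>d U - e U - k U\<bar> * i S
        + \<bar>k U - d U - e U\<bar> * j (sym_diff S U) + (e U + d U + k U) * (i S * j (sym_diff S U)))"
    proof (rule avg_mono)
      fix S assume S: "S \<subseteq> A"
      have "\<bar>y S * y (sym_diff S U)\<bar> = 1"
        using pm(1)[OF S] pm(1)[OF sdA[OF S U]] by (elim disjE) simp_all
      then show "\<bar>y S * y (sym_diff S U)
          * (e U * (\<sigma> S * \<tau> (sym_diff S U)) - d U * \<sigma> S - k U * \<tau> (sym_diff S U))\<bar>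
        \<le> \<bar>e U - d U - k U\<bar> + \<bar>d U - e U - k U\<bar> * i S
        + \<bar>k U - d U - e U\<bar> * j (sym_diff S U) + (e U + d U + k U) * (i S * j (sym_diff S U))"
        using ijv(1)[OF S] ijv(2)[OF sdA[OF S U]] dek0[of U]
        unfolding abs_mult[of "y S * y (sym_diff S U)"] by (elim disjE conjE) simp_all
    qed
    also have "\<dots> = \<bar>e U - d U - k U\<bar> + \<bar>d U - e U - k U\<bar> * \<rho>1
        + \<bar>k U - d U - e U\<bar> * \<rho>2 + (e U + d U + k U) * avg A (\<lambda>S. i S * j (sym_diff S U))"
      unfolding avg_add avg_cmult evj avg_const[OF assms(1)] \<rho> ..
    also have "\<dots> \<le> \<bar>e U - d U - k U\<bar> + \<bar>d U - e U - k U\<bar> * \<rho>1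
        + \<bar>k U - d U - e U\<bar> * \<rho>2 + (e U + d U + k U) * \<mu>"
      using evij dek0[of U] by (intro add_left_mono mult_left_mono) auto
    finally show ?thesis by (simp add: mult.commute)
  qed
  have "\<bar>\<Sum>U\<in>?I. avg A (\<lambda>S. y S * y (sym_diff S U)
          * (e U * (\<sigma> S * \<tau> (sym_diff S U)) - d U * \<sigma> S - k U * \<tau> (sym_diff S U)))\<bar>
      \<le> (\<Sum>U\<in>?I. \<bar>e U - d U - k U\<bar> + \<rho>1 * \<bar>d U - e U - k U\<bar> + \<rho>2 * \<bar>k U - d U - e U\<bar> + \<mu> * (e U + d U + k U))"
    using err1 by (intro order.trans[OF sum_abs] sum_mono)
  also have "\<dots> = (\<Sum>U\<in>?I. \<bar>e U - d U - k U\<bar>) + \<rho>1 * (\<Sum>U\<in>?I. \<bar>d U - e U - k U\<bar>)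
      + \<rho>2 * (\<Sum>U\<in>?I. \<bar>k U - d U - e U\<bar>) + \<mu> * (\<Sum>U\<in>?I. e U + d U + k U)"
    by (simp only: sum.distrib distrib_left sum_distrib_left)
  also have "\<dots> \<le> L1 / 100 + \<rho>1 * (L2 / 100) + \<rho>2 * (L3 / 100) + \<mu> * ((L1 + L2 + L3) / 100)"
    using E1 E2 E3 E4 \<rho>0 \<mu> by (intro add_mono mult_left_mono) auto
  also have "\<dots> \<le> L1 / 4 + \<rho>1 * L2 / 2 + \<rho>2 * L3 / 2"
  proof -
    have "\<mu> * L1 \<le> 1 * L1" "\<mu> * L2 \<le> \<rho>1 * L2" "\<mu> * L3 \<le> \<rho>2 * L3"
      using \<mu> L0 by (intro mult_right_mono; simp)+
    moreover have "0 \<le> \<rho>1 * L2" "0 \<le> \<rho>2 * L3" using \<rho>0 L0 by auto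
    ultimately show ?thesis using L0 unfolding distrib_left add_divide_distrib by simp
  qed
  finally show "ker A f x g y + ker A g y h w \<le> 1 + ker A f x h w"
    using main1 eq1 by (simp add: abs_le_iff)

  have eq2: "1 + ker A f x h w + ker A f x g y + ker A g y h w
      = avg A (\<lambda>S. 1 + e {} * (\<sigma> S * \<tau> S) + d {} * \<sigma> S + k {} * \<tau> S)
      + (\<Sum>U\<in>?I. avg A (\<lambda>S. y S * y (sym_diff S U)
          * (e U * (\<sigma> S * \<tau> (sym_diff S U)) + d U * \<sigma> S + k U * \<tau> (sym_diff S U))))"
    unfolding p q r distrib_left avg_add sum.distrib avg_const[OF assms(1)] by simp
  have aux: "0 \<le> m + s"
    if "1/4 \<le> m" "\<bar>s\<bar> \<le> t" "t \<le> (L1 + L2 + L3) / 100" "L1 \<le> 1/16" "L2 \<le> 1/16" "L3 \<le> 1/16"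
    for m s t :: real
  proof -
    have "(L1 + L2 + L3) / 100 \<le> 1/4" using that by simp
    then show ?thesis using that(1-3) by (simp only: abs_le_iff) linarith
  qed
  \<comment> \<open>Type \<open>(+,+)\<close> contributes at least 1 and has frequency at least 1/4;
    in the other types the slacks make the integrand nonnegative.\<close>
  have "1/4 \<le> avg A (\<lambda>S. 1 + e {} * (\<sigma> S * \<tau> S) + d {} * \<sigma> S + k {} * \<tau> S)"
  proof (rule order.trans[OF al' avg_mono])
    fix S assume S: "S \<subseteq> A"
    show "(1 - i S) * (1 - j S) \<le> 1 + e {} * (\<sigma> S * \<tau> S) + d {} * \<sigma> S + k {} * \<tau> S"
      using ijv[OF S] sl1 sl2 sl3 L0 dek0[of "{}"] by auto
  qed
  moreover have "\<bar>\<Sum>U\<in>?I. avg A (\<lambda>S. y S * y (sym_diff S U)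
          * (e U * (\<sigma> S * \<tau> (sym_diff S U)) + d U * \<sigma> S + k U * \<tau> (sym_diff S U)))\<bar>
      \<le> (\<Sum>U\<in>?I. e U + d U + k U)"
  proof (intro order.trans[OF sum_abs] sum_mono)
    fix U assume "U \<in> ?I"
    then have U: "U \<subseteq> A" by auto
    have "\<bar>avg A (\<lambda>S. y S * y (sym_diff S U)
          * (e U * (\<sigma> S * \<tau> (sym_diff S U)) + d U * \<sigma> S + k U * \<tau> (sym_diff S U)))\<bar>
      \<le> avg A (\<lambda>S. \<bar>y S * y (sym_diff S U)
          * (e U * (\<sigma> S * \<tau> (sym_diff S U)) + d U * \<sigma> S + k U * \<tau> (sym_diff S U))\<bar>)"
      by (rule abs_avg_le)
    also have "\<dots> \<le> avg A (\<lambda>S. e U + d U + k U)"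
    proof (rule avg_mono)
      fix S assume S: "S \<subseteq> A"
      have "\<bar>y S * y (sym_diff S U)\<bar> = 1"
        using pm(1)[OF S] pm(1)[OF sdA[OF S U]] by (elim disjE) simp_all
      then show "\<bar>y S * y (sym_diff S U)
          * (e U * (\<sigma> S * \<tau> (sym_diff S U)) + d U * \<sigma> S + k U * \<tau> (sym_diff S U))\<bar> \<le> e U + d U + k U"
        using ijv(1)[OF S] ijv(2)[OF sdA[OF S U]] dek0[of U]
        unfolding abs_mult[of "y S * y (sym_diff S U)"] by (elim disjE conjE) simp_all
    qed
    finally show "\<bar>avg A (\<lambda>S. y S * y (sym_diff S U)
          * (e U * (\<sigma> S * \<tau> (sym_diff S U)) + d U * \<sigma> S + k U * \<tau> (sym_diff S U)))\<bar> \<le> e U + d U + k U"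
      by (simp add: avg_const assms(1))
  qed
  ultimately have "0 \<le> 1 + ker A f x h w + ker A f x g y + ker A g y h w"
    unfolding eq2 using E4 L16 by (intro aux)
  then show "- 1 \<le> ker A f x g y + ker A g y h w + ker A f x h w" by linarith
qed

section \<open>Symmetries of the inner product and alignment along orbits\<close>

lemma corr_uminus: "corr A (\<lambda>z. - f z) g U = - corr A f g U"
  unfolding corr_def fourier_def by (simp add: avg_minus)

lemma sigcorr_uminus: "sigcorr A (\<lambda>S. - x S) y U = - sigcorr A x y U" "sigcorr A x (\<lambda>S. - y S) U = - sigcorr A x y U"
  unfolding sigcorr_def by (simp_all add: avg_minus)

lemma ker_uminus_left: "ker A (\<lambda>z. - f z) x g y = ker A f x g y"
  unfolding ker_def by (simp add: corr_uminus)

lemma ker_uminus_right: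
  "ker A f (\<lambda>S. - x S) g y = - ker A f x g y" "ker A f x g (\<lambda>S. - y S) = - ker A f x g y"
  unfolding ker_def by (simp_all add: sigcorr_uminus sum_negf)

lemma corr_shift:
  assumes "finite A" "T \<subseteq> A" "U \<subseteq> A"
  shows "corr A (\<lambda>z. f z * chi T z) g U = corr A f g (sym_diff U T)"
proof -
  have "finite T" "finite U" using assms finite_subset by blast+
  then have "chi (sym_diff U T) z = chi T z * chi U z" for z by (simp only: chi_sym_diff mult.commute)
  then show ?thesis unfolding corr_def fourier_def by (simp add: mult_ac)
qed

lemma sigcorr_shift:
  assumes "T \<subseteq> A" "U \<subseteq> A"
  shows "sigcorr A (\<lambda>S. x (sym_diff S T)) y U = sigcorr A x y (sym_diff U T)"
proof -
  have "sigcorr A x y (sym_diff U T) = avg A (\<lambda>S. x (sym_diff S T) * y (sym_diff (sym_diff S T) (sym_diff U T)))"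
    unfolding sigcorr_def using avg_sym_diff[OF assms(1), of "\<lambda>S. x S * y (sym_diff S (sym_diff U T))"] by simp
  also have "\<dots> = avg A (\<lambda>S. x (sym_diff S T) * y (sym_diff S U))"
  proof (rule avg_cong)
    fix S
    have "sym_diff (sym_diff S T) (sym_diff U T) = sym_diff S U" by auto
    then show "x (sym_diff S T) * y (sym_diff (sym_diff S T) (sym_diff U T)) = x (sym_diff S T) * y (sym_diff S U)"
      by simp
  qed
  finally show ?thesis unfolding sigcorr_def by simp
qed

text \<open>The move along the orbit translates the index of both \<open>corr\<close> and
  \<open>sigcorr\<close> by \<open>T\<close>, and the sum over all \<open>U\<close> does not see
  this.\<close>

lemma ker_shift:
  assumes "finite A" "T \<subseteq> A"
  shows "ker A (\<lambda>z. f z * chi T z) (\<lambda>S. x (sym_diff S T)) g y = ker A f x g y"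
proof -
  have "ker A (\<lambda>z. f z * chi T z) (\<lambda>S. x (sym_diff S T)) g y
      = (\<Sum>U\<in>Pow A. corr A f g (sym_diff U T) ^ 20 * sigcorr A x y (sym_diff U T))"
    unfolding ker_def using assms by (intro sum.cong) (simp_all add: corr_shift sigcorr_shift)
  also have "\<dots> = ker A f x g y"
    unfolding ker_def by (rule sum_sym_diff[OF assms(2)])
  finally show ?thesis .
qed

lemma sign_choice:
  fixes p q r :: real
  assumes "s1 = 1 \<or> s1 = - 1" "s3 = 1 \<or> s3 = - 1"
    and "s1 * p + s3 * q \<le> 1 + s1 * s3 * r" "s1 * p + s1 * s3 * r \<le> 1 + s3 * q"
    "s3 * q + s1 * s3 * r \<le> 1 + s1 * p" "- 1 \<le> s1 * p + s3 * q + s1 * s3 * r"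
  shows "p + q \<le> 1 + r"
  using assms by (elim disjE) simp_all

text \<open>Flipping the signs of \<open>x\<close> and \<open>w\<close> makes the most frequent type \<open>(+,+)\<close>. It permutes the four
  inequalities \<open>p + q \<le> 1 + r\<close>, \<open>p + r \<le> 1 + q\<close>, \<open>q + r \<le> 1 + p\<close>, \<open>-p - q - r \<le> 1\<close> between the inner products.\<close>

lemma near_triangle:
  assumes "finite A" and sf: "sgn_fun A f" "sgn_fun A g" "sgn_fun A h"
    and sx: "sgn_fun A x" "sgn_fun A y" "sgn_fun A w"
    and D: "1 - corr A f g {} \<le> 1/4" "1 - corr A g h {} \<le> 1/4" "1 - corr A f h {} \<le> 1/4"
  shows "ker A f x g y + ker A g y h w \<le> 1 + ker A f x h w"
proof -
  let ?E = "\<lambda>s1 s3. avg A (\<lambda>S. (1 + s1 * x S * y S) / 2 * ((1 + s3 * w S * y S) / 2))"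
  have "?E 1 1 + ?E 1 (- 1) + ?E (- 1) 1 + ?E (- 1) (- 1) = avg A (\<lambda>S. 1)"
    unfolding avg_add[symmetric] by (intro avg_cong) (simp add: field_simps)
  then have "?E 1 1 + ?E 1 (- 1) + ?E (- 1) 1 + ?E (- 1) (- 1) = 1"
    by (simp add: avg_const assms(1))
  then have "1/4 \<le> ?E 1 1 \<or> 1/4 \<le> ?E 1 (- 1) \<or> 1/4 \<le> ?E (- 1) 1 \<or> 1/4 \<le> ?E (- 1) (- 1)"
    by linarith
  then obtain s1 s3 :: real where s: "s1 = 1 \<or> s1 = - 1" "s3 = 1 \<or> s3 = - 1" and E: "1/4 \<le> ?E s1 s3"
    by (elim disjE) blast+
  let ?x = "\<lambda>S. s1 * x S" and ?w = "\<lambda>S. s3 * w S"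
  have sx': "sgn_fun A ?x" "sgn_fun A ?w"
    using s sx sgn_fun_minus by auto
  have kx: "ker A f' ?x g' y' = s1 * ker A f' x g' y'" "ker A f' y' g' ?x = s1 * ker A f' y' g' x" for f' g' y'
    using s(1) by (auto simp: ker_uminus_right)
  have kw: "ker A f' ?w g' y' = s3 * ker A f' w g' y'" "ker A f' y' g' ?w = s3 * ker A f' y' g' w" for f' g' y'
    using s(2) by (auto simp: ker_uminus_right)
  have D': "1 - corr A g f {} \<le> 1/4" "1 - corr A h g {} \<le> 1/4" "1 - corr A h f {} \<le> 1/4"
    using D by (simp_all add: corr_commute[of A h] corr_commute[of A g f])
  \<comment> \<open>In type \<open>(+,+)\<close> all three signs agree, so its frequency does not
    depend on which of the three functions takes the middle position.\<close>
  have E2: "1/4 \<le> avg A (\<lambda>S. (1 + y S * ?x S) / 2 * ((1 + ?w S * ?x S) / 2))"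
  proof (rule order.trans[OF E], rule avg_mono)
    fix S assume S: "S \<subseteq> A"
    show "(1 + s1 * x S * y S) / 2 * ((1 + s3 * w S * y S) / 2)
        \<le> (1 + y S * ?x S) / 2 * ((1 + ?w S * ?x S) / 2)"
      using s sgn_funD[OF sx(1) S] sgn_funD[OF sx(2) S] sgn_funD[OF sx(3) S] by (elim disjE) simp_all
  qed
  have E3: "1/4 \<le> avg A (\<lambda>S. (1 + ?x S * ?w S) / 2 * ((1 + y S * ?w S) / 2))"
  proof (rule order.trans[OF E], rule avg_mono)
    fix S assume S: "S \<subseteq> A"
    show "(1 + s1 * x S * y S) / 2 * ((1 + s3 * w S * y S) / 2)
        \<le> (1 + ?x S * ?w S) / 2 * ((1 + y S * ?w S) / 2)"
      using s sgn_funD[OF sx(1) S] sgn_funD[OF sx(2) S] sgn_funD[OF sx(3) S] by (elim disjE) simp_all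
  qed
  note i1 = near_triangle_aligned[OF assms(1) sf sx'(1) sx(2) sx'(2) D E]
  note i2 = near_triangle_aligned(1)[OF assms(1) sf(2,1,3) sx(2) sx' D'(1) D(3,2) E2]
  note i3 = near_triangle_aligned(1)[OF assms(1) sf(1,3,2) sx' sx(2) D(3) D'(2) D(1) E3]
  show ?thesis
  proof (rule sign_choice[OF s])
    show "s1 * ker A f x g y + s3 * ker A g y h w \<le> 1 + s1 * s3 * ker A f x h w"
      and "- 1 \<le> s1 * ker A f x g y + s3 * ker A g y h w + s1 * s3 * ker A f x h w"
      using i1 by (simp_all add: kx kw mult_ac)
    show "s1 * ker A f x g y + s1 * s3 * ker A f x h w \<le> 1 + s3 * ker A g y h w"
      using i2 by (simp add: kx kw mult_ac ker_commute[of A g y f x])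
    show "s3 * ker A g y h w + s1 * s3 * ker A f x h w \<le> 1 + s1 * ker A f x g y"
      using i3 by (simp add: kx kw mult_ac ker_commute[of A h w g y])
  qed
qed

text \<open>A move along the orbit carries the correlation at \<open>T\<close> to the empty set; a
  change of sign of \<open>f\<close>, invisible to the even tensor power, makes it nonnegative. The
  inner products stay the same, so a triangle may be aligned before it is estimated.\<close>

lemma align:
  assumes "finite A" "sgn_fun A f" "sgn_fun A x" "T \<subseteq> A"
  obtains f' x' where "sgn_fun A f'" "sgn_fun A x'" "corr A f' g {} = \<bar>corr A f g T\<bar>"
    "\<And>h w. ker A f' x' h w = ker A f x h w"
    "\<And>h U. U \<subseteq> A \<Longrightarrow> \<bar>corr A f' h U\<bar> = \<bar>corr A f h (sym_diff U T)\<bar>"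
proof -
  let ?f = "\<lambda>z. f z * chi T z" and ?x = "\<lambda>S. x (sym_diff S T)"
  have sf: "sgn_fun A ?f" using assms sgn_fun_mult sgn_fun_chi by blast
  have sx: "sgn_fun A ?x" using assms sgn_fun_shift by blast
  have c: "corr A ?f h U = corr A f h (sym_diff U T)" if "U \<subseteq> A" for h U
    using corr_shift[OF assms(1,4) that] .
  have k: "ker A ?f ?x h w = ker A f x h w" for h w using ker_shift[OF assms(1,4)] .
  show thesis
  proof (cases "0 \<le> corr A f g T")
    case True
    then show thesis using that[OF sf sx] c k by simp
  next
    case False
    then show thesis
      using that[OF sgn_fun_minus[OF sf] sx] c k by (simp add: corr_uminus ker_uminus_left)
  qed
qed

text \<open>After alignment with \<open>g\<close> the distances from \<open>f\<close> and
  \<open>h\<close> to \<open>g\<close> are below 1/8, hence all three are at most 1/4. This is why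
  the threshold is 7/8. All three rotations follow at once, since closeness is then mutual.\<close>

lemma two_near_triangle:
  assumes "finite A" and sf: "sgn_fun A f" "sgn_fun A g" "sgn_fun A h"
    and sx: "sgn_fun A x" "sgn_fun A y" "sgn_fun A w"
    and near: "T1 \<subseteq> A" "7/8 < \<bar>corr A f g T1\<bar>" "T2 \<subseteq> A" "7/8 < \<bar>corr A g h T2\<bar>"
  shows "ker A f x g y + ker A g y h w \<le> 1 + ker A f x h w"
    "ker A f x g y + ker A f x h w \<le> 1 + ker A g y h w"
    "ker A g y h w + ker A f x h w \<le> 1 + ker A f x g y"
proof -
  obtain f' x' where f': "sgn_fun A f'" "sgn_fun A x'" "corr A f' g {} = \<bar>corr A f g T1\<bar>"
    "\<And>h w. ker A f' x' h w = ker A f x h w"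
    using align[OF assms(1) sf(1) sx(1) near(1)] by metis
  obtain h' w' where h': "sgn_fun A h'" "sgn_fun A w'" "corr A h' g {} = \<bar>corr A h g T2\<bar>"
    "\<And>f x. ker A h' w' f x = ker A h w f x"
    using align[OF assms(1) sf(3) sx(3) near(3)] by metis
  have k: "ker A f' x' g y = ker A f x g y" "ker A g y h' w' = ker A g y h w" "ker A f' x' h' w' = ker A f x h w"
    unfolding f'(4) ker_commute[of A g y h' w'] ker_commute[of A f x h' w'] h'(4)
    by (rule refl ker_commute)+
  have D: "1 - corr A f' g {} \<le> 1/4" "1 - corr A g h' {} \<le> 1/4" "1 - corr A f' h' {} \<le> 1/4"
    using f'(3) h'(3) near corr_empty_triangle[OF assms(1) f'(1) sf(2) h'(1)]
    by (simp_all add: corr_commute[of A g])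
  then have D': "1 - corr A g f' {} \<le> 1/4" "1 - corr A h' g {} \<le> 1/4" "1 - corr A h' f' {} \<le> 1/4"
    by (simp_all only: corr_commute[of A g f'] corr_commute[of A h' g] corr_commute[of A h' f'])
  show "ker A f x g y + ker A g y h w \<le> 1 + ker A f x h w"
    using near_triangle[OF assms(1) f'(1) sf(2) h'(1) f'(2) sx(2) h'(2) D] unfolding k .
  show "ker A f x g y + ker A f x h w \<le> 1 + ker A g y h w"
    using near_triangle[OF assms(1) sf(2) f'(1) h'(1) sx(2) f'(2) h'(2) D'(1) D(3,2)]
    by (simp only: k ker_commute[of A g y f' x'])
  show "ker A g y h w + ker A f x h w \<le> 1 + ker A f x g y"
    using near_triangle[OF assms(1) f'(1) h'(1) sf(2) f'(2) h'(2) sx(2) D(3) D'(2) D(1)]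
    by (simp only: k ker_commute[of A h' w' g y] add.commute)
qed

section \<open>One function far from the other two\<close>

lemma abs_sigcorr_diff_le:
  assumes "finite A" "sgn_fun A x" "sgn_fun A y" "sgn_fun A w" "U \<subseteq> A"
  shows "\<bar>sigcorr A y w U - sigcorr A x w U\<bar> \<le> 1 - sigcorr A x y {}"
proof -
  have "sigcorr A y w U - sigcorr A x w U = avg A (\<lambda>S. (y S - x S) * w (sym_diff S U))"
    unfolding sigcorr_def avg_diff[symmetric] by (simp add: algebra_simps)
  also have "\<bar>\<dots>\<bar> \<le> avg A (\<lambda>S. \<bar>(y S - x S) * w (sym_diff S U)\<bar>)" by (rule abs_avg_le)
  also have "\<dots> = avg A (\<lambda>S. 1 - x S * y S)"
  proof (rule avg_cong)
    fix S assume S: "S \<subseteq> A"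
    then have "sym_diff S U \<subseteq> A" using assms by auto
    then have "\<bar>w (sym_diff S U)\<bar> = 1" by (rule abs_sgn_fun[OF assms(4)])
    then show "\<bar>(y S - x S) * w (sym_diff S U)\<bar> = 1 - x S * y S"
      using abs_sgn_fun_diff(1)[OF assms(2,3) S] unfolding abs_mult by (simp add: abs_minus_commute)
  qed
  also have "\<dots> = 1 - sigcorr A x y {}"
    unfolding avg_diff sigcorr_def using avg_const[OF assms(1), of 1] by simp
  finally show ?thesis .
qed

text \<open>Let \<open>D\<close> be the distance of \<open>f\<close> and \<open>g\<close>, and
  \<open>p\<close> the diagonal correlation of \<open>x\<close> and \<open>y\<close>. Seen from the
  far point, the inner product changes by at most \<open>10 * D + (1 - p) / 2\<close>, because high
  powers of 7/8 damp both contributions. On the other side \<open>1 - ker A f x g y\<close> is at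
  least \<open>(1 - a ^ 20) + a ^ 20 * (1 - p) - D\<close>, where Bernoulli gives
  \<open>11 * D\<close> for the first summand.\<close>

lemma far_lipschitz_aligned:
  assumes "finite A" and sf: "sgn_fun A f" "sgn_fun A g" "sgn_fun A h"
    and sx: "sgn_fun A x" "sgn_fun A y" "sgn_fun A w"
    and far: "\<And>U. U \<subseteq> A \<Longrightarrow> \<bar>corr A g h U\<bar> \<le> 7/8" "\<And>U. U \<subseteq> A \<Longrightarrow> \<bar>corr A f h U\<bar> \<le> 7/8"
    and a: "0 \<le> corr A f g {}" "3/4 \<le> corr A f g {} ^ 18"
  shows "ker A g y h w - ker A f x h w \<le> 1 - ker A f x g y"
proof -
  define a where "a = corr A f g {}"
  define D where "D = 1 - a"
  define p where "p = sigcorr A x y {}"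
  have a01: "0 \<le> a" "a \<le> 1" using a abs_corr_le_1[OF assms(1) sf(1,2), of "{}"] unfolding a_def by auto
  have D0: "0 \<le> D" "D \<le> 1" using a01 unfolding D_def by auto
  have p1: "p \<le> 1" using abs_sigcorr_le_1[OF assms(1) sx(1,2), of "{}"] unfolding p_def by auto
  have a20: "9/16 \<le> a ^ 20"
  proof -
    have "(3/4)\<^sup>2 \<le> (a ^ 18)\<^sup>2" using a(2) unfolding a_def by (intro power_mono) auto
    also have "\<dots> = a ^ 36" by (simp flip: power_mult)
    also have "\<dots> \<le> a ^ 20" using a01 by (intro power_decreasing) auto
    finally show ?thesis by (simp add: power2_eq_square)
  qed
  have upper: "ker A g y h w - ker A f x h w \<le> 20 * D * ((7/8) ^ 17 * 2) + (7/8) ^ 18 * (1 - p)"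
  proof -
    have "ker A g y h w - ker A f x h w
        = (\<Sum>U\<in>Pow A. (corr A g h U ^ 20 - corr A f h U ^ 20) * sigcorr A y w U
          + corr A f h U ^ 20 * (sigcorr A y w U - sigcorr A x w U))"
      unfolding ker_def sum_subtractf[symmetric] by (simp add: algebra_simps)
    also have "\<dots> \<le> (\<Sum>U\<in>Pow A. 20 * D * (7/8) ^ 17 * ((corr A f h U)\<^sup>2 + (corr A g h U)\<^sup>2)
          + \<bar>corr A f h U\<bar> ^ (18 + 2) * (1 - p))"
    proof (rule sum_mono)
      fix U assume "U \<in> Pow A"
      then have U: "U \<subseteq> A" by auto
      have "\<bar>corr A f h U ^ (17 + 3) - corr A g h U ^ (17 + 3)\<bar>
        \<le> real (17 + 3) * \<bar>corr A f h U - corr A g h U\<bar> * ((7/8) ^ 17 * ((corr A f h U)\<^sup>2 + (corr A g h U)\<^sup>2))"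
        by (rule power_diff_le[OF far(2)[OF U] far(1)[OF U]])
      also have "\<dots> \<le> real (17 + 3) * D * ((7/8) ^ 17 * ((corr A f h U)\<^sup>2 + (corr A g h U)\<^sup>2))"
        using abs_corr_diff_le[OF assms(1) sf, of U] unfolding D_def a_def
        by (intro mult_right_mono mult_left_mono) auto
      finally have t1: "\<bar>corr A g h U ^ 20 - corr A f h U ^ 20\<bar>
          \<le> 20 * D * (7/8) ^ 17 * ((corr A f h U)\<^sup>2 + (corr A g h U)\<^sup>2)"
        by (simp add: mult_ac abs_minus_commute)
      have "(corr A g h U ^ 20 - corr A f h U ^ 20) * sigcorr A y w U
          \<le> \<bar>corr A g h U ^ 20 - corr A f h U ^ 20\<bar> * \<bar>sigcorr A y w U\<bar>"
        unfolding abs_mult[symmetric] by (rule abs_ge_self)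
      also have "\<dots> \<le> \<bar>corr A g h U ^ 20 - corr A f h U ^ 20\<bar> * 1"
        using abs_sigcorr_le_1[OF assms(1) sx(2,3) U] by (intro mult_left_mono) auto
      finally have t2: "(corr A g h U ^ 20 - corr A f h U ^ 20) * sigcorr A y w U
          \<le> 20 * D * (7/8) ^ 17 * ((corr A f h U)\<^sup>2 + (corr A g h U)\<^sup>2)"
        using t1 by (simp only: mult_1_right)
      have "corr A f h U ^ 20 * (sigcorr A y w U - sigcorr A x w U) \<le> corr A f h U ^ 20 * (1 - p)"
        using abs_sigcorr_diff_le[OF assms(1) sx U] unfolding p_def
        by (intro mult_left_mono) (auto simp: zero_le_even_power)
      then have "corr A f h U ^ 20 * (sigcorr A y w U - sigcorr A x w U) \<le> \<bar>corr A f h U\<bar> ^ (18 + 2) * (1 - p)"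
        by (simp add: power_even_abs)
      then show "(corr A g h U ^ 20 - corr A f h U ^ 20) * sigcorr A y w U
          + corr A f h U ^ 20 * (sigcorr A y w U - sigcorr A x w U)
        \<le> 20 * D * (7/8) ^ 17 * ((corr A f h U)\<^sup>2 + (corr A g h U)\<^sup>2)
          + \<bar>corr A f h U\<bar> ^ (18 + 2) * (1 - p)"
        using t2 by linarith
    qed
    also have "\<dots> = 20 * D * (7/8) ^ 17 * ((\<Sum>U\<in>Pow A. (corr A f h U)\<^sup>2) + (\<Sum>U\<in>Pow A. (corr A g h U)\<^sup>2))
        + (\<Sum>U\<in>Pow A. \<bar>corr A f h U\<bar> ^ (18 + 2)) * (1 - p)"
      by (simp only: sum.distrib sum_distrib_left[symmetric] sum_distrib_right[symmetric])
    also have "\<dots> = 20 * D * ((7/8) ^ 17 * 2) + (\<Sum>U\<in>Pow A. \<bar>corr A f h U\<bar> ^ (18 + 2)) * (1 - p)"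
      by (simp add: sum_corr_sq assms)
    also have "(\<Sum>U\<in>Pow A. \<bar>corr A f h U\<bar> ^ (18 + 2)) * (1 - p) \<le> (7/8) ^ 18 * 1 * (1 - p)"
      using far(2) p1 sum_corr_sq[OF assms(1) sf(1,3)]
      by (intro mult_right_mono sum_power_le) auto
    finally show ?thesis by simp
  qed
  have lower: "1 - a ^ 20 * p - D \<le> 1 - ker A f x g y"
  proof -
    have "ker A f x g y = a ^ 20 * p + (\<Sum>U\<in>Pow A - {{}}. corr A f g U ^ 20 * sigcorr A x y U)"
      unfolding ker_def a_def p_def by (rule sum_Pow_remove_empty[OF assms(1)])
    also have "(\<Sum>U\<in>Pow A - {{}}. corr A f g U ^ 20 * sigcorr A x y U) \<le> (\<Sum>U\<in>Pow A - {{}}. corr A f g U ^ 20)"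
    proof (rule sum_mono)
      fix U assume "U \<in> Pow A - {{}}"
      then have "sigcorr A x y U \<le> 1" using abs_sigcorr_le_1[OF assms(1) sx(1,2), of U] by auto
      then have "corr A f g U ^ 20 * sigcorr A x y U \<le> corr A f g U ^ 20 * 1"
        by (intro mult_left_mono) (auto simp: zero_le_even_power)
      then show "corr A f g U ^ 20 * sigcorr A x y U \<le> corr A f g U ^ 20" by simp
    qed
    also have "\<dots> \<le> D ^ 18 * (2 * D)"
      unfolding D_def a_def by (rule sum_corr_power_nonempty[OF assms(1) sf(1,2)])
    also have "\<dots> \<le> (1/2) * (2 * D)"
    proof (rule mult_right_mono)
      have "a ^ 18 \<le> a ^ 1" using a01 by (intro power_decreasing) auto
      then have "D \<le> 1/4" using a(2) unfolding D_def a_def by simp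
      moreover have "D ^ 18 \<le> D ^ 1" using D0 by (intro power_decreasing) auto
      ultimately show "D ^ 18 \<le> 1/2" by simp
    qed (use D0 in auto)
    finally show ?thesis by simp
  qed
  have "20 * D * ((7/8) ^ 17 * 2) \<le> 20 * D * (1/2)"
    using D0 by (intro mult_left_mono) (auto simp: power_divide)
  moreover have "(7/8) ^ 18 * (1 - p) \<le> (1/2) * (1 - p)"
    using p1 by (intro mult_right_mono) (auto simp: power_divide)
  ultimately have upper': "ker A g y h w - ker A f x h w \<le> 10 * D + (1 - p) / 2"
    using order.trans[OF upper add_mono] by fastforce
  \<comment> \<open>As 20 * 9/16 exceeds 11, this leaves one \<open>D\<close> beyond the 10 of
    \<open>upper'\<close>; it pays for the off-diagonal loss in \<open>lower\<close>.\<close>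
  have "20 * D * (9/16) \<le> 20 * D * a ^ 20" using a20 D0 by (intro mult_left_mono) auto
  then have 1: "11 * D \<le> 1 - a ^ 20"
    using Bernoulli_diff_ge[OF a01, of 20] D0(1) unfolding D_def[symmetric] by simp
  have "(1/2) * (1 - p) \<le> a ^ 20 * (1 - p)" using a20 p1 by (intro mult_right_mono) auto
  then have 2: "(1 - p) / 2 \<le> a ^ 20 - a ^ 20 * p" by (simp add: right_diff_distrib)
  show ?thesis using upper' lower 1 2 by linarith
qed

text \<open>If the inner product of the pair is at most 3/4, the right-hand side is at least 1/4,
  and the two far inner products are at most 1/8 each. Otherwise some correlation of
  \<open>f\<close> and \<open>g\<close> has an 18th power of at least 3/4, and alignment moves it to
  the empty set.\<close>

lemma far_lipschitz:
  assumes "finite A" and sf: "sgn_fun A f" "sgn_fun A g" "sgn_fun A h"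
    and sx: "sgn_fun A x" "sgn_fun A y" "sgn_fun A w"
    and far: "\<And>U. U \<subseteq> A \<Longrightarrow> \<bar>corr A g h U\<bar> \<le> 7/8" "\<And>U. U \<subseteq> A \<Longrightarrow> \<bar>corr A f h U\<bar> \<le> 7/8"
  shows "ker A g y h w - ker A f x h w \<le> 1 - ker A f x g y"
proof (cases "ker A f x g y \<le> 3/4")
  case True
  have "\<bar>ker A g y h w\<bar> \<le> (7/8) ^ 18" "\<bar>ker A f x h w\<bar> \<le> (7/8) ^ 18"
    using assms by (intro abs_ker_le; simp)+
  moreover have "(7/8) ^ 18 \<le> (1/8 :: real)" by (simp add: power_divide)
  ultimately show ?thesis using True by linarith
next
  case False
  define \<theta> where "\<theta> = Max ((\<lambda>U. \<bar>corr A f g U\<bar>) ` Pow A)"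
  have "\<theta> \<in> (\<lambda>U. \<bar>corr A f g U\<bar>) ` Pow A"
    unfolding \<theta>_def using assms(1) by (intro Max_in) auto
  then obtain T where T: "T \<subseteq> A" "\<theta> = \<bar>corr A f g T\<bar>" by auto
  have "\<bar>corr A f g U\<bar> \<le> \<theta>" if "U \<subseteq> A" for U
    unfolding \<theta>_def using assms(1) that by (intro Max_ge) auto
  then have "\<bar>ker A f x g y\<bar> \<le> \<theta> ^ 18"
    using assms T(2) by (intro abs_ker_le) auto
  then have th: "3/4 \<le> \<theta> ^ 18" using False by linarith
  obtain f' x' where f': "sgn_fun A f'" "sgn_fun A x'" "corr A f' g {} = \<theta>"
    "\<And>h w. ker A f' x' h w = ker A f x h w"
    "\<And>h U. U \<subseteq> A \<Longrightarrow> \<bar>corr A f' h U\<bar> = \<bar>corr A f h (sym_diff U T)\<bar>"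
    using align[OF assms(1) sf(1) sx(1) T(1), of g] T(2) by metis
  have "\<bar>corr A f' h U\<bar> \<le> 7/8" if "U \<subseteq> A" for U
  proof -
    have "sym_diff U T \<subseteq> A" using that T by auto
    from far(2)[OF this] show ?thesis using f'(5)[OF that] by simp
  qed
  then have "ker A g y h w - ker A f' x' h w \<le> 1 - ker A f' x' g y"
    using far(1) th T(2) f'(3) by (intro far_lipschitz_aligned assms f'(1,2)) auto
  then show ?thesis using f'(4) by simp
qed

text \<open>Of the three pairs, two are near or two are far. Two near pairs make the whole triangle
  close after alignment; two far pairs share a function, which is then far from both others.\<close>

theorem ker_triangle:
  assumes "finite A" and sf: "sgn_fun A f" "sgn_fun A g" "sgn_fun A h"
    and sx: "sgn_fun A x" "sgn_fun A y" "sgn_fun A w"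
  shows "ker A f x g y + ker A g y h w \<le> 1 + ker A f x h w"
proof -
  define near where "near f g \<longleftrightarrow> (\<exists>T\<subseteq>A. 7/8 < \<bar>corr A f g T\<bar>)" for f g
  have near_sym: "near f g \<longleftrightarrow> near g f" for f g unfolding near_def by (simp add: corr_commute)
  have two: "ker A f x g y + ker A g y h w \<le> 1 + ker A f x h w \<and>
    ker A f x g y + ker A f x h w \<le> 1 + ker A g y h w \<and>
    ker A g y h w + ker A f x h w \<le> 1 + ker A f x g y"
    if "near f g" "near g h" "sgn_fun A f" "sgn_fun A g" "sgn_fun A h" "sgn_fun A x" "sgn_fun A y" "sgn_fun A w"
    for f g h x y w
    using that two_near_triangle[OF assms(1) that(3-)] unfolding near_def by blast
  have far: "ker A g y h w - ker A f x h w \<le> 1 - ker A f x g y"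
    if "\<not> near g h" "\<not> near f h" "sgn_fun A f" "sgn_fun A g" "sgn_fun A h" "sgn_fun A x" "sgn_fun A y" "sgn_fun A w"
    for f g h x y w
    using that unfolding near_def by (intro far_lipschitz assms(1)) (auto simp: not_less)
  consider "near f g" "near g h" | "near f g" "near f h" | "near g h" "near f h"
    | "\<not> near f g" "\<not> near g h" | "\<not> near f g" "\<not> near f h" | "\<not> near g h" "\<not> near f h" by blast
  then show ?thesis
  proof cases
    case 1
    then show ?thesis using two[of f g h x y w] sf sx by blast
  next
    case 2
    then show ?thesis using two[of g f h y x w] sf sx near_sym by (simp add: ker_commute[of A g y f x])
  next
    case 3
    then show ?thesis using two[of f h g x w y] sf sx near_sym by (simp add: ker_commute[of A h w g y])
  next
    \<comment> \<open>The Lipschitz estimate bounds differences. Here the far function is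
      \<open>g\<close>, and replacing \<open>w\<close> by its negative produces the required
      signs.\<close>
    case 4
    then show ?thesis
      using far[of f g h "\<lambda>S. - w S" x y] sf sx sgn_fun_minus[OF sx(3)] near_sym
      by (simp add: ker_uminus_right ker_commute[of A h] ker_commute[of A g y f x])
  next
    case 5
    then show ?thesis
      using far[of g f h w y x] sf sx near_sym
      by (simp add: ker_commute[of A h] ker_commute[of A g y f x])
  next
    case 6
    then show ?thesis using far[of g h f x y w] sf sx by simp
  qed
qed

section \<open>The cube of pairs of sign functions\<close>

text \<open>The tensor construction in coordinates, indexed by 20-tuples of subsets. Summing a
  product over all tuples gives the product of 20 inner products; grouping the pairs
  \<open>S\<close>, \<open>S'\<close> by their symmetric difference \<open>U\<close> then gives
  \<open>ker\<close>.\<close>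

lemma ker_embedding:
  assumes "finite A"
  shows "\<exists>(d::nat) V. \<forall>f x g y. (\<Sum>i<d. V f x i * V g y i) = ker A f x g y"
proof -
  define N :: real where "N = 2 ^ card A"
  have N0: "0 < N" unfolding N_def by simp
  define \<Phi> where "\<Phi> = Pi\<^sub>E {..<20 :: nat} (\<lambda>_. Pow A)"
  have fin: "finite \<Phi>" unfolding \<Phi>_def using assms by (intro finite_PiE) auto
  \<comment> \<open>In the inner product, 20 factors \<open>N\<close> come from the unnormalised
    inner products and one from the sum over \<open>S\<close>; hence the exponent 21.\<close>
  define vec where "vec f x \<phi> =
      (\<Sum>S\<in>Pow A. x S * (\<Prod>i<20. f (\<phi> i) * chi S (\<phi> i))) / sqrt (N ^ 21)"
    for f x :: "'a set \<Rightarrow> real" and \<phi> :: "nat \<Rightarrow> 'a set"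
  have inner: "(\<Sum>\<phi>\<in>\<Phi>. vec f x \<phi> * vec g y \<phi>) = ker A f x g y" for f x g y
  proof -
    have corr: "(\<Sum>z\<in>Pow A. (f z * chi S z) * (g z * chi S' z)) = N * corr A f g (sym_diff S S')"
      if "S \<in> Pow A" "S' \<in> Pow A" for S S'
    proof -
      have "finite S" "finite S'" using that assms finite_subset by auto
      then have "chi (sym_diff S S') z = chi S z * chi S' z" for z by (rule chi_sym_diff)
      then show ?thesis unfolding corr_def fourier_def avg_def N_def by (simp add: mult_ac)
    qed
    have "vec f x \<phi> * vec g y \<phi> = (\<Sum>S\<in>Pow A. \<Sum>S'\<in>Pow A. x S * y S' *
        (\<Prod>i<20. (f (\<phi> i) * chi S (\<phi> i)) * (g (\<phi> i) * chi S' (\<phi> i)))) / N ^ 21" for \<phi>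
    proof -
      have "vec f x \<phi> * vec g y \<phi> = ((\<Sum>S\<in>Pow A. x S * (\<Prod>i<20. f (\<phi> i) * chi S (\<phi> i)))
          * (\<Sum>S\<in>Pow A. y S * (\<Prod>i<20. g (\<phi> i) * chi S (\<phi> i)))) / (sqrt (N ^ 21) * sqrt (N ^ 21))"
        unfolding vec_def by simp
      also have "sqrt (N ^ 21) * sqrt (N ^ 21) = N ^ 21" using N0 by simp
      also have "(\<Sum>S\<in>Pow A. x S * (\<Prod>i<20. f (\<phi> i) * chi S (\<phi> i)))
          * (\<Sum>S\<in>Pow A. y S * (\<Prod>i<20. g (\<phi> i) * chi S (\<phi> i)))
        = (\<Sum>S\<in>Pow A. \<Sum>S'\<in>Pow A. x S * y S' *
          (\<Prod>i<20. (f (\<phi> i) * chi S (\<phi> i)) * (g (\<phi> i) * chi S' (\<phi> i))))"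
        unfolding sum_product prod.distrib by (intro sum.cong refl) (simp only: mult_ac)
      finally show ?thesis .
    qed
    then have "(\<Sum>\<phi>\<in>\<Phi>. vec f x \<phi> * vec g y \<phi>)
      = (\<Sum>\<phi>\<in>\<Phi>. \<Sum>S\<in>Pow A. \<Sum>S'\<in>Pow A. x S * y S' *
        (\<Prod>i<20. (f (\<phi> i) * chi S (\<phi> i)) * (g (\<phi> i) * chi S' (\<phi> i)))) / N ^ 21"
      by (simp add: sum_divide_distrib)
    also have "(\<Sum>\<phi>\<in>\<Phi>. \<Sum>S\<in>Pow A. \<Sum>S'\<in>Pow A. x S * y S' *
        (\<Prod>i<20. (f (\<phi> i) * chi S (\<phi> i)) * (g (\<phi> i) * chi S' (\<phi> i))))
      = (\<Sum>S\<in>Pow A. \<Sum>S'\<in>Pow A. x S * y S' *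
        (\<Sum>\<phi>\<in>\<Phi>. \<Prod>i<20. (f (\<phi> i) * chi S (\<phi> i)) * (g (\<phi> i) * chi S' (\<phi> i))))"
    proof -
      have "(\<Sum>\<phi>\<in>\<Phi>. \<Sum>S\<in>Pow A. \<Sum>S'\<in>Pow A. G \<phi> S S') = (\<Sum>S\<in>Pow A. \<Sum>S'\<in>Pow A. \<Sum>\<phi>\<in>\<Phi>. G \<phi> S S')"
        for G :: "(nat \<Rightarrow> 'a set) \<Rightarrow> 'a set \<Rightarrow> 'a set \<Rightarrow> real"
        using sum.swap[of "\<lambda>\<phi> S. \<Sum>S'\<in>Pow A. G \<phi> S S'" "Pow A" \<Phi>]
          sum.swap[of "\<lambda>\<phi> S'. G \<phi> _ S'" "Pow A" \<Phi>] by simp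
      then show ?thesis unfolding sum_distrib_left .
    qed
    also have "\<dots> = (\<Sum>S\<in>Pow A. \<Sum>S'\<in>Pow A. x S * y S' * (N * corr A f g (sym_diff S S')) ^ 20)"
    proof (intro sum.cong refl)
      fix S S' assume S: "S \<in> Pow A" "S' \<in> Pow A"
      have "(\<Sum>\<phi>\<in>\<Phi>. \<Prod>i<20. (f (\<phi> i) * chi S (\<phi> i)) * (g (\<phi> i) * chi S' (\<phi> i)))
          = (\<Prod>i<20::nat. \<Sum>z\<in>Pow A. (f z * chi S z) * (g z * chi S' z))"
        unfolding \<Phi>_def using assms by (subst prod_sum_PiE) auto
      then show "x S * y S' * (\<Sum>\<phi>\<in>\<Phi>. \<Prod>i<20. (f (\<phi> i) * chi S (\<phi> i)) * (g (\<phi> i) * chi S' (\<phi> i)))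
          = x S * y S' * (N * corr A f g (sym_diff S S')) ^ 20"
        by (simp add: corr[OF S])
    qed
    also have "\<dots> = (\<Sum>S\<in>Pow A. \<Sum>U\<in>Pow A. x S * y (sym_diff S U) * (N * corr A f g U) ^ 20)"
    proof (rule sum.cong[OF refl])
      fix S assume "S \<in> Pow A"
      then have S: "S \<subseteq> A" by simp
      have e: "sym_diff S (sym_diff S U) = U" for U by auto
      show "(\<Sum>S'\<in>Pow A. x S * y S' * (N * corr A f g (sym_diff S S')) ^ 20)
          = (\<Sum>U\<in>Pow A. x S * y (sym_diff S U) * (N * corr A f g U) ^ 20)"
        using sum_sym_diff'[OF S, of "\<lambda>S'. x S * y S' * (N * corr A f g (sym_diff S S')) ^ 20"]
        unfolding e by simp
    qed
    also have "\<dots> = (\<Sum>U\<in>Pow A. \<Sum>S\<in>Pow A. x S * y (sym_diff S U) * (N * corr A f g U) ^ 20)"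
      by (rule sum.swap)
    also have "\<dots> = (\<Sum>U\<in>Pow A. (N * corr A f g U) ^ 20 * (N * sigcorr A x y U))"
    proof (rule sum.cong[OF refl])
      fix U
      have "N * sigcorr A x y U = (\<Sum>S\<in>Pow A. x S * y (sym_diff S U))"
        by (simp add: sigcorr_def avg_def N_def)
      then show "(\<Sum>S\<in>Pow A. x S * y (sym_diff S U) * (N * corr A f g U) ^ 20)
          = (N * corr A f g U) ^ 20 * (N * sigcorr A x y U)"
        by (simp add: sum_distrib_right[symmetric])
    qed
    also have "\<dots> / N ^ 21 = ker A f x g y"
      unfolding ker_def sum_divide_distrib
    proof (intro sum.cong refl)
      fix U
      have "(N * corr A f g U) ^ 20 * (N * sigcorr A x y U) = (corr A f g U ^ 20 * sigcorr A x y U) * (N ^ 20 * N)"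
        unfolding power_mult_distrib by (simp only: mult_ac)
      also have "N ^ 20 * N = N ^ 21" using power_add[of N 20 1] by simp
      finally have "(N * corr A f g U) ^ 20 * (N * sigcorr A x y U) = (corr A f g U ^ 20 * sigcorr A x y U) * N ^ 21" .
      then show "(N * corr A f g U) ^ 20 * (N * sigcorr A x y U) / N ^ 21 = corr A f g U ^ 20 * sigcorr A x y U"
        using N0 by (simp only: nonzero_mult_div_cancel_right[OF power_not_zero] less_irrefl not_False_eq_True)
    qed
    finally show ?thesis .
  qed
  obtain b where b: "bij_betw b {0..<card \<Phi>} \<Phi>" using ex_bij_betw_nat_finite[OF fin] by blast
  have "(\<Sum>i<card \<Phi>. vec f x (b i) * vec g y (b i)) = ker A f x g y" for f x g y
    using sum.reindex_bij_betw[OF b, of "\<lambda>\<phi>. vec f x \<phi> * vec g y \<phi>"] inner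
    by (simp add: atLeast0LessThan)
  then show ?thesis
    by (intro exI[of _ "card \<Phi>"] exI[of _ "\<lambda>f x i. vec f x (b i)"]) simp
qed

section \<open>Special values of the inner product\<close>

lemma ker_cong:
  assumes "\<And>S. S \<subseteq> A \<Longrightarrow> f S = f' S" "\<And>S. S \<subseteq> A \<Longrightarrow> x S = x' S"
  shows "ker A f x g y = ker A f' x' g y"
  unfolding ker_def corr_def fourier_def sigcorr_def
  by (intro sum.cong refl arg_cong2[of _ _ _ _ "(*)"] arg_cong[of _ _ "\<lambda>x. x ^ 20"] avg_cong) (simp_all add: assms)

lemma sigcorr_self_empty: "finite A \<Longrightarrow> sgn_fun A x \<Longrightarrow> sigcorr A x x {} = 1"
proof -
  assume "finite A" "sgn_fun A x"
  then have "sigcorr A x x {} = avg A (\<lambda>S. 1)"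
    unfolding sigcorr_def using sgn_funD[of A x] by (intro avg_cong) force
  then show ?thesis by (simp add: avg_const \<open>finite A\<close>)
qed

lemma ker_same_left:
  assumes "finite A" "sgn_fun A f"
  shows "ker A f x f y = sigcorr A x y {}"
proof -
  have "corr A f f U = of_bool (U = {})" if "U \<subseteq> A" for U
  proof -
    have "corr A f f U = avg A (chi U)"
      unfolding corr_def fourier_def using sgn_funD[OF assms(2)] by (intro avg_cong) force
    then show ?thesis using avg_chi[OF assms(1) that] by simp
  qed
  then have "ker A f x f y = (\<Sum>U\<in>Pow A. if U = {} then sigcorr A x y U else 0)"
    unfolding ker_def by (intro sum.cong) auto
  also have "\<dots> = sigcorr A x y {}" using assms(1) by (subst sum.delta) auto
  finally show ?thesis .
qed

lemma ker_self: "finite A \<Longrightarrow> sgn_fun A f \<Longrightarrow> sgn_fun A x \<Longrightarrow> ker A f x f x = 1"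
  by (simp add: ker_same_left sigcorr_self_empty)

text \<open>The constant is 20 from Bernoulli on the diagonal plus 2 from Parseval off it.\<close>

lemma ker_same_right_ge:
  assumes "finite A" "sgn_fun A f" "sgn_fun A g" "sgn_fun A x"
    and D: "1 - corr A f g {} \<le> 1"
  shows "1 - 22 * (1 - corr A f g {}) \<le> ker A f x g x"
proof -
  define D where "D = 1 - corr A f g {}"
  have D0: "0 \<le> D" "D \<le> 1" using D abs_corr_le_1[OF assms(1-3), of "{}"] unfolding D_def by auto
  have "1 + real 20 * (- D) \<le> (1 + (- D)) ^ 20" using D0 by (intro Bernoulli_inequality) auto
  then have "1 - 20 * D \<le> corr A f g {} ^ 20" unfolding D_def by simp
  moreover have "ker A f x g x = corr A f g {} ^ 20 + (\<Sum>U\<in>Pow A - {{}}. corr A f g U ^ 20 * sigcorr A x x U)"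
    unfolding ker_def sum_Pow_remove_empty[OF assms(1)] by (simp add: sigcorr_self_empty assms)
  moreover have "- (\<Sum>U\<in>Pow A - {{}}. corr A f g U ^ 20) \<le> (\<Sum>U\<in>Pow A - {{}}. corr A f g U ^ 20 * sigcorr A x x U)"
    unfolding sum_negf[symmetric]
  proof (rule sum_mono)
    fix U assume "U \<in> Pow A - {{}}"
    then have "- 1 \<le> sigcorr A x x U" using abs_sigcorr_le_1[OF assms(1,4,4), of U] by auto
    then have "corr A f g U ^ 20 * (- 1) \<le> corr A f g U ^ 20 * sigcorr A x x U"
      by (intro mult_left_mono) (auto simp: zero_le_even_power)
    then show "- (corr A f g U ^ 20) \<le> corr A f g U ^ 20 * sigcorr A x x U" by simp
  qed
  moreover have "(\<Sum>U\<in>Pow A - {{}}. corr A f g U ^ 20) \<le> D ^ 18 * (2 * D)"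
    unfolding D_def by (rule sum_corr_power_nonempty[OF assms(1-3)])
  moreover have "D ^ 18 * (2 * D) \<le> 1 * (2 * D)"
    using D0 by (intro mult_right_mono power_le_one) auto
  ultimately show ?thesis unfolding D_def[symmetric] by linarith
qed

text \<open>A subset \<open>Z\<close> of \<open>cube A\<close> encodes the pair of sign functions \<open>(fpart Z, xpart Z)\<close>.\<close>

definition cube :: "'a set \<Rightarrow> ('a set \<times> bool) set" where
  "cube A = Pow A \<times> UNIV"

definition fpart :: "('a set \<times> bool) set \<Rightarrow> 'a set \<Rightarrow> real" where
  "fpart Z z = (if (z, False) \<in> Z then - 1 else 1)"

definition xpart :: "('a set \<times> bool) set \<Rightarrow> 'a set \<Rightarrow> real" where
  "xpart Z S = (if (S, True) \<in> Z then - 1 else 1)"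

text \<open>Equating the two truth values keeps the sign bit where \<open>chi T z = 1\<close> and
  complements it elsewhere, which multiplies \<open>fpart Z\<close> by \<open>chi T\<close>; the
  other bits are translated by \<open>T\<close>.\<close>

definition act :: "'a set \<Rightarrow> 'a set \<Rightarrow> ('a set \<times> bool) set \<Rightarrow> ('a set \<times> bool) set" where
  "act A T Z = {(z, b) \<in> cube A. if b then (sym_diff z T, True) \<in> Z else ((z, False) \<in> Z) = (chi T z = 1)}"

definition kern :: "'a set \<Rightarrow> ('a set \<times> bool) set \<Rightarrow> ('a set \<times> bool) set \<Rightarrow> real" where
  "kern A Z Z' = ker A (fpart Z) (xpart Z) (fpart Z') (xpart Z')"

lemma finite_cube [simp]: "finite A \<Longrightarrow> finite (cube A)"
  by (simp add: cube_def)

lemma card_cube: "finite A \<Longrightarrow> card (cube A) = 2 * 2 ^ card A"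
  by (simp add: cube_def card_cartesian_product card_Pow)

lemma sgn_fun_parts [simp]: "sgn_fun A (fpart Z)" "sgn_fun A (xpart Z)"
  unfolding sgn_fun_def fpart_def xpart_def by auto

lemma kern_commute: "kern A Z Z' = kern A Z' Z"
  unfolding kern_def by (rule ker_commute)

lemma kern_self: "finite A \<Longrightarrow> kern A Z Z = 1"
  unfolding kern_def by (simp add: ker_self)

lemma kern_triangle: "finite A \<Longrightarrow> kern A Z1 Z2 + kern A Z2 Z3 \<le> 1 + kern A Z1 Z3"
  unfolding kern_def by (rule ker_triangle) auto

lemma act_subset: "act A T Z \<subseteq> cube A"
  unfolding act_def cube_def by auto

lemma chi_cases: "chi S T = 1 \<or> chi S T = - 1"
  using sgn_fun_chi[of T S] sgn_funD[of T "chi S" T] by blast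

lemma kern_act:
  assumes "finite A" "T \<subseteq> A"
  shows "kern A (act A T Z) Z' = kern A Z Z'"
proof -
  have f: "fpart (act A T Z) z = fpart Z z * chi T z" if "z \<subseteq> A" for z
    using that chi_cases[of T z] unfolding fpart_def act_def cube_def by auto
  have x: "xpart (act A T Z) S = xpart Z (sym_diff S T)" if "S \<subseteq> A" for S
    using that unfolding xpart_def act_def cube_def by auto
  show ?thesis
    unfolding kern_def ker_shift[OF assms, of "fpart Z", symmetric]
    by (rule ker_cong) (auto simp: f x)
qed

lemma act_act:
  assumes "finite A" "T \<subseteq> A" "Z \<subseteq> cube A"
  shows "act A T (act A T Z) = Z"
proof (rule set_eqI)
  fix p :: "'a set \<times> bool"
  obtain z b where p: "p = (z, b)" by (cases p)
  show "p \<in> act A T (act A T Z) \<longleftrightarrow> p \<in> Z"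
  proof (cases "z \<subseteq> A")
    case True
    then have "sym_diff z T \<subseteq> A" using assms by auto
    then show ?thesis using True chi_cases[of T z] unfolding p act_def cube_def
      by (cases b) auto
  next
    case False
    then show ?thesis using assms(3) unfolding p act_def cube_def by auto
  qed
qed

lemma bij_betw_act:
  "finite A \<Longrightarrow> T \<subseteq> A \<Longrightarrow> bij_betw (act A T) (Pow (cube A)) (Pow (cube A))"
  by (rule bij_betwI[where g = "act A T"]) (simp_all add: act_act act_subset)

lemma act_flip:
  assumes "T \<subseteq> A" "S \<subseteq> A" "Z \<subseteq> cube A"
  shows "act A T (sym_diff Z {(S, True)}) = sym_diff (act A T Z) {(sym_diff S T, True)}"
proof (rule set_eqI)
  fix p :: "'a set \<times> bool"
  obtain z b where p: "p = (z, b)" by (cases p)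
  have e: "sym_diff z T = S \<longleftrightarrow> z = sym_diff S T" by auto
  have sub: "sym_diff S T \<subseteq> A" using assms by auto
  show "p \<in> act A T (sym_diff Z {(S, True)}) \<longleftrightarrow> p \<in> sym_diff (act A T Z) {(sym_diff S T, True)}"
  proof (cases b)
    case True
    then show ?thesis
      using sub unfolding p act_def cube_def by (cases "z = sym_diff S T") (simp_all add: e)
  next
    case False
    then show ?thesis unfolding p act_def cube_def by simp
  qed
qed

text \<open>By \<open>act_flip\<close> the bijection \<open>act A T\<close> carries flips at
  \<open>S\<close> to flips at \<open>sym_diff S T\<close>. Taking \<open>T = S\<close> compares
  every \<open>x\<close>-coordinate with the one at the empty set.\<close>

lemma influence_act:
  assumes "finite A" "T \<subseteq> A" "S \<subseteq> A"
    and inv: "\<And>Z. Z \<subseteq> cube A \<Longrightarrow> F (act A T Z) = F Z"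
  shows "influence (cube A) F (S, True) = influence (cube A) F (sym_diff S T, True)"
proof -
  let ?G = "\<lambda>U Z. ((F Z - F (sym_diff Z {(U, True)})) / 2)\<^sup>2"
  have "(\<Sum>Z\<in>Pow (cube A). ?G S Z) = (\<Sum>Z\<in>Pow (cube A). ?G (sym_diff S T) (act A T Z))"
  proof (rule sum.cong)
    fix Z assume "Z \<in> Pow (cube A)"
    then have Z: "Z \<subseteq> cube A" by simp
    have "sym_diff Z {(S, True)} \<subseteq> cube A" using Z assms(3) unfolding cube_def by auto
    then show "?G S Z = ?G (sym_diff S T) (act A T Z)"
      using inv[OF Z] inv[of "sym_diff Z {(S, True)}"] act_flip[OF assms(2,3) Z] by simp
  qed simp
  also have "\<dots> = (\<Sum>Z\<in>Pow (cube A). ?G (sym_diff S T) Z)"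
    by (rule sum.reindex_bij_betw[OF bij_betw_act[OF assms(1,2)]])
  finally show ?thesis unfolding influence_def avg_def by simp
qed

definition xcoords :: "'a set \<Rightarrow> ('a set \<times> bool) set" where
  "xcoords A = Pow A \<times> {True}"

lemma xcoords_subset: "xcoords A \<subseteq> cube A"
  unfolding xcoords_def cube_def by auto

lemma kern_flip_xcoords:
  assumes "finite A"
  shows "kern A Z (sym_diff Z (xcoords A)) = - 1"
proof -
  have "kern A (sym_diff Z (xcoords A)) Z = ker A (fpart Z) (\<lambda>S. - xpart Z S) (fpart Z) (xpart Z)"
    unfolding kern_def by (rule ker_cong) (auto simp: fpart_def xpart_def xcoords_def)
  also have "\<dots> = - 1" by (simp add: ker_uminus_right ker_self assms)
  finally show ?thesis by (simp add: kern_commute)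
qed

lemma avg_flip_one:
  assumes "finite A" "S \<subseteq> A"
  shows "avg A (\<lambda>z. if z = S then - 1 else 1) = 1 - 2 / 2 ^ card A"
proof -
  have "avg A (\<lambda>z. if z = S then - 1 else 1) = avg A (\<lambda>z. 1 - (if z = S then 2 else 0))"
    by (intro avg_cong) auto
  also have "\<dots> = 1 - avg A (\<lambda>z. if z = S then 2 else 0)"
    unfolding avg_diff using avg_const[OF assms(1)] by simp
  also have "avg A (\<lambda>z. if z = S then 2 else 0) = 2 / 2 ^ card A"
    unfolding avg_def using assms by (subst sum.delta) auto
  finally show ?thesis .
qed

lemma kern_flip_x:
  assumes "finite A" "S \<subseteq> A"
  shows "kern A Z (sym_diff Z {(S, True)}) = 1 - 2 / 2 ^ card A"
proof -
  have "kern A (sym_diff Z {(S, True)}) Z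
      = ker A (fpart Z) (\<lambda>S'. xpart Z S' * (if S' = S then - 1 else 1)) (fpart Z) (xpart Z)"
    unfolding kern_def by (rule ker_cong) (auto simp: fpart_def xpart_def)
  also have "\<dots> = sigcorr A (\<lambda>S'. xpart Z S' * (if S' = S then - 1 else 1)) (xpart Z) {}"
    by (rule ker_same_left[OF assms(1)]) simp
  also have "\<dots> = avg A (\<lambda>z. if z = S then - 1 else 1)"
    unfolding sigcorr_def by (intro avg_cong) (auto simp: xpart_def)
  finally show ?thesis using avg_flip_one[OF assms] by (simp add: kern_commute)
qed

lemma kern_flip_f:
  assumes "finite A" "S \<subseteq> A" "A \<noteq> {}"
  shows "1 - 44 / 2 ^ card A \<le> kern A Z (sym_diff Z {(S, False)})"
proof -
  let ?f = "fpart (sym_diff Z {(S, False)})"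
  have "corr A ?f (fpart Z) {} = avg A (\<lambda>z. if z = S then - 1 else 1)"
    unfolding corr_empty by (intro avg_cong) (auto simp: fpart_def)
  then have corr: "corr A ?f (fpart Z) {} = 1 - 2 / 2 ^ card A"
    using avg_flip_one[OF assms(1,2)] by simp
  have "1 \<le> card A" using assms by (simp add: Suc_le_eq card_gt_0_iff)
  then have "(2::real) ^ 1 \<le> 2 ^ card A" by (intro power_increasing) auto
  then have le: "1 - corr A ?f (fpart Z) {} \<le> 1" unfolding corr by simp
  have "kern A (sym_diff Z {(S, False)}) Z = ker A ?f (xpart Z) (fpart Z) (xpart Z)"
    unfolding kern_def by (rule ker_cong) (auto simp: xpart_def)
  moreover have "1 - 22 * (1 - corr A ?f (fpart Z) {}) \<le> ker A ?f (xpart Z) (fpart Z) (xpart Z)"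
    by (rule ker_same_right_ge[OF assms(1) _ _ _ le]) auto
  ultimately show ?thesis unfolding corr by (simp add: kern_commute)
qed

text \<open>Suppose the total influence \<open>E\<close> were smaller. The \<open>N\<close>
  coordinates in \<open>xcoords A\<close> share at most \<open>E\<close> equally, so each has
  influence at most \<open>E / N\<close>. In \<open>kkl\<close> the first term is then below
  \<open>\<theta> / 2\<close>. The second is \<open>E * sqrt E * 3 ^ d / sqrt N\<close>; the choice
  \<open>card A = 8 * d\<close> makes \<open>sqrt N\<close> equal to \<open>16 ^ d\<close>, which
  beats \<open>3 ^ d\<close> and the factors \<open>d + 1\<close>, so this term is at most
  \<open>\<theta> / 2\<close> as well.\<close>

lemma invariant_cut_bound:
  fixes F :: "('a set \<times> bool) set \<Rightarrow> real"
  assumes "finite A" "card A = 8 * d"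
    and F: "\<And>Z. Z \<subseteq> cube A \<Longrightarrow> F Z \<in> {- 1, 1}"
    and inv: "\<And>T Z. T \<subseteq> A \<Longrightarrow> Z \<subseteq> cube A \<Longrightarrow> F (act A T Z) = F Z"
  defines "\<theta> \<equiv> avg (cube A) (\<lambda>Z. ((F Z - F (sym_diff Z (xcoords A))) / 2)\<^sup>2)"
  shows "real (d + 1) / 2 * \<theta> \<le> (\<Sum>i\<in>cube A. influence (cube A) F i)"
proof (rule ccontr)
  define E where "E = (\<Sum>i\<in>cube A. influence (cube A) F i)"
  define N :: real where "N = 2 ^ card A"
  assume "\<not> ?thesis"
  then have less: "E < real (d + 1) / 2 * \<theta>" unfolding E_def by simp
  have inf0: "0 \<le> influence (cube A) F i" for i unfolding influence_def by (intro avg_nonneg) auto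
  have E0: "0 \<le> E" unfolding E_def by (intro sum_nonneg inf0)
  have \<theta>1: "\<theta> \<le> 1"
  proof -
    have "\<theta> \<le> avg (cube A) (\<lambda>Z. 1)"
      unfolding \<theta>_def
    proof (rule avg_mono)
      fix Z assume Z: "Z \<subseteq> cube A"
      then have "sym_diff Z (xcoords A) \<subseteq> cube A" using xcoords_subset by auto
      from F[OF Z] F[OF this] show "((F Z - F (sym_diff Z (xcoords A))) / 2)\<^sup>2 \<le> 1" by auto
    qed
    then show ?thesis by (simp add: avg_const assms(1))
  qed
  have \<theta>0: "0 < \<theta>"
  proof -
    have "0 < real (d + 1) / 2 * \<theta>" using less E0 by linarith
    then show ?thesis by (simp add: zero_less_mult_iff)
  qed
  have eqinf: "influence (cube A) F (S, True) = influence (cube A) F ({}, True)" if "S \<subseteq> A" for S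
    using influence_act[OF assms(1) that that, of F] inv[OF that] by simp
  have fx: "finite (xcoords A)" "card (xcoords A) = 2 ^ card A"
    using assms(1) by (simp_all add: xcoords_def card_cartesian_product card_Pow)
  have "N * influence (cube A) F ({}, True) = (\<Sum>i\<in>xcoords A. influence (cube A) F i)"
  proof -
    have "(\<Sum>i\<in>xcoords A. influence (cube A) F i) = (\<Sum>i\<in>xcoords A. influence (cube A) F ({}, True))"
    proof (rule sum.cong[OF refl])
      fix i assume "i \<in> xcoords A"
      then obtain S where "i = (S, True)" "S \<subseteq> A" unfolding xcoords_def by auto
      then show "influence (cube A) F i = influence (cube A) F ({}, True)" using eqinf by blast
    qed
    then show ?thesis using fx unfolding N_def by simp
  qed
  also have "\<dots> \<le> E" unfolding E_def
    using assms(1) xcoords_subset inf0 by (intro sum_mono2) auto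
  finally have "influence (cube A) F ({}, True) \<le> E / N"
    unfolding N_def by (simp add: field_simps)
  have tau: "influence (cube A) F i \<le> E / N" if i: "i \<in> xcoords A" for i
  proof -
    obtain S where "i = (S, True)" "S \<subseteq> A" using i unfolding xcoords_def by auto
    then show ?thesis using eqinf \<open>influence (cube A) F ({}, True) \<le> E / N\<close> by metis
  qed
  have "\<theta> \<le> E / real (d + 1) + real (card (xcoords A)) * (3 ^ d * (E / N * sqrt (E / N)))"
    unfolding \<theta>_def E_def
    by (rule kkl[OF _ xcoords_subset F]) (use assms(1) tau E_def in auto)
  also have "real (card (xcoords A)) * (3 ^ d * (E / N * sqrt (E / N))) = E * (3 ^ d / 2 ^ (4 * d)) * sqrt E"
  proof -
    have "sqrt N = 2 ^ (4 * d)"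
    proof (rule real_sqrt_unique)
      show "(2 ^ (4 * d))\<^sup>2 = N" unfolding N_def assms(2) by (simp flip: power_mult)
    qed simp
    then show ?thesis unfolding fx(2) using N_def by (simp add: real_sqrt_divide)
  qed
  also have "\<dots> \<le> (real (d + 1) / 2 * \<theta>) * (1 / 4 ^ d) * real (d + 1)"
  proof (intro mult_mono)
    have "(3::real) ^ d * 4 ^ d \<le> 2 ^ (4 * d)"
      unfolding power_mult power_mult_distrib[symmetric] by (rule power_mono) auto
    then show "(3::real) ^ d / 2 ^ (4 * d) \<le> 1 / 4 ^ d" by (simp add: field_simps)
    have "real (d + 1) / 2 * \<theta> \<le> real (d + 1) / 2 * 1" using \<theta>1 by (intro mult_left_mono) auto
    with less have "E < real (d + 1) / 2 * 1" by (rule order.strict_trans2)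
    then have "E \<le> real (d + 1)" by simp
    also have "\<dots> \<le> real (d + 1) ^ 2" by (simp add: power2_eq_square)
    finally show "sqrt E \<le> real (d + 1)" by (intro real_le_lsqrt) (use E0 in auto)
  qed (use less E0 \<theta>0 in auto)
  also have "\<dots> \<le> \<theta> / 2"
  proof -
    have "d + 1 \<le> 2 ^ d" by (induction d) auto
    then have "real (d + 1) \<le> 2 ^ d" by (metis of_nat_le_iff of_nat_numeral of_nat_power)
    then have "real (d + 1) * real (d + 1) \<le> 2 ^ d * 2 ^ d" by (intro mult_mono) auto
    also have "\<dots> = 4 ^ d" by (simp flip: power_mult_distrib)
    finally have "\<theta> / 2 * (real (d + 1) * real (d + 1) / 4 ^ d) \<le> \<theta> / 2 * 1"
      using \<theta>0 by (intro mult_left_mono) auto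
    then show ?thesis by (simp add: mult_ac)
  qed
  also have "E / real (d + 1) + \<theta> / 2 < \<theta>"
    using less by (simp add: field_simps)
  finally show False by simp
qed

section \<open>Integrality gaps\<close>

lemma sqdist_commute: "sqdist d u w = sqdist d w u"
  unfolding sqdist_def sqnorm_def by (simp add: power2_commute)

lemma sqdist_self [simp]: "sqdist d u u = 0"
  unfolding sqdist_def sqnorm_def by simp

lemma sqdist_nonneg: "0 \<le> sqdist d u w"
  unfolding sqdist_def sqnorm_def by (intro sum_nonneg) auto

lemma sqdist_inner: "sqdist d u w = sqnorm d u + sqnorm d w - 2 * (\<Sum>i<d. u i * w i)"
  unfolding sqdist_def sqnorm_def
  by (simp add: power2_diff sum.distrib sum_subtractf sum_distrib_left mult.assoc)

lemma sum_nsets_2: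
  fixes \<phi> :: "nat \<Rightarrow> nat \<Rightarrow> real"
  assumes "finite V" and sym: "\<And>a b. a \<in> V \<Longrightarrow> b \<in> V \<Longrightarrow> \<phi> a b = \<phi> b a"
    and diag: "\<And>a. a \<in> V \<Longrightarrow> \<phi> a a = 0"
  shows "(\<Sum>e\<in>nsets V 2. \<phi> (Min e) (Max e)) = (\<Sum>a\<in>V. \<Sum>b\<in>V. \<phi> a b) / 2"
proof -
  let ?L = "\<lambda>a b. if a < b then \<phi> a b else 0"
  have "(\<Sum>e\<in>nsets V 2. \<phi> (Min e) (Max e)) = (\<Sum>p\<in>{p \<in> V \<times> V. fst p < snd p}. \<phi> (fst p) (snd p))"
  proof (rule sum.reindex_bij_witness[where i = "\<lambda>p. {fst p, snd p}" and j = "\<lambda>e. (Min e, Max e)"])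
    fix e assume "e \<in> nsets V 2"
    then obtain a b where e: "a < b" "e = {a, b}" "a \<in> V" "b \<in> V"
      unfolding ordered_nsets_2_eq by blast
    then show "{fst (Min e, Max e), snd (Min e, Max e)} = e"
      "(Min e, Max e) \<in> {p \<in> V \<times> V. fst p < snd p}" "\<phi> (fst (Min e, Max e)) (snd (Min e, Max e)) = \<phi> (Min e) (Max e)"
      by auto
  qed auto
  also have "\<dots> = (\<Sum>p\<in>V \<times> V. if fst p < snd p then \<phi> (fst p) (snd p) else 0)"
    using assms(1) by (intro sum.inter_filter) auto
  also have "\<dots> = (\<Sum>a\<in>V. \<Sum>b\<in>V. ?L a b)"
    by (simp add: sum.cartesian_product case_prod_beta)
  finally have L: "(\<Sum>e\<in>nsets V 2. \<phi> (Min e) (Max e)) = (\<Sum>a\<in>V. \<Sum>b\<in>V. ?L a b)" .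
  have "(\<Sum>a\<in>V. \<Sum>b\<in>V. \<phi> a b) = (\<Sum>a\<in>V. \<Sum>b\<in>V. ?L a b + ?L b a)"
  proof (intro sum.cong refl)
    fix a b assume "a \<in> V" "b \<in> V"
    then have \<phi>: "\<phi> b a = \<phi> a b" "a = b \<Longrightarrow> \<phi> a b = 0" using sym diag by blast+
    show "\<phi> a b = ?L a b + ?L b a"
      unfolding \<phi>(1) using \<phi>(2) by (cases a b rule: linorder_cases) simp_all
  qed
  also have "\<dots> = (\<Sum>a\<in>V. \<Sum>b\<in>V. ?L a b) + (\<Sum>b\<in>V. \<Sum>a\<in>V. ?L b a)"
    unfolding sum.distrib by (subst (2) sum.swap) simp
  finally show ?thesis using L by simp
qed

lemma sum_crossing:
  fixes c :: "nat set \<Rightarrow> real"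
  assumes "finite V"
  shows "(\<Sum>e\<in>crossing V S. c e) = (\<Sum>e\<in>nsets V 2. of_bool ((Min e \<in> S) \<noteq> (Max e \<in> S)) * c e)"
proof -
  have iff: "card (e \<inter> S) = 1 \<longleftrightarrow> (Min e \<in> S) \<noteq> (Max e \<in> S)" if e_in: "e \<in> nsets V 2" for e
  proof -
    obtain a b where e: "a < b" "e = {a, b}"
      using e_in unfolding ordered_nsets_2_eq by blast
    then have "Min e = a" "Max e = b" by auto
    moreover have "e \<inter> S = (if a \<in> S then {a} else {}) \<union> (if b \<in> S then {b} else {})"
      using e by auto
    ultimately show ?thesis using e by auto
  qed
  have "finite (nsets V 2)" using assms by (rule finite_imp_finite_nsets)
  then have "(\<Sum>e\<in>crossing V S. c e) = (\<Sum>e\<in>nsets V 2. if card (e \<inter> S) = 1 then c e else 0)"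
    unfolding crossing_def by (rule sum.inter_filter)
  also have "\<dots> = (\<Sum>e\<in>nsets V 2. of_bool ((Min e \<in> S) \<noteq> (Max e \<in> S)) * c e)"
    using iff by (intro sum.cong refl) auto
  finally show ?thesis .
qed

text \<open>Demand 2 over ordered pairs means total demand 1, so \<open>B = 1/2\<close> is
  admissible and a \<open>B/3\<close>-balanced cut crosses demand at least 1/6, whence the factor 6.
  The 8 in \<open>val\<close> is 4 from the relaxation times 2 for ordered pairs. The assumption
  \<open>full\<close> makes the minima range over nonempty sets; \<open>antipodal\<close> makes the
  demand constraints hold with value 1; \<open>lower\<close> bounds the optima below by 1 and 1/2,
  so that the quotients are genuine.\<close>

lemma gap_transfer:
  fixes \<Omega> :: "'b set" and F0 :: "'b \<Rightarrow> bool" and W D :: "'b \<Rightarrow> 'b \<Rightarrow> real" and v :: "'b \<Rightarrow> nat \<Rightarrow> real"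
  assumes fin: "finite \<Omega>"
    and W0: "\<And>p q. 0 \<le> W p q" and D0: "\<And>p q. 0 \<le> D p q"
    and Wsym: "\<And>p q. p \<in> \<Omega> \<Longrightarrow> q \<in> \<Omega> \<Longrightarrow> W p q = W q p"
    and Dsym: "\<And>p q. p \<in> \<Omega> \<Longrightarrow> q \<in> \<Omega> \<Longrightarrow> D p q = D q p"
    and Ddiag: "\<And>p. p \<in> \<Omega> \<Longrightarrow> D p p = 0"
    and total: "(\<Sum>p\<in>\<Omega>. \<Sum>q\<in>\<Omega>. D p q) = 2"
    and cut: "\<And>F :: 'b \<Rightarrow> bool. s * (\<Sum>p\<in>\<Omega>. \<Sum>q\<in>\<Omega>. of_bool (F p \<noteq> F q) * D p q)
        \<le> (\<Sum>p\<in>\<Omega>. \<Sum>q\<in>\<Omega>. of_bool (F p \<noteq> F q) * W p q)"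
    and full: "(\<Sum>p\<in>\<Omega>. \<Sum>q\<in>\<Omega>. of_bool (F0 p \<noteq> F0 q) * D p q) = 2"
    and unit: "\<And>p. p \<in> \<Omega> \<Longrightarrow> sqnorm d (v p) = 1" and tri: "triangle_ineqs \<Omega> d v"
    and antipodal: "\<And>p q. p \<in> \<Omega> \<Longrightarrow> q \<in> \<Omega> \<Longrightarrow> D p q \<noteq> 0 \<Longrightarrow> sqdist d (v p) (v q) = 4"
    and val: "(\<Sum>p\<in>\<Omega>. \<Sum>q\<in>\<Omega>. W p q * sqdist d (v p) (v q)) \<le> 8 * c"
    and lower: "\<And>d u. triangle_ineqs \<Omega> d u \<Longrightarrow> (\<Sum>p\<in>\<Omega>. \<Sum>q\<in>\<Omega>. D p q * sqdist d (u p) (u q))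
        \<le> (\<Sum>p\<in>\<Omega>. \<Sum>q\<in>\<Omega>. W p q * sqdist d (u p) (u q))"
    and s: "0 < s" and c: "0 < c"
  shows "\<exists>(V :: nat set) wt dem. card V = card \<Omega> \<and> sc_instance V wt dem \<and>
    s / c \<le> sc_integrality_gap V wt dem \<and> bes_instance V wt dem (1/2) \<and>
    s / (6 * c) \<le> bes_integrality_gap V wt dem (1/2)"
proof -
  obtain b where b: "bij_betw b {0..<card \<Omega>} \<Omega>" using ex_bij_betw_nat_finite[OF fin] by blast
  define V where "V = {0..<card \<Omega>}"
  have bV: "bij_betw b V \<Omega>" and finV: "finite V" and cardV: "card V = card \<Omega>"
    using b unfolding V_def by auto
  have b_in: "b a \<in> \<Omega>" if "a \<in> V" for a using bV that by (auto simp: bij_betw_def)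
  define ib where "ib = inv_into V b"
  have ib: "ib (b a) = a" if "a \<in> V" for a
    unfolding ib_def using that bV by (simp add: bij_betw_inv_into_left)
  have ib_in: "ib p \<in> V" if "p \<in> \<Omega>" for p
    unfolding ib_def using that bV by (metis bij_betw_imp_surj_on inv_into_into)
  define wt where "wt = (\<lambda>e. W (b (Min e)) (b (Max e)))"
  define dem where "dem = (\<lambda>e. D (b (Min e)) (b (Max e)))"
  have double: "(\<Sum>a\<in>V. \<Sum>a'\<in>V. \<psi> (b a) (b a')) = (\<Sum>p\<in>\<Omega>. \<Sum>q\<in>\<Omega>. \<psi> p q)" for \<psi> :: "'b \<Rightarrow> 'b \<Rightarrow> real"
    by (simp add: sum.reindex_bij_betw[OF bV] sum.reindex_bij_betw[OF bV, of "\<lambda>p. \<Sum>q\<in>\<Omega>. \<psi> p q"])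
  have edges: "(\<Sum>e\<in>nsets V 2. \<psi> (b (Min e)) (b (Max e))) = (\<Sum>p\<in>\<Omega>. \<Sum>q\<in>\<Omega>. \<psi> p q) / 2"
    if "\<And>p q. p \<in> \<Omega> \<Longrightarrow> q \<in> \<Omega> \<Longrightarrow> \<psi> p q = \<psi> q p" "\<And>p. p \<in> \<Omega> \<Longrightarrow> \<psi> p p = 0"
    for \<psi> :: "'b \<Rightarrow> 'b \<Rightarrow> real"
    unfolding double[symmetric] using that b_in
    by (intro sum_nsets_2[OF finV, of "\<lambda>a a'. \<psi> (b a) (b a')"]) auto
  have minmax: "Min e \<in> V" "Max e \<in> V" if "e \<in> nsets V 2" for e
  proof -
    have "finite e" "e \<noteq> {}" "e \<subseteq> V" using that by (auto simp: nsets_def)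
    then show "Min e \<in> V" "Max e \<in> V" using Min_in Max_in by blast+
  qed
  have tot: "total_demand V dem = 1"
    unfolding total_demand_def dem_def using edges[of D] Dsym Ddiag total by simp
  have inst: "sc_instance V wt dem"
    unfolding sc_instance_def using finV W0 D0 tot by (simp add: wt_def dem_def)
  then have binst: "bes_instance V wt dem (1/2)"
    unfolding bes_instance_def tot by simp
  have cross: "(\<Sum>e\<in>crossing V S. X (b (Min e)) (b (Max e)))
      = (\<Sum>p\<in>\<Omega>. \<Sum>q\<in>\<Omega>. of_bool ((ib p \<in> S) \<noteq> (ib q \<in> S)) * X p q) / 2"
    if "\<And>p q. p \<in> \<Omega> \<Longrightarrow> q \<in> \<Omega> \<Longrightarrow> X p q = X q p" for S and X :: "'b \<Rightarrow> 'b \<Rightarrow> real"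
  proof -
    have "(\<Sum>e\<in>crossing V S. X (b (Min e)) (b (Max e)))
        = (\<Sum>e\<in>nsets V 2. of_bool ((ib (b (Min e)) \<in> S) \<noteq> (ib (b (Max e)) \<in> S)) * X (b (Min e)) (b (Max e)))"
      unfolding sum_crossing[OF finV] using minmax by (intro sum.cong refl) (simp add: ib)
    also have "\<dots> = (\<Sum>p\<in>\<Omega>. \<Sum>q\<in>\<Omega>. of_bool ((ib p \<in> S) \<noteq> (ib q \<in> S)) * X p q) / 2"
      by (rule edges) (use that in auto)
    finally show ?thesis .
  qed
  have cutS: "s * (\<Sum>e\<in>crossing V S. dem e) \<le> (\<Sum>e\<in>crossing V S. wt e)" for S
  proof -
    let ?A = "\<lambda>X. \<Sum>p\<in>\<Omega>. \<Sum>q\<in>\<Omega>. of_bool ((ib p \<in> S) \<noteq> (ib q \<in> S)) * X p q :: real"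
    have 1: "(\<Sum>e\<in>crossing V S. dem e) = ?A D / 2"
      unfolding dem_def by (rule cross) (rule Dsym)
    have 2: "(\<Sum>e\<in>crossing V S. wt e) = ?A W / 2"
      unfolding wt_def by (rule cross) (rule Wsym)
    have "s * ?A D / 2 \<le> ?A W / 2" by (rule divide_right_mono[OF cut]) simp
    then show ?thesis unfolding 1 2 by simp
  qed
  have sdp: "sdp_sum V (\<lambda>e. X (b (Min e)) (b (Max e))) d' u
      = (\<Sum>p\<in>\<Omega>. \<Sum>q\<in>\<Omega>. X p q * sqdist d' (u (ib p)) (u (ib q))) / 8"
    if "\<And>p q. p \<in> \<Omega> \<Longrightarrow> q \<in> \<Omega> \<Longrightarrow> X p q = X q p" for d' u and X :: "'b \<Rightarrow> 'b \<Rightarrow> real"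
  proof -
    have "(\<Sum>e\<in>nsets V 2. X (b (Min e)) (b (Max e)) * sqdist d' (u (Min e)) (u (Max e)))
        = (\<Sum>e\<in>nsets V 2. X (b (Min e)) (b (Max e)) * sqdist d' (u (ib (b (Min e)))) (u (ib (b (Max e)))))"
      using minmax by (intro sum.cong refl) (simp add: ib)
    also have "\<dots> = (\<Sum>p\<in>\<Omega>. \<Sum>q\<in>\<Omega>. X p q * sqdist d' (u (ib p)) (u (ib q))) / 2"
      using that by (intro edges) (auto simp: sqdist_commute)
    finally show ?thesis unfolding sdp_sum_def by simp
  qed
  have sdp_le: "sdp_sum V dem d' u \<le> sdp_sum V wt d' u" if "triangle_ineqs V d' u" for d' u
  proof -
    have "triangle_ineqs \<Omega> d' (\<lambda>p. u (ib p))"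
      using that ib_in unfolding triangle_ineqs_def by blast
    from lower[OF this] show ?thesis
      unfolding dem_def wt_def using sdp[of D d' u] sdp[of W d' u] Dsym Wsym by simp
  qed
  define u where "u = (\<lambda>a. v (b a))"
  have b_ib: "b (ib p) = p" if "p \<in> \<Omega>" for p
    unfolding ib_def using that bV by (simp add: bij_betw_inv_into_right)
  have utri: "triangle_ineqs V d u" using tri b_in unfolding u_def triangle_ineqs_def by blast
  have udem: "sdp_sum V dem d u = 1"
  proof -
    have "sdp_sum V dem d u = (\<Sum>p\<in>\<Omega>. \<Sum>q\<in>\<Omega>. D p q * sqdist d (u (ib p)) (u (ib q))) / 8"
      unfolding dem_def using sdp[of D d u] Dsym by simp
    also have "(\<Sum>p\<in>\<Omega>. \<Sum>q\<in>\<Omega>. D p q * sqdist d (u (ib p)) (u (ib q))) = (\<Sum>p\<in>\<Omega>. \<Sum>q\<in>\<Omega>. D p q * 4)"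
    proof (intro sum.cong refl)
      fix p q assume "p \<in> \<Omega>" "q \<in> \<Omega>"
      then show "D p q * sqdist d (u (ib p)) (u (ib q)) = D p q * 4"
        using antipodal[of p q] by (cases "D p q = 0") (simp_all add: u_def b_ib)
    qed
    also have "\<dots> = 8" using total by (simp flip: sum_distrib_right)
    finally show ?thesis by simp
  qed
  have uwt: "sdp_sum V wt d u \<le> c"
  proof -
    have "sdp_sum V wt d u = (\<Sum>p\<in>\<Omega>. \<Sum>q\<in>\<Omega>. W p q * sqdist d (u (ib p)) (u (ib q))) / 8"
      unfolding wt_def using sdp[of W d u] Wsym by simp
    also have "\<dots> = (\<Sum>p\<in>\<Omega>. \<Sum>q\<in>\<Omega>. W p q * sqdist d (v p) (v q)) / 8"
      by (simp add: u_def b_ib)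
    finally show ?thesis using val by simp
  qed
  have opt: "l \<le> Inf X \<and> Inf X \<le> c" if "sdp_sum V wt d u \<in> X" "\<And>t. t \<in> X \<Longrightarrow> l \<le> t" for l X
  proof
    show "l \<le> Inf X" using that by (intro cInf_greatest) auto
    have "Inf X \<le> sdp_sum V wt d u" using that by (intro cInf_lower bdd_belowI) auto
    then show "Inf X \<le> c" using uwt by linarith
  qed
  have sc_opt: "1 \<le> sc_sdp_opt V wt dem \<and> sc_sdp_opt V wt dem \<le> c"
    unfolding sc_sdp_opt_def
  proof (rule opt)
    show "sdp_sum V wt d u \<in> {sdp_sum V wt d v |d v. sc_feasible V dem d v}"
      using utri udem unfolding sc_feasible_def by blast
    fix t assume "t \<in> {sdp_sum V wt d v |d v. sc_feasible V dem d v}"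
    then show "1 \<le> t" using sdp_le unfolding sc_feasible_def by force
  qed
  have bes_opt: "1/2 \<le> bes_sdp_opt V wt dem (1/2) \<and> bes_sdp_opt V wt dem (1/2) \<le> c"
    unfolding bes_sdp_opt_def
  proof (rule opt)
    have "bes_feasible V dem (1/2) d u"
      unfolding bes_feasible_def using utri udem unit b_in by (simp add: u_def)
    then show "sdp_sum V wt d u \<in> {sdp_sum V wt d v |d v. bes_feasible V dem (1/2) d v}" by blast
    fix t assume "t \<in> {sdp_sum V wt d v |d v. bes_feasible V dem (1/2) d v}"
    then show "1/2 \<le> t" using sdp_le unfolding bes_feasible_def by force
  qed
  define S0 where "S0 = {a \<in> V. F0 (b a)}"
  have S0dem: "(\<Sum>e\<in>crossing V S0. dem e) = 1"
  proof -
    have "(\<Sum>e\<in>crossing V S0. dem e) = (\<Sum>p\<in>\<Omega>. \<Sum>q\<in>\<Omega>. of_bool ((ib p \<in> S0) \<noteq> (ib q \<in> S0)) * D p q) / 2"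
      unfolding dem_def using cross[of D S0] Dsym by simp
    also have "(\<Sum>p\<in>\<Omega>. \<Sum>q\<in>\<Omega>. of_bool ((ib p \<in> S0) \<noteq> (ib q \<in> S0)) * D p q)
        = (\<Sum>p\<in>\<Omega>. \<Sum>q\<in>\<Omega>. of_bool (F0 p \<noteq> F0 q) * D p q)"
      by (intro sum.cong refl) (simp add: S0_def ib_in b_ib)
    finally show ?thesis using full by simp
  qed
  \<comment> \<open>The trivial cuts cross nothing, whereas \<open>S0\<close> crosses all the
    demand, so it is a nontrivial cut.\<close>
  have "crossing V {} = {}" "crossing V V = {}"
    unfolding crossing_def nsets_def by (auto simp: Int_absorb2)
  then have "S0 \<noteq> {}" "S0 \<noteq> V" using S0dem by (metis sum.empty zero_neq_one)+
  then have S0: "S0 \<in> nontrivial_cuts V"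
    unfolding nontrivial_cuts_def by (auto simp: S0_def)
  have fin_cuts: "finite (nontrivial_cuts V)" unfolding nontrivial_cuts_def using finV by auto
  have sp: "s \<le> min_sparsity V wt dem"
    unfolding min_sparsity_def
  proof (rule Min.boundedI)
    show "finite (sparsity V wt dem ` {S \<in> nontrivial_cuts V. 0 < (\<Sum>e\<in>crossing V S. dem e)})"
      using fin_cuts by auto
    show "sparsity V wt dem ` {S \<in> nontrivial_cuts V. 0 < (\<Sum>e\<in>crossing V S. dem e)} \<noteq> {}"
      using S0 S0dem by auto
    fix t assume "t \<in> sparsity V wt dem ` {S \<in> nontrivial_cuts V. 0 < (\<Sum>e\<in>crossing V S. dem e)}"
    then obtain S where S: "0 < (\<Sum>e\<in>crossing V S. dem e)" "t = sparsity V wt dem S" by auto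
    then show "s \<le> t" unfolding S(2) sparsity_def using cutS[of S] by (simp add: le_divide_eq)
  qed
  have bal: "s / 6 \<le> min_balanced_cut V wt dem (1/2/3)"
    unfolding min_balanced_cut_def
  proof (rule Min.boundedI)
    show "finite ((\<lambda>S. \<Sum>e\<in>crossing V S. wt e) ` balanced_cuts V dem (1/2/3))"
      unfolding balanced_cuts_def using fin_cuts by auto
    show "(\<lambda>S. \<Sum>e\<in>crossing V S. wt e) ` balanced_cuts V dem (1/2/3) \<noteq> {}"
      unfolding balanced_cuts_def using S0 S0dem by auto
    fix t assume "t \<in> (\<lambda>S. \<Sum>e\<in>crossing V S. wt e) ` balanced_cuts V dem (1/2/3)"
    then obtain S where S: "1/6 \<le> (\<Sum>e\<in>crossing V S. dem e)" "t = (\<Sum>e\<in>crossing V S. wt e)"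
      unfolding balanced_cuts_def by auto
    have "s * (1/6) \<le> s * (\<Sum>e\<in>crossing V S. dem e)" using S(1) s by (intro mult_left_mono) auto
    then show "s / 6 \<le> t" using cutS[of S] S(2) by simp
  qed
  have "s / c \<le> sc_integrality_gap V wt dem"
    unfolding sc_integrality_gap_def using sp sc_opt s by (intro frac_le) auto
  moreover have "s / 6 / c \<le> bes_integrality_gap V wt dem (1/2)"
    unfolding bes_integrality_gap_def using bal bes_opt s by (intro frac_le) auto
  ultimately show ?thesis using cardV inst binst by (intro exI[of _ V] exI[of _ wt] exI[of _ dem]) simp
qed

section \<open>The gap instance on the cube\<close>

text \<open>The cube edges are normalised to give twice an average over the vertices; the orbit
  edges are not, so that splitting a single orbit pair already costs \<open>M\<close>.\<close>

definition cube_wt :: "'a set \<Rightarrow> real \<Rightarrow> ('a set \<times> bool) set \<Rightarrow> ('a set \<times> bool) set \<Rightarrow> real" where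
  "cube_wt A M Z Z' = 2 / 2 ^ card (cube A) * (\<Sum>j\<in>cube A. of_bool (Z' = sym_diff Z {j}))
     + M * (\<Sum>T\<in>Pow A. of_bool (Z' = act A T Z))"

definition cube_dem :: "'a set \<Rightarrow> ('a set \<times> bool) set \<Rightarrow> ('a set \<times> bool) set \<Rightarrow> real" where
  "cube_dem A Z Z' = 2 / 2 ^ card (cube A) * of_bool (Z' = sym_diff Z (xcoords A))"

lemma sum_of_bool_eq:
  fixes \<phi> :: "'b \<Rightarrow> real"
  assumes "finite \<Omega>" "g \<in> \<Omega>"
  shows "(\<Sum>q\<in>\<Omega>. \<phi> q * of_bool (q = g)) = \<phi> g"
proof -
  have "(\<Sum>q\<in>\<Omega>. \<phi> q * of_bool (q = g)) = (\<Sum>q\<in>\<Omega>. if q = g then \<phi> q else 0)"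
    by (intro sum.cong) auto
  then show ?thesis using assms by simp
qed

text \<open>Stated for arbitrary \<phi> since it is evaluated both at cut indicators and at squared
  distances.\<close>

lemma sum_cube_wt:
  fixes \<phi> :: "('a set \<times> bool) set \<Rightarrow> ('a set \<times> bool) set \<Rightarrow> real"
  assumes "finite A"
  shows "(\<Sum>Z\<in>Pow (cube A). \<Sum>Z'\<in>Pow (cube A). \<phi> Z Z' * cube_wt A M Z Z')
    = 2 * (\<Sum>j\<in>cube A. avg (cube A) (\<lambda>Z. \<phi> Z (sym_diff Z {j})))
      + M * (\<Sum>Z\<in>Pow (cube A). \<Sum>T\<in>Pow A. \<phi> Z (act A T Z))"
proof -
  let ?\<Omega> = "Pow (cube A)" and ?n = "2 ^ card (cube A) :: real"
  have fin: "finite ?\<Omega>" using assms by simp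
  have one: "(\<Sum>Z'\<in>?\<Omega>. \<phi> Z Z' * cube_wt A M Z Z')
      = 2 / ?n * (\<Sum>j\<in>cube A. \<phi> Z (sym_diff Z {j})) + M * (\<Sum>T\<in>Pow A. \<phi> Z (act A T Z))"
    if "Z \<in> ?\<Omega>" for Z
  proof -
    have "(\<Sum>Z'\<in>?\<Omega>. \<phi> Z Z' * cube_wt A M Z Z')
        = 2 / ?n * (\<Sum>Z'\<in>?\<Omega>. \<Sum>j\<in>cube A. \<phi> Z Z' * of_bool (Z' = sym_diff Z {j}))
          + M * (\<Sum>Z'\<in>?\<Omega>. \<Sum>T\<in>Pow A. \<phi> Z Z' * of_bool (Z' = act A T Z))"
      unfolding cube_wt_def distrib_left sum.distrib sum_distrib_left
      by (intro arg_cong2[of _ _ _ _ "(+)"] sum.cong refl) (simp_all only: mult_ac)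
    also have "(\<Sum>Z'\<in>?\<Omega>. \<Sum>j\<in>cube A. \<phi> Z Z' * of_bool (Z' = sym_diff Z {j}))
        = (\<Sum>j\<in>cube A. \<Sum>Z'\<in>?\<Omega>. \<phi> Z Z' * of_bool (Z' = sym_diff Z {j}))" by (rule sum.swap)
    also have "\<dots> = (\<Sum>j\<in>cube A. \<phi> Z (sym_diff Z {j}))"
      using that by (intro sum.cong refl sum_of_bool_eq[OF fin]) auto
    also have "(\<Sum>Z'\<in>?\<Omega>. \<Sum>T\<in>Pow A. \<phi> Z Z' * of_bool (Z' = act A T Z))
        = (\<Sum>T\<in>Pow A. \<Sum>Z'\<in>?\<Omega>. \<phi> Z Z' * of_bool (Z' = act A T Z))" by (rule sum.swap)
    also have "\<dots> = (\<Sum>T\<in>Pow A. \<phi> Z (act A T Z))"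
      using act_subset by (intro sum.cong refl sum_of_bool_eq[OF fin]) simp
    finally show ?thesis .
  qed
  have "(\<Sum>Z\<in>?\<Omega>. \<Sum>Z'\<in>?\<Omega>. \<phi> Z Z' * cube_wt A M Z Z')
      = (\<Sum>Z\<in>?\<Omega>. 2 / ?n * (\<Sum>j\<in>cube A. \<phi> Z (sym_diff Z {j})) + M * (\<Sum>T\<in>Pow A. \<phi> Z (act A T Z)))"
    by (rule sum.cong[OF refl one])
  also have "\<dots> = 2 / ?n * (\<Sum>Z\<in>?\<Omega>. \<Sum>j\<in>cube A. \<phi> Z (sym_diff Z {j}))
      + M * (\<Sum>Z\<in>?\<Omega>. \<Sum>T\<in>Pow A. \<phi> Z (act A T Z))"
    by (simp only: sum.distrib sum_distrib_left)
  also have "(\<Sum>Z\<in>?\<Omega>. \<Sum>j\<in>cube A. \<phi> Z (sym_diff Z {j})) = (\<Sum>j\<in>cube A. \<Sum>Z\<in>?\<Omega>. \<phi> Z (sym_diff Z {j}))"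
    by (rule sum.swap)
  also have "2 / ?n * \<dots> = 2 * (\<Sum>j\<in>cube A. avg (cube A) (\<lambda>Z. \<phi> Z (sym_diff Z {j})))"
    unfolding avg_def sum_divide_distrib[symmetric] by simp
  finally show ?thesis .
qed

lemma sum_cube_dem:
  fixes \<phi> :: "('a set \<times> bool) set \<Rightarrow> ('a set \<times> bool) set \<Rightarrow> real"
  assumes "finite A"
  shows "(\<Sum>Z\<in>Pow (cube A). \<Sum>Z'\<in>Pow (cube A). \<phi> Z Z' * cube_dem A Z Z')
    = 2 * avg (cube A) (\<lambda>Z. \<phi> Z (sym_diff Z (xcoords A)))"
proof -
  let ?\<Omega> = "Pow (cube A)" and ?n = "2 ^ card (cube A) :: real"
  have fin: "finite ?\<Omega>" using assms by simp
  have "(\<Sum>Z\<in>?\<Omega>. \<Sum>Z'\<in>?\<Omega>. \<phi> Z Z' * cube_dem A Z Z')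
      = (\<Sum>Z\<in>?\<Omega>. 2 / ?n * (\<Sum>Z'\<in>?\<Omega>. \<phi> Z Z' * of_bool (Z' = sym_diff Z (xcoords A))))"
    unfolding cube_dem_def sum_distrib_left by (intro sum.cong refl) (simp only: mult_ac)
  also have "\<dots> = (\<Sum>Z\<in>?\<Omega>. 2 / ?n * \<phi> Z (sym_diff Z (xcoords A)))"
  proof (intro sum.cong refl arg_cong[of _ _ "(*) (2 / ?n)"])
    fix Z assume "Z \<in> ?\<Omega>"
    then have "sym_diff Z (xcoords A) \<in> ?\<Omega>" using xcoords_subset[of A] by auto
    then show "(\<Sum>Z'\<in>?\<Omega>. \<phi> Z Z' * of_bool (Z' = sym_diff Z (xcoords A))) = \<phi> Z (sym_diff Z (xcoords A))"
      by (rule sum_of_bool_eq[OF fin])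
  qed
  also have "\<dots> = 2 * avg (cube A) (\<lambda>Z. \<phi> Z (sym_diff Z (xcoords A)))"
    unfolding avg_def sum_distrib_left[symmetric] by simp
  finally show ?thesis .
qed

text \<open>A cut constant on orbits falls under \<open>invariant_cut_bound\<close>. Any other cut
  splits some orbit and pays at least \<open>d + 1\<close>, while the left-hand side is
  \<open>(d + 1) * \<theta>\<close> with \<open>\<theta> \<le> 1\<close>; this is why the orbit
  weight is \<open>d + 1\<close>.\<close>

lemma cube_cut_bound:
  fixes F :: "('a set \<times> bool) set \<Rightarrow> bool"
  assumes "finite A" "card A = 8 * d"
  defines "\<Omega> \<equiv> Pow (cube A)"
  shows "real (d + 1) / 2 * (\<Sum>Z\<in>\<Omega>. \<Sum>Z'\<in>\<Omega>. of_bool (F Z \<noteq> F Z') * cube_dem A Z Z')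
    \<le> (\<Sum>Z\<in>\<Omega>. \<Sum>Z'\<in>\<Omega>. of_bool (F Z \<noteq> F Z') * cube_wt A (real (d + 1)) Z Z')"
proof -
  let ?J = "cube A"
  define f where "f Z = (if F Z then 1 else - 1 :: real)" for Z
  have fsq: "((f Z - f Z') / 2)\<^sup>2 = of_bool (F Z \<noteq> F Z')" for Z Z'
    unfolding f_def by auto
  define \<theta> where "\<theta> = avg ?J (\<lambda>Z. of_bool (F Z \<noteq> F (sym_diff Z (xcoords A))))"
  define B where "B = (\<Sum>Z\<in>\<Omega>. \<Sum>T\<in>Pow A. of_bool (F Z \<noteq> F (act A T Z)) :: real)"
  have dem: "(\<Sum>Z\<in>\<Omega>. \<Sum>Z'\<in>\<Omega>. of_bool (F Z \<noteq> F Z') * cube_dem A Z Z') = 2 * \<theta>"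
    unfolding \<Omega>_def \<theta>_def by (rule sum_cube_dem[OF assms(1)])
  have influence: "influence ?J f j = avg ?J (\<lambda>Z. of_bool (F Z \<noteq> F (sym_diff Z {j})))" for j
    unfolding influence_def fsq ..
  have wt: "(\<Sum>Z\<in>\<Omega>. \<Sum>Z'\<in>\<Omega>. of_bool (F Z \<noteq> F Z') * cube_wt A (real (d + 1)) Z Z')
      = 2 * (\<Sum>j\<in>?J. influence ?J f j) + real (d + 1) * B"
    unfolding \<Omega>_def B_def influence by (rule sum_cube_wt[OF assms(1)])
  have B0: "0 \<le> B" unfolding B_def by (intro sum_nonneg) auto
  have I0: "0 \<le> (\<Sum>j\<in>?J. influence ?J f j)" unfolding influence_def by (intro sum_nonneg avg_nonneg) auto
  show ?thesis
  proof (cases "\<forall>T Z. T \<subseteq> A \<longrightarrow> Z \<subseteq> ?J \<longrightarrow> F (act A T Z) = F Z")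
    case True
    have "real (d + 1) / 2 * avg ?J (\<lambda>Z. ((f Z - f (sym_diff Z (xcoords A))) / 2)\<^sup>2) \<le> (\<Sum>j\<in>?J. influence ?J f j)"
      by (rule invariant_cut_bound[OF assms(1,2)]) (use True in \<open>auto simp: f_def\<close>)
    then have "real (d + 1) / 2 * \<theta> \<le> (\<Sum>j\<in>?J. influence ?J f j)" unfolding fsq \<theta>_def .
    moreover have "0 \<le> real (d + 1) * B" using B0 by simp
    ultimately show ?thesis unfolding dem wt by simp
  next
    case False
    then obtain T Z where TZ: "T \<in> Pow A" "Z \<in> \<Omega>" "F Z \<noteq> F (act A T Z)" unfolding \<Omega>_def by auto
    have fin: "finite \<Omega>" unfolding \<Omega>_def using assms by simp
    have "1 = (of_bool (F Z \<noteq> F (act A T Z)) :: real)" using TZ by simp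
    also have "\<dots> \<le> (\<Sum>T\<in>Pow A. of_bool (F Z \<noteq> F (act A T Z)))"
      using assms(1) TZ(1) by (intro member_le_sum) auto
    also have "\<dots> \<le> B" unfolding B_def
      using fin TZ(2) by (intro member_le_sum) (auto intro: sum_nonneg)
    finally have "real (d + 1) * 1 \<le> real (d + 1) * B" by (intro mult_left_mono) auto
    moreover have "\<theta> \<le> 1"
    proof -
      have "\<theta> \<le> avg ?J (\<lambda>Z. 1)" unfolding \<theta>_def by (intro avg_mono) auto
      then show ?thesis by (simp add: avg_const assms(1))
    qed
    then have "real (d + 1) * \<theta> \<le> real (d + 1) * 1" by (intro mult_left_mono) auto
    ultimately have "real (d + 1) * \<theta> \<le> real (d + 1) * B" by linarith
    moreover have "real (d + 1) / 2 * (2 * \<theta>) = real (d + 1) * \<theta>" by simp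
    ultimately show ?thesis unfolding dem wt using I0 by linarith
  qed
qed

text \<open>The coordinates of \<open>Y\<close> are flipped one at a time. After averaging over
  \<open>Z\<close> the cost of a step no longer depends on the flips made before it.\<close>

lemma cube_path:
  assumes "finite A" "Y \<subseteq> cube A" and tri: "triangle_ineqs (Pow (cube A)) d u"
  shows "avg (cube A) (\<lambda>Z. sqdist d (u Z) (u (sym_diff Z Y)))
    \<le> (\<Sum>j\<in>Y. avg (cube A) (\<lambda>Z. sqdist d (u Z) (u (sym_diff Z {j}))))"
proof -
  have "finite Y" using assms finite_subset finite_cube by blast
  then show ?thesis using assms(2)
  proof (induction Y)
    case empty
    then show ?case by (simp add: avg_def)
  next
    case (insert j Y)
    have e: "sym_diff Z (insert j Y) = sym_diff (sym_diff Z Y) {j}" for Z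
      using insert.hyps by auto
    have "avg (cube A) (\<lambda>Z. sqdist d (u Z) (u (sym_diff Z (insert j Y))))
        \<le> avg (cube A) (\<lambda>Z. sqdist d (u Z) (u (sym_diff Z Y))
          + sqdist d (u (sym_diff Z Y)) (u (sym_diff (sym_diff Z Y) {j})))"
    proof (rule avg_mono)
      fix Z assume "Z \<subseteq> cube A"
      then have "Z \<in> Pow (cube A)" "sym_diff Z Y \<in> Pow (cube A)" "sym_diff Z (insert j Y) \<in> Pow (cube A)"
        using insert.prems by auto
      then show "sqdist d (u Z) (u (sym_diff Z (insert j Y)))
          \<le> sqdist d (u Z) (u (sym_diff Z Y)) + sqdist d (u (sym_diff Z Y)) (u (sym_diff (sym_diff Z Y) {j}))"
        using tri unfolding triangle_ineqs_def e[symmetric] by blast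
    qed
    also have "\<dots> = avg (cube A) (\<lambda>Z. sqdist d (u Z) (u (sym_diff Z Y)))
        + avg (cube A) (\<lambda>Z. sqdist d (u Z) (u (sym_diff Z {j})))"
      unfolding avg_add using avg_sym_diff[of Y "cube A" "\<lambda>Z. sqdist d (u Z) (u (sym_diff Z {j}))"] insert.prems
      by simp
    also have "\<dots> \<le> (\<Sum>j\<in>insert j Y. avg (cube A) (\<lambda>Z. sqdist d (u Z) (u (sym_diff Z {j}))))"
      using insert by simp
    finally show ?case .
  qed
qed

lemma kern_embedding:
  assumes "finite A"
  obtains d :: nat and v where "\<And>Z. sqnorm d (v Z) = 1" "\<And>Z Z'. sqdist d (v Z) (v Z') = 2 - 2 * kern A Z Z'"
proof -
  obtain d :: nat and V where V: "(\<Sum>i<d. V f x i * V g y i) = ker A f x g y" for f x g y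
    using ker_embedding[OF assms] by blast
  define v where "v Z = V (fpart Z) (xpart Z)" for Z
  have inner: "(\<Sum>i<d. v Z i * v Z' i) = kern A Z Z'" for Z Z'
    unfolding v_def V kern_def ..
  have "sqnorm d (v Z) = 1" for Z
    unfolding sqnorm_def power2_eq_square inner using kern_self[OF assms] .
  moreover from this have "sqdist d (v Z) (v Z') = 2 - 2 * kern A Z Z'" for Z Z'
    unfolding sqdist_inner inner by simp
  ultimately show thesis by (rule that)
qed

lemma kern_flip:
  assumes "finite A" "A \<noteq> {}" "j \<in> cube A"
  shows "2 - 2 * kern A Z (sym_diff Z {j}) \<le> 88 / 2 ^ card A"
proof -
  obtain S b where j: "j = (S, b)" "S \<subseteq> A" using assms(3) unfolding cube_def by auto
  show ?thesis
  proof (cases b)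
    case True
    then show ?thesis using kern_flip_x[OF assms(1) j(2), of Z] unfolding j(1) by (simp add: field_simps)
  next
    case False
    then show ?thesis using kern_flip_f[OF assms(1) j(2) assms(2), of Z] unfolding j(1) by (simp add: field_simps)
  qed
qed

lemma sym_diff_swap: "Z' = sym_diff Z Y \<longleftrightarrow> Z = sym_diff Z' Y"
  by auto

lemma cube_gap:
  assumes "1 \<le> d"
  shows "\<exists>(V :: nat set) wt dem. card V = 2 ^ (2 ^ (8 * d + 1)) \<and> sc_instance V wt dem \<and>
    real (d + 1) / 88 \<le> sc_integrality_gap V wt dem \<and> bes_instance V wt dem (1/2) \<and>
    real (d + 1) / 528 \<le> bes_integrality_gap V wt dem (1/2)"
proof -
  define A where "A = {..<8 * d}"
  have A: "finite A" "card A = 8 * d" "A \<noteq> {}"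
    using assms unfolding A_def by (auto simp: lessThan_empty_iff)
  define \<Omega> where "\<Omega> = Pow (cube A)"
  let ?W = "cube_wt A (real (d + 1))" and ?D = "cube_dem A"
  obtain m :: nat and v where v: "\<And>Z. sqnorm m (v Z) = 1"
    "\<And>Z Z'. sqdist m (v Z) (v Z') = 2 - 2 * kern A Z Z'"
    using kern_embedding[OF A(1)] by blast
  have fin: "finite \<Omega>" unfolding \<Omega>_def using A by simp
  have "\<exists>(V :: nat set) wt dem. card V = card \<Omega> \<and> sc_instance V wt dem \<and>
    real (d + 1) / 2 / 44 \<le> sc_integrality_gap V wt dem \<and> bes_instance V wt dem (1/2) \<and>
    real (d + 1) / 2 / (6 * 44) \<le> bes_integrality_gap V wt dem (1/2)"
  proof (rule gap_transfer[where W = ?W and D = ?D and d = m and v = v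
      and ?F0.0 = "\<lambda>Z. ({}, True) \<in> Z"])
    show "finite \<Omega>" by (rule fin)
    show "0 \<le> ?W p q" for p q
      unfolding cube_wt_def by (intro add_nonneg_nonneg mult_nonneg_nonneg sum_nonneg) auto
    show "0 \<le> ?D p q" for p q unfolding cube_dem_def by simp
    show "?W p q = ?W q p" if "p \<in> \<Omega>" "q \<in> \<Omega>" for p q
    proof -
      have "(q = act A T p) = (p = act A T q)" if "T \<in> Pow A" for T
        using act_act[OF A(1), of T p] act_act[OF A(1), of T q] that \<open>p \<in> \<Omega>\<close> \<open>q \<in> \<Omega>\<close>
        unfolding \<Omega>_def by auto
      then show ?thesis unfolding cube_wt_def using sym_diff_swap[of q p] by simp
    qed
    show "?D p q = ?D q p" for p q unfolding cube_dem_def using sym_diff_swap[of q p] by simp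
    have "({}, True) \<in> xcoords A" unfolding xcoords_def by simp
    then have ne: "(({}, True) \<in> sym_diff Z (xcoords A)) = (({}, True) \<notin> Z)" for Z by auto
    show "?D p p = 0" for p
    proof -
      have "p \<noteq> sym_diff p (xcoords A)" using ne[of p] by metis
      then show ?thesis unfolding cube_dem_def by simp
    qed
    show "(\<Sum>p\<in>\<Omega>. \<Sum>q\<in>\<Omega>. ?D p q) = 2"
      using sum_cube_dem[OF A(1), of "\<lambda>_ _. 1"] A unfolding \<Omega>_def by (simp add: avg_const)
    show "real (d + 1) / 2 * (\<Sum>p\<in>\<Omega>. \<Sum>q\<in>\<Omega>. of_bool (F p \<noteq> F q) * ?D p q)
        \<le> (\<Sum>p\<in>\<Omega>. \<Sum>q\<in>\<Omega>. of_bool (F p \<noteq> F q) * ?W p q)" for F :: "(nat set \<times> bool) set \<Rightarrow> bool"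
      unfolding \<Omega>_def by (rule cube_cut_bound[OF A(1,2)])
    show "(\<Sum>p\<in>\<Omega>. \<Sum>q\<in>\<Omega>. of_bool ((({}, True) \<in> p) \<noteq> (({}, True) \<in> q)) * ?D p q) = 2"
      unfolding \<Omega>_def sum_cube_dem[OF A(1), of "\<lambda>p q. of_bool ((({}, True) \<in> p) \<noteq> (({}, True) \<in> q))"] ne
      by (simp add: avg_const A)
    show "sqnorm m (v p) = 1" for p by (rule v(1))
    show "triangle_ineqs \<Omega> m v"
      unfolding triangle_ineqs_def v(2)
    proof (intro ballI)
      fix x y z
      show "2 - 2 * kern A x z \<le> 2 - 2 * kern A x y + (2 - 2 * kern A y z)"
        using kern_triangle[OF A(1), of x y z] by simp
    qed
    show "sqdist m (v p) (v q) = 4" if "?D p q \<noteq> 0" for p q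
    proof -
      have "q = sym_diff p (xcoords A)" using that unfolding cube_dem_def by (auto split: if_splits)
      then show ?thesis unfolding v(2) using kern_flip_xcoords[OF A(1), of p] by simp
    qed
    \<comment> \<open>There are \<open>2 * 2 ^ card A\<close> directions with mean squared length at
      most \<open>88 / 2 ^ card A\<close>, which sums to 176; doubled, this is 8 * 44. Orbit edges
      have length 0.\<close>
    show "(\<Sum>p\<in>\<Omega>. \<Sum>q\<in>\<Omega>. ?W p q * sqdist m (v p) (v q)) \<le> 8 * 44"
    proof -
      have "(\<Sum>p\<in>\<Omega>. \<Sum>q\<in>\<Omega>. ?W p q * sqdist m (v p) (v q))
          = 2 * (\<Sum>j\<in>cube A. avg (cube A) (\<lambda>Z. sqdist m (v Z) (v (sym_diff Z {j}))))
          + real (d + 1) * (\<Sum>Z\<in>\<Omega>. \<Sum>T\<in>Pow A. sqdist m (v Z) (v (act A T Z)))"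
        using sum_cube_wt[OF A(1), of "\<lambda>p q. sqdist m (v p) (v q)" "real (d + 1)"]
        unfolding \<Omega>_def by (simp only: mult.commute)
      also have "(\<Sum>Z\<in>\<Omega>. \<Sum>T\<in>Pow A. sqdist m (v Z) (v (act A T Z))) = 0"
      proof (intro sum.neutral ballI)
        fix Z T assume "T \<in> Pow A"
        then have "kern A Z (act A T Z) = 1"
          using kern_act[OF A(1), of T Z Z] kern_self[OF A(1)] by (simp add: kern_commute)
        then show "sqdist m (v Z) (v (act A T Z)) = 0" unfolding v(2) by simp
      qed
      also have "(\<Sum>j\<in>cube A. avg (cube A) (\<lambda>Z. sqdist m (v Z) (v (sym_diff Z {j}))))
          \<le> (\<Sum>j\<in>cube A. 88 / 2 ^ card A)"
      proof (rule sum_mono)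
        fix j assume j: "j \<in> cube A"
        have "avg (cube A) (\<lambda>Z. sqdist m (v Z) (v (sym_diff Z {j}))) \<le> avg (cube A) (\<lambda>Z. 88 / 2 ^ card A)"
          unfolding v(2) by (intro avg_mono kern_flip A j)
        then show "avg (cube A) (\<lambda>Z. sqdist m (v Z) (v (sym_diff Z {j}))) \<le> 88 / 2 ^ card A"
          by (simp add: avg_const A)
      qed
      also have "(\<Sum>j\<in>cube A. 88 / 2 ^ card A) = (176 :: real)"
        by (simp add: card_cube[OF A(1)])
      finally show ?thesis by simp
    qed
    \<comment> \<open>A demand pair is joined by a path that flips the \<open>x\<close>-coordinates
      in turn, so cube edges alone already dominate the demand.\<close>
    show "(\<Sum>p\<in>\<Omega>. \<Sum>q\<in>\<Omega>. ?D p q * sqdist d' (u p) (u q)) \<le> (\<Sum>p\<in>\<Omega>. \<Sum>q\<in>\<Omega>. ?W p q * sqdist d' (u p) (u q))"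
      if "triangle_ineqs \<Omega> d' u" for d' u
    proof -
      have e0: "0 \<le> avg (cube A) (\<lambda>Z. sqdist d' (u Z) (u (sym_diff Z {j})))" for j
        by (intro avg_nonneg sqdist_nonneg)
      have "(\<Sum>p\<in>\<Omega>. \<Sum>q\<in>\<Omega>. ?D p q * sqdist d' (u p) (u q))
          = 2 * avg (cube A) (\<lambda>Z. sqdist d' (u Z) (u (sym_diff Z (xcoords A))))"
        using sum_cube_dem[OF A(1), of "\<lambda>p q. sqdist d' (u p) (u q)"] unfolding \<Omega>_def by (simp only: mult.commute)
      also have "\<dots> \<le> 2 * (\<Sum>j\<in>xcoords A. avg (cube A) (\<lambda>Z. sqdist d' (u Z) (u (sym_diff Z {j}))))"
        using cube_path[OF A(1) xcoords_subset] that unfolding \<Omega>_def by simp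
      also have "\<dots> \<le> 2 * (\<Sum>j\<in>cube A. avg (cube A) (\<lambda>Z. sqdist d' (u Z) (u (sym_diff Z {j}))))"
        using A xcoords_subset e0 by (intro mult_left_mono sum_mono2) auto
      also have "\<dots> \<le> 2 * (\<Sum>j\<in>cube A. avg (cube A) (\<lambda>Z. sqdist d' (u Z) (u (sym_diff Z {j}))))
          + real (d + 1) * (\<Sum>Z\<in>\<Omega>. \<Sum>T\<in>Pow A. sqdist d' (u Z) (u (act A T Z)))"
        by (simp add: sum_nonneg sqdist_nonneg)
      also have "\<dots> = (\<Sum>p\<in>\<Omega>. \<Sum>q\<in>\<Omega>. ?W p q * sqdist d' (u p) (u q))"
        using sum_cube_wt[OF A(1), of "\<lambda>p q. sqdist d' (u p) (u q)" "real (d + 1)"]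
        unfolding \<Omega>_def by (simp only: mult.commute)
      finally show ?thesis .
    qed
  qed auto
  moreover have "card \<Omega> = 2 ^ (2 ^ (8 * d + 1))"
    unfolding \<Omega>_def using A by (simp add: card_Pow card_cube)
  ultimately show ?thesis by simp
qed

section \<open>Choice of the dimension\<close>

theorem theorem5p1:
  fixes \<delta> :: real
  assumes "\<delta> > 0"
  shows "\<exists>n0::nat. \<forall>n\<ge>n0.
    (\<exists>(V::nat set) wt dem. sc_instance V wt dem \<and> card V \<le> n \<and>
        sc_integrality_gap V wt dem \<ge> log 2 (log 2 (real n)) powr (1/6 - \<delta>)) \<and>
    (\<exists>(V::nat set) wt dem B. bes_instance V wt dem B \<and> card V \<le> n \<and>
        bes_integrality_gap V wt dem B \<ge> log 2 (log 2 (real n)) powr (1/6 - \<delta>))"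
proof -
  have "\<forall>\<^sub>F n in sequentially. 9 \<le> log 2 (log 2 (real n))" by real_asymp
  \<comment> \<open>Here 4224 = 8 * 528: the gap \<open>(d + 1) / 528\<close> with
    \<open>d + 1 > (L - 1) / 8\<close> is linear in \<open>L\<close>, so it eventually exceeds the
    power 1/6.\<close>
  moreover have "\<forall>\<^sub>F n in sequentially.
      log 2 (log 2 (real n)) powr (1/6) \<le> (log 2 (log 2 (real n)) - 1) / 4224" by real_asymp
  moreover have "\<forall>\<^sub>F n in sequentially. 1 < log 2 (real n)" by real_asymp
  ultimately have "\<forall>\<^sub>F n in sequentially. 9 \<le> log 2 (log 2 (real n)) \<and>
      log 2 (log 2 (real n)) powr (1/6) \<le> (log 2 (log 2 (real n)) - 1) / 4224 \<and> 1 < log 2 (real n)"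
    by eventually_elim auto
  then obtain n0 where n0: "\<forall>n\<ge>n0. 9 \<le> log 2 (log 2 (real n)) \<and>
      log 2 (log 2 (real n)) powr (1/6) \<le> (log 2 (log 2 (real n)) - 1) / 4224 \<and> 1 < log 2 (real n)"
    unfolding eventually_sequentially by blast
  show ?thesis
  proof (intro exI[of _ "max n0 1"] allI impI)
    fix n assume "max n0 1 \<le> n"
    define L where "L = log 2 (log 2 (real n))"
    have n: "0 < real n" and L: "9 \<le> L" "L powr (1/6) \<le> (L - 1) / 4224" and l: "1 < log 2 (real n)"
      using n0 \<open>max n0 1 \<le> n\<close> unfolding L_def by auto
    \<comment> \<open>The largest \<open>d\<close> with \<open>8 * d + 1 \<le> L\<close>, so that
      the \<open>2 ^ (2 ^ (8 * d + 1))\<close> vertices number at most \<open>n\<close>. The bound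
      \<open>9 \<le> L\<close> gives \<open>1 \<le> d\<close>.\<close>
    define d where "d = nat \<lfloor>(L - 1) / 8\<rfloor>"
    have d: "real d \<le> (L - 1) / 8" "(L - 1) / 8 < real d + 1" "1 \<le> d"
  proof -
      have r: "real d = real_of_int \<lfloor>(L - 1) / 8\<rfloor>" unfolding d_def using L(1) by simp
      show "real d \<le> (L - 1) / 8" "(L - 1) / 8 < real d + 1" unfolding r by linarith+
      then show "1 \<le> d" using L(1) by simp
    qed
    obtain V :: "nat set" and wt dem where V: "card V = 2 ^ (2 ^ (8 * d + 1))" "sc_instance V wt dem"
      "real (d + 1) / 88 \<le> sc_integrality_gap V wt dem" "bes_instance V wt dem (1/2)"
      "real (d + 1) / 528 \<le> bes_integrality_gap V wt dem (1/2)"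
      using cube_gap[OF d(3)] by blast
    have "real (card V) \<le> real n"
    proof -
      have "(2::real) ^ (8 * d + 1) = 2 powr real (8 * d + 1)" by (rule powr_realpow[symmetric]) simp
      also have "\<dots> \<le> 2 powr L" using d(1) by simp
      also have "\<dots> = log 2 (real n)" unfolding L_def using l by (intro powr_log_cancel) auto
      finally have le: "real (2 ^ (8 * d + 1)) \<le> log 2 (real n)"
        by (simp only: of_nat_power of_nat_numeral)
      have "real (card V) = 2 ^ (2 ^ (8 * d + 1))"
        unfolding V(1) by (simp only: of_nat_power of_nat_numeral)
      also have "\<dots> = 2 powr real (2 ^ (8 * d + 1))" by (rule powr_realpow[symmetric]) simp
      also have "\<dots> \<le> 2 powr log 2 (real n)" using le by (rule powr_mono) simp
      also have "\<dots> = real n" using n by (intro powr_log_cancel) auto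
      finally show ?thesis .
    qed
    then have card: "card V \<le> n" by simp
    have "L powr (1/6 - \<delta>) \<le> L powr (1/6)" using L(1) assms by (intro powr_mono) auto
    also have "\<dots> \<le> (L - 1) / 4224" by (rule L(2))
    also have "\<dots> \<le> real (d + 1) / 528" using d(2) by simp
    finally have bound: "L powr (1/6 - \<delta>) \<le> real (d + 1) / 528" .
    then have "L powr (1/6 - \<delta>) \<le> sc_integrality_gap V wt dem"
      "L powr (1/6 - \<delta>) \<le> bes_integrality_gap V wt dem (1/2)"
      using V(3,5) by simp_all
    then show "(\<exists>(V::nat set) wt dem. sc_instance V wt dem \<and> card V \<le> n \<and>
        sc_integrality_gap V wt dem \<ge> log 2 (log 2 (real n)) powr (1/6 - \<delta>)) \<and>
      (\<exists>(V::nat set) wt dem B. bes_instance V wt dem B \<and> card V \<le> n \<and>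
        bes_integrality_gap V wt dem B \<ge> log 2 (log 2 (real n)) powr (1/6 - \<delta>))"
      using V(2,4) card unfolding L_def by blast
  qed
qed

end
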